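(* Let $f=gQ$ with $g\in C(\partial\mathbb{D})$ a positive function and $Q$ a polynomial with complex coefficients. Then for any non-trivial probability measure $\mu$ on $\partial\mathbb{D}$, $$Z_f(\mu)=\lim_{n\to\infty}Z_f(\mu_n),$$ where $\mu_n$ are the Bernstein–Szegő approximations of $\mu$ (the case in which both sides equal $-\infty$ is included).
   Context: $\mathbb{D}=\{|z|<1\}$; a probability measure on $\partial\mathbb{D}$ is non-trivial if its support is infinite; $\partial\mathbb{D}$ is identified with $[0,2\pi)$ via $\theta\mapsto e^{i\theta}$, and $d\mu=w(\theta)\frac{d\theta}{2\pi}+d\mu_{\rm sing}$ with $\mu_{\rm sing}$ singular. For continuous $f$ on $\partial\mathbb{D}$, $Z_f(\mu)=\int_0^{2\pi}|f(e^{i\theta})|^2\log w(\theta)\frac{d\theta}{4\pi}\in[-\infty,\infty)$, with the conventions $\log0=-\infty$, $0\cdot(-\infty)=0$. $\Phi_n$ are the monic orthogonal polynomials of $\mu$, $\Phi_n^*(z)=z^n\overline{\Phi_n(1/\bar z)}$, and the Verblunsky coefficients $\alpha_n\in\mathbb{D}$ ($n\ge0$) are defined by $\Phi_{n+1}(z)=z\Phi_n(z)-\bar\alpha_n\Phi_n^*(z)$. By Verblunsky's theorem, non-trivial probability measures on $\partial\mathbb{D}$ are in one-to-one correspondence with sequences $\{\alpha_n\}_{n\ge0}$ in $\mathbb{D}$. The $n$-th Bernstein–Szegő approximation $\mu_n$ of $\mu$ is the measure with Verblunsky coefficients $\{\alpha_0,\dots,\alpha_n,0,0,\dots\}$. 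*)

theory Defs
  imports
    "HOL-Probability.Probability"
    "HOL-Computational_Algebra.Computational_Algebra"
begin

definition circle_borel :: "complex measure" where
  "circle_borel = restrict_space borel (sphere 0 1)"

definition circle_support :: "complex measure \<Rightarrow> complex set" where
  "circle_support \<mu> =
     {z \<in> sphere 0 1. \<forall>U. open U \<longrightarrow> z \<in> U \<longrightarrow> emeasure \<mu> (U \<inter> sphere 0 1) > 0}"

definition nontrivial_circle_prob :: "complex measure \<Rightarrow> bool" where
  "nontrivial_circle_prob \<mu> \<longleftrightarrow>
     prob_space \<mu> \<and> sets \<mu> = sets circle_borel \<and> infinite (circle_support \<mu>)"

text \<open>\<open>angle_measure c\<close> is the measure \<open>d\<theta> / c\<close> on \<open>[0, 2\<pi>)\<close>; the circle is
  identified with this interval through \<^const>\<open>cis\<close>.\<close>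

definition angle_measure :: "real \<Rightarrow> real measure" where
  "angle_measure c = scale_measure (ennreal (1 / c)) (restrict_space lborel {0..<2 * pi})"

definition circle_lebesgue :: "complex measure" where
  "circle_lebesgue = distr (angle_measure (2 * pi)) circle_borel cis"

definition circle_singular :: "complex measure \<Rightarrow> bool" where
  "circle_singular \<nu> \<longleftrightarrow>
     (\<exists>N \<in> sets circle_borel. emeasure circle_lebesgue N = 0 \<and> emeasure \<nu> (sphere 0 1 - N) = 0)"

text \<open>\<open>is_ac_weight \<mu> w\<close> says that \<open>d\<mu> = w(\<theta>) d\<theta>/(2\<pi>) + d\<mu>\<^sub>s\<^sub>i\<^sub>n\<^sub>g\<close> is the Lebesgue
  decomposition of \<open>\<mu>\<close>. Note that \<^const>\<open>RN_deriv\<close> cannot serve as the weight here: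
  it is zero for measures that are not absolutely continuous.\<close>

definition is_ac_weight :: "complex measure \<Rightarrow> (real \<Rightarrow> real) \<Rightarrow> bool" where
  "is_ac_weight \<mu> w \<longleftrightarrow>
     w \<in> borel_measurable (angle_measure (2 * pi)) \<and>
     (\<forall>\<theta>\<in>{0..<2 * pi}. 0 \<le> w \<theta>) \<and>
     (\<exists>\<mu>_sing. sets \<mu>_sing = sets circle_borel \<and> circle_singular \<mu>_sing \<and>
        (\<forall>A \<in> sets circle_borel.
           emeasure \<mu> A =
             emeasure (distr (density (angle_measure (2 * pi)) (\<lambda>\<theta>. ennreal (w \<theta>)))
                             circle_borel cis) A
             + emeasure \<mu>_sing A))"

text \<open>The weight is determined only almost everywhere; any choice gives the same integrals.\<close>

definition ac_weight :: "complex measure \<Rightarrow> real \<Rightarrow> real" where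
  "ac_weight \<mu> = (SOME w. is_ac_weight \<mu> w)"

definition ln_ext :: "real \<Rightarrow> ereal" where
  "ln_ext x = (if x = 0 then -\<infinity> else ereal (ln x))"

text \<open>Integral of an extended real function as the difference of the integrals of its positive
  and negative parts (\<^const>\<open>e2ennreal\<close> sends negative values to \<open>0\<close>). It is meaningful when
  one of the two is finite; in \<open>Z_functional\<close> below, with \<open>f\<close> continuous on the circle, the
  positive part is integrable because \<open>log w \<le> w\<close>.\<close>

definition ereal_integral :: "'a measure \<Rightarrow> ('a \<Rightarrow> ereal) \<Rightarrow> ereal" where
  "ereal_integral M h =
     enn2ereal (\<integral>\<^sup>+ x. e2ennreal (h x) \<partial>M) - enn2ereal (\<integral>\<^sup>+ x. e2ennreal (- h x) \<partial>M)"

text \<open>In \<^typ>\<open>ereal\<close> one has \<open>0 * (-\<infinity>) = 0\<close>, which is the convention needed at zeros of \<open>f\<close>.\<close>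

definition Z_functional :: "(complex \<Rightarrow> complex) \<Rightarrow> complex measure \<Rightarrow> ereal" where
  "Z_functional f \<mu> =
     ereal_integral (angle_measure (4 * pi))
       (\<lambda>\<theta>. ereal ((norm (f (cis \<theta>)))\<^sup>2) * ln_ext (ac_weight \<mu> \<theta>))"

definition monic_OP :: "complex measure \<Rightarrow> nat \<Rightarrow> complex poly" where
  "monic_OP \<mu> n =
     (THE p. degree p = n \<and> lead_coeff p = 1 \<and>
             (\<forall>k<n. (LINT z|\<mu>. cnj (z ^ k) * poly p z) = 0))"

text \<open>The reversed polynomial \<open>z\<^sup>n * cnj (p (1 / cnj z))\<close>, see \<open>poly_star\<close>.\<close>

definition star_poly :: "nat \<Rightarrow> complex poly \<Rightarrow> complex poly" where
  "star_poly n p = (\<Sum>k\<le>n. monom (cnj (coeff p (n - k))) k)"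

lemma poly_star:
  assumes "degree p \<le> n" "z \<noteq> 0"
  shows "poly (star_poly n p) z = z ^ n * cnj (poly p (1 / cnj z))"
proof -
  have "poly p (1 / cnj z) = (\<Sum>k\<le>n. coeff p k * (1 / cnj z) ^ k)"
    by (subst poly_altdef)
      (rule sum.mono_neutral_left, use assms in \<open>auto simp: coeff_eq_0\<close>)
  then have "z ^ n * cnj (poly p (1 / cnj z)) = (\<Sum>k\<le>n. cnj (coeff p k) * (z ^ n * (1 / z) ^ k))"
    by (simp add: sum_distrib_left mult_ac)
  also have "\<dots> = (\<Sum>k\<le>n. cnj (coeff p k) * z ^ (n - k))"
    by (rule sum.cong) (use assms in \<open>auto simp: power_diff power_one_over field_simps\<close>)
  also have "\<dots> = (\<Sum>k\<le>n. cnj (coeff p (n - k)) * z ^ k)"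
    by (rule sum.reindex_bij_witness[where i = "\<lambda>k. n - k" and j = "\<lambda>k. n - k"]) auto
  finally show ?thesis
    by (simp add: star_poly_def poly_sum poly_monom)
qed

definition verblunsky :: "complex measure \<Rightarrow> nat \<Rightarrow> complex" where
  "verblunsky \<mu> n =
     (THE a. monic_OP \<mu> (Suc n) =
               pCons 0 (monic_OP \<mu> n) - smult (cnj a) (star_poly n (monic_OP \<mu> n)))"

text \<open>Well defined by Verblunsky's theorem.\<close>

definition bernstein_szego :: "complex measure \<Rightarrow> nat \<Rightarrow> complex measure" where
  "bernstein_szego \<mu> n =
     (THE \<nu>. nontrivial_circle_prob \<nu> \<and>
             (\<forall>k. verblunsky \<nu> k = (if k \<le> n then verblunsky \<mu> k else 0)))"

end

theory Submission
  imports Defs "HOL-Complex_Analysis.Cauchy_Integral_Formula"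
begin

text \<open>
  Write \<open>w\<close> and \<open>w\<^sub>n\<close> for the weights of \<open>\<mu>\<close> and \<open>\<mu>\<^sub>n\<close>, and \<open>F = |f|\<^sup>2\<close>. The measure \<open>\<mu>\<^sub>n\<close> is absolutely
  continuous with \<open>w\<^sub>n = 1 / |\<phi>|\<^sup>2\<close>, where \<open>\<phi>\<close> is the normalised orthogonal polynomial of degree \<open>n + 1\<close>
  (\<open>bernstein_szego_eq\<close>). Two facts follow: \<open>\<mu>\<^sub>n \<rightarrow> \<mu>\<close> weakly, because the moments up to order \<open>n + 1\<close> agree
  (\<open>bernstein_szego_weak_convergence\<close>), and the ratio \<open>r\<^sub>n = w/w\<^sub>n = w |\<phi>|\<^sup>2\<close> has integral at most \<open>1\<close>
  (\<open>ratio_integral_le_1\<close>).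

  Upper bound (\<open>log_weight_upper\<close>). For a continuous function \<open>h > 0\<close> integrate
  \<open>F log w\<^sub>n \<le> F (w\<^sub>n h - 1 - log h)\<close> and let \<open>n \<rightarrow> \<infinity>\<close>. The limit of the right-hand side extends to bounded
  Borel functions \<open>h\<close>; for truncations of \<open>1/w\<close> that are small on a null set carrying the singular part
  it comes down to the integral of \<open>F log w\<close>, also when this is \<open>-\<infinity>\<close>.

  Lower bound (\<open>log_weight_lower\<close>). If the functional is not \<open>-\<infinity>\<close> at \<open>\<mu>\<close> and \<open>f\<close> vanishes only on a null set,
  then \<open>w > 0\<close> almost everywhere. In this situation the integral of \<open>G r\<^sub>n\<close> is asymptotically at least
  that of \<open>G\<close> for every continuous \<open>G \<ge> 0\<close> (\<open>ratio_defect\<close>): by \<open>r\<^sub>n + w\<^sub>n h \<ge> 2 sqrt (w h)\<close> and weak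
  convergence, with \<open>h\<close> close to \<open>1/w\<close>. Taking \<open>G = B - F\<close> for an upper bound \<open>B\<close> of \<open>F\<close> and using that
  \<open>r\<^sub>n\<close> has integral at most \<open>1\<close>, the integral of \<open>F (r\<^sub>n - 1) \<ge> F log r\<^sub>n = F (log w - log w\<^sub>n)\<close> is
  asymptotically nonpositive. The step replaces an appeal to Rakhmanov's theorem: convergence of
  the Verblunsky coefficients to zero is not needed.
\<close>

section \<open>The circle and its normalised Lebesgue measure\<close>

text \<open>Normalised Lebesgue measure on \<open>[0, 2\<pi>)\<close>; the circle is parametrised by \<^const>\<open>cis\<close>, with
  inverse \<^const>\<open>Arg2pi\<close>.\<close>

abbreviation angle_prob :: "real measure" where
  "angle_prob \<equiv> angle_measure (2 * pi)"

lemma space_angle_measure [simp]: "space (angle_measure c) = {0..<2 * pi}"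
  by (simp add: angle_measure_def space_scale_measure space_restrict_space)

lemma sets_angle_measure [measurable_cong]:
  "sets (angle_measure c) = sets (restrict_space borel {0..<2 * pi})"
  by (simp add: angle_measure_def sets_restrict_space)

lemma space_circle_borel [simp]: "space circle_borel = sphere 0 1"
  by (simp add: circle_borel_def space_restrict_space)

lemma space_circle_measure:
  "sets \<mu> = sets circle_borel \<Longrightarrow> space \<mu> = sphere 0 1"
  by (metis sets_eq_imp_space_eq space_circle_borel)

lemma angle_measure_eq_density:
  assumes "c > 0"
  shows "angle_measure c = density (restrict_space lborel {0..<2 * pi}) (\<lambda>_. ennreal (1 / c))"
  by (rule measure_eqI) (auto simp: angle_measure_def emeasure_density_const)

lemma emeasure_angle_prob:
  assumes "A \<in> sets angle_prob"
  shows "emeasure angle_prob A = ennreal (1 / (2 * pi)) * emeasure lborel A"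
proof -
  have "A \<subseteq> {0..<2 * pi}"
    using sets.sets_into_space[OF assms] by simp
  then show ?thesis
    using assms by (simp add: angle_measure_def emeasure_restrict_space)
qed

interpretation angle_prob: prob_space angle_prob
proof
  have "{0..<2 * pi} \<in> sets angle_prob"
    using sets.top[of angle_prob] by simp
  then have "emeasure angle_prob (space angle_prob) = ennreal (1 / (2 * pi)) * ennreal (2 * pi)"
    by (subst emeasure_angle_prob) auto
  also have "\<dots> = 1"
    by (subst ennreal_mult[symmetric]) auto
  finally show "emeasure angle_prob (space angle_prob) = 1" .
qed

lemma angle_measure_4pi: "angle_measure (4 * pi) = scale_measure (ennreal (1 / 2)) angle_prob"
proof -
  have "ennreal (1 / (4 * pi)) = ennreal (1 / 2) * ennreal (1 / (2 * pi))"
    by (subst ennreal_mult[symmetric]) auto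
  then show ?thesis
    by (simp only: angle_measure_def scale_scale_measure)
qed

lemma cis_measurable [measurable]: "cis \<in> measurable angle_prob circle_borel"
proof -
  have "cis \<in> borel_measurable borel"
    by (intro borel_measurable_continuous_onI continuous_intros)
  then have "cis \<in> measurable (restrict_space borel {0..<2 * pi}) borel"
    by (rule measurable_restrict_space1)
  then show ?thesis
    unfolding circle_borel_def
    by (intro measurable_restrict_space2) (auto simp: measurable_cong_sets[OF sets_angle_measure refl])
qed

lemma cis_Arg2pi: "z \<in> sphere 0 1 \<Longrightarrow> cis (Arg2pi z) = z"
  using complex_norm_eq_1_exp[of z] by (simp add: cis_conv_exp)

lemma Arg2pi_cis: "\<theta> \<in> {0..<2 * pi} \<Longrightarrow> Arg2pi (cis \<theta>) = \<theta>"
  by (intro Arg2pi_unique[of 1]) (auto simp: cis_conv_exp)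

lemma Arg2pi_measurable [measurable]: "Arg2pi \<in> measurable circle_borel angle_prob"
proof -
  have "(\<lambda>z. if z = 1 then 0 else Im (Ln (- z)) + pi) \<in> borel_measurable circle_borel"
  proof (subst measurable_If_restrict_space_iff, safe)
    show "{z \<in> space circle_borel. z = 1} \<in> sets circle_borel"
      by (auto simp: circle_borel_def sets_restrict_space image_iff intro!: bexI[of _ "{1}"])
    have "restrict_space circle_borel {x. x \<noteq> 1} = restrict_space borel (sphere 0 1 \<inter> {x. x \<noteq> (1::complex)})"
      unfolding circle_borel_def
      by (subst restrict_restrict_space) auto
    moreover have "continuous_on (sphere 0 1 \<inter> {x. x \<noteq> (1::complex)}) (\<lambda>z. Im (Ln (- z)) + pi)"
    proof (intro continuous_intros)
      fix z :: complex assume z: "z \<in> sphere 0 1 \<inter> {x. x \<noteq> 1}"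
      show "- z \<notin> \<real>\<^sub>\<le>\<^sub>0"
      proof
        assume "- z \<in> \<real>\<^sub>\<le>\<^sub>0"
        then have "z \<in> \<real>" "Re z \<ge> 0"
          by (auto simp: complex_nonpos_Reals_iff complex_is_Real_iff)
        then have "Re z = cmod z"
          by (simp add: in_Reals_norm complex_is_Real_iff cmod_def)
        with \<open>z \<in> \<real>\<close> z show False
          by (auto simp: complex_eq_iff complex_is_Real_iff)
      qed
    qed
    ultimately show "(\<lambda>z. Im (Ln (- z)) + pi) \<in> borel_measurable (restrict_space circle_borel {x. x \<noteq> 1})"
      by (simp add: borel_measurable_continuous_on_restrict)
  qed auto
  also have "?this \<longleftrightarrow> Arg2pi \<in> borel_measurable circle_borel"
  proof (rule measurable_cong)
    fix z :: complex assume z: "z \<in> space circle_borel"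
    show "(if z = 1 then 0 else Im (Ln (- z)) + pi) = Arg2pi z"
    proof (cases "z = 1")
      case False
      have "Arg2pi z \<noteq> 0"
        using z False cis_Arg2pi[of z] by auto
      then show ?thesis
        using False Arg2pi_Ln[of z] Arg2pi_ge_0[of z] by auto
    qed (use Arg2pi_of_real[of 1] in auto)
  qed
  finally have "Arg2pi \<in> measurable circle_borel (restrict_space borel {0..<2 * pi})"
    by (intro measurable_restrict_space2) (auto simp: Arg2pi_ge_0 Arg2pi_lt_2pi)
  then show ?thesis
    by (simp add: measurable_cong_sets[OF refl sets_angle_measure])
qed

lemma circle_continuous_measurable:
  assumes "sets \<mu> = sets circle_borel" "continuous_on (sphere 0 1) (h :: complex \<Rightarrow> 'b :: topological_space)"
  shows "h \<in> borel_measurable \<mu>"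
  using assms
  by (simp add: borel_measurable_continuous_on_restrict circle_borel_def measurable_cong_sets[OF assms(1) refl])

lemma circle_continuous_bounded:
  fixes h :: "complex \<Rightarrow> 'b :: real_normed_vector"
  assumes "continuous_on (sphere 0 1) h"
  obtains B where "B > 0" "\<And>z. z \<in> sphere 0 1 \<Longrightarrow> norm (h z) \<le> B"
proof -
  have "bounded (h ` sphere 0 1)"
    using assms by (intro compact_imp_bounded compact_continuous_image) auto
  then show ?thesis
    using that by (auto simp: bounded_pos)
qed

lemma circle_continuous_integrable:
  fixes h :: "complex \<Rightarrow> 'b :: {banach, second_countable_topology}"
  assumes "finite_measure \<mu>" "sets \<mu> = sets circle_borel" "continuous_on (sphere 0 1) h"
  shows "integrable \<mu> h"
proof -
  interpret finite_measure \<mu> by fact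
  obtain B where "\<And>z. z \<in> sphere 0 1 \<Longrightarrow> norm (h z) \<le> B"
    using circle_continuous_bounded assms(3) by blast
  then show ?thesis
    using assms circle_continuous_measurable
    by (intro integrable_const_bound[of _ B]) (auto simp: space_circle_measure[OF assms(2)])
qed

lemma circle_comp_measurable:
  assumes "continuous_on (sphere 0 1) (h :: complex \<Rightarrow> 'b :: topological_space)"
  shows "(\<lambda>\<theta>. h (cis \<theta>)) \<in> borel_measurable angle_prob"
  using measurable_comp[OF cis_measurable circle_continuous_measurable[OF refl assms]]
  by (simp add: comp_def)

lemma circle_comp_integrable:
  fixes h :: "complex \<Rightarrow> 'b :: {banach, second_countable_topology}"
  assumes "continuous_on (sphere 0 1) h"
  shows "integrable angle_prob (\<lambda>\<theta>. h (cis \<theta>))"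
proof -
  obtain B where "\<And>z. z \<in> sphere 0 1 \<Longrightarrow> norm (h z) \<le> B"
    using circle_continuous_bounded assms by blast
  then show ?thesis
    using assms circle_comp_measurable
    by (intro angle_prob.integrable_const_bound[of _ B]) auto
qed

text \<open>The mean value property, from Cauchy's integral formula.\<close>

lemma mean_value_circle:
  assumes "F holomorphic_on cball 0 1"
  shows "(\<integral>\<theta>. F (cis \<theta>) \<partial>angle_prob) = F 0"
proof -
  have c: "continuous_on (sphere 0 1) F"
    by (rule continuous_on_subset[OF holomorphic_on_imp_continuous_on[OF assms]]) auto
  have "((\<lambda>u. F u / (u - 0)) has_contour_integral (2 * of_real pi * \<i> * F 0)) (circlepath 0 1)"
    using Cauchy_integral_circlepath_simple[OF assms, of 0] by simp
  then have "((\<lambda>t. F (cis t) / cis t * \<i> * cis t) has_integral (2 * of_real pi * \<i> * F 0)) {0..2 * pi}"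
    unfolding circlepath_def by (subst (asm) has_contour_integral_part_circlepath_iff) auto
  then have "((\<lambda>t. \<i> * F (cis t)) has_integral (2 * of_real pi * \<i> * F 0)) {0..2 * pi}"
    by (simp add: field_simps)
  then have "((\<lambda>t. (-\<i>) * (\<i> * F (cis t))) has_integral (-\<i>) * (2 * of_real pi * \<i> * F 0)) {0..2 * pi}"
    by (rule has_integral_mult_right)
  then have "((\<lambda>t. F (cis t)) has_integral (2 * of_real pi * F 0)) {0..2 * pi}"
    by (simp add: mult_ac)
  then have *: "((\<lambda>t. F (cis t)) has_integral (2 * of_real pi * F 0)) {0..<2 * pi}"
    by (subst (asm) has_integral_spike_set_eq[where T = "{0..<2 * pi}"])
       (auto intro!: negligible_subset[OF negligible_sing[of "2 * pi"]])
  have i: "set_integrable lborel {0..<2 * pi} (\<lambda>t. F (cis t))"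
  proof (rule set_integrable_subset)
    show "set_integrable lborel {0..2 * pi} (\<lambda>t. F (cis t))"
      by (intro borel_integrable_compact[folded set_integrable_def] borel_integrable_atLeastAtMost'
            continuous_on_compose2[OF c] continuous_intros) auto
  qed auto
  have "(\<integral>\<theta>. F (cis \<theta>) \<partial>angle_prob) = (1 / (2 * pi)) *\<^sub>R (\<integral>\<theta>. F (cis \<theta>) \<partial>restrict_space lborel {0..<2 * pi})"
  proof -
    have "(\<lambda>\<theta>. F (cis \<theta>)) \<in> borel_measurable (restrict_space lborel {0..<2 * pi})"
      using circle_comp_measurable[OF c]
      by (simp add: measurable_def sets_angle_measure space_restrict_space sets_restrict_space)
    then show ?thesis
      by (simp add: angle_measure_eq_density integral_density)
  qed
  also have "(\<integral>\<theta>. F (cis \<theta>) \<partial>restrict_space lborel {0..<2 * pi}) = (LINT \<theta>:{0..<2 * pi}|lborel. F (cis \<theta>))"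
    by (simp add: integral_restrict_space set_lebesgue_integral_def)
  also have "\<dots> = 2 * of_real pi * F 0"
    using set_borel_integral_eq_integral(2)[OF i] * by (simp add: integral_unique)
  finally show ?thesis by (simp add: scaleR_conv_of_real)
qed

section \<open>Orthogonal polynomials and the Szego recursion\<close>

text \<open>The inner product of \<open>L\<^sup>2(\<mu>)\<close> restricted to polynomials, conjugate linear in the first
  argument, and the square of its norm.\<close>

definition circle_inner :: "complex measure \<Rightarrow> complex poly \<Rightarrow> complex poly \<Rightarrow> complex" where
  "circle_inner \<mu> p q = (LINT z|\<mu>. cnj (poly p z) * poly q z)"

definition circle_sqnorm :: "complex measure \<Rightarrow> complex poly \<Rightarrow> real" where
  "circle_sqnorm \<mu> p = (LINT z|\<mu>. (norm (poly p z))\<^sup>2)"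

text \<open>The characterisation of the monic orthogonal polynomial of degree \<open>n\<close>, as a predicate.\<close>

definition is_monic_OP :: "complex measure \<Rightarrow> nat \<Rightarrow> complex poly \<Rightarrow> bool" where
  "is_monic_OP \<mu> n p \<longleftrightarrow>
     degree p = n \<and> lead_coeff p = 1 \<and> (\<forall>k<n. circle_inner \<mu> (monom 1 k) p = 0)"

lemma coeff_star_poly: "coeff (star_poly n p) k = (if k \<le> n then cnj (coeff p (n - k)) else 0)"
  by (simp add: star_poly_def coeff_sum)

lemma degree_star_poly: "degree (star_poly n p) \<le> n"
  by (intro degree_le) (simp add: coeff_star_poly)

text \<open>On the circle \<open>1 / cnj z = z\<close>.\<close>

lemma poly_star_circle:
  assumes "degree p \<le> n" "z \<in> sphere 0 1"
  shows "poly (star_poly n p) z = z ^ n * cnj (poly p z)"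
proof -
  have "z * cnj z = 1"
    using assms by (simp add: complex_norm_square[symmetric])
  then have "1 / cnj z = z"
    by (auto simp: divide_simps mult_ac)
  then show ?thesis
    using assms poly_star[of p n z] by fastforce
qed

text \<open>A non-trivial probability measure on the circle, with its monic orthogonal polynomials \<open>\<Phi>\<close> and
  Verblunsky coefficients \<open>\<alpha>\<close>.\<close>

locale nontrivial_circle =
  fixes \<mu> :: "complex measure"
  assumes nontrivial: "nontrivial_circle_prob \<mu>"

sublocale nontrivial_circle \<subseteq> prob_space \<mu>
  using nontrivial by (simp add: nontrivial_circle_prob_def)

context nontrivial_circle
begin

lemma sets_eq [measurable_cong]: "sets \<mu> = sets circle_borel"
  using nontrivial by (simp add: nontrivial_circle_prob_def)

lemma space_eq [simp]: "space \<mu> = sphere 0 1"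
  by (rule space_circle_measure[OF sets_eq])

lemma continuous_integrable:
  fixes h :: "complex \<Rightarrow> 'b :: {banach, second_countable_topology}"
  shows "continuous_on (sphere 0 1) h \<Longrightarrow> integrable \<mu> h"
  by (rule circle_continuous_integrable[OF finite_measure_axioms sets_eq])

lemma inner_integrable: "integrable \<mu> (\<lambda>z. cnj (poly p z) * poly q z)"
  by (intro continuous_integrable continuous_intros)

abbreviation inner where "inner \<equiv> circle_inner \<mu>"
abbreviation sqnorm where "sqnorm \<equiv> circle_sqnorm \<mu>"

lemma inner_add_right: "inner p (q + r) = inner p q + inner p r"
  unfolding circle_inner_def
  by (subst Bochner_Integration.integral_add[symmetric, OF inner_integrable inner_integrable])
     (simp add: algebra_simps)

lemma inner_smult_right: "inner p (smult c q) = c * inner p q"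
  unfolding circle_inner_def
  by (subst integral_mult_right_zero[symmetric]) (simp add: algebra_simps)

lemma inner_diff_right: "inner p (q - r) = inner p q - inner p r"
  using inner_add_right[of p q "smult (-1) r"] inner_smult_right[of p "-1" r] by simp

lemma inner_commute: "inner q p = cnj (inner p q)"
  unfolding circle_inner_def by (subst Bochner_Integration.integral_cnj[symmetric]) (simp add: mult_ac)

lemma inner_add_left: "inner (p + q) r = inner p r + inner q r"
  using inner_add_right[of r p q] by (metis inner_commute complex_cnj_add)

lemma inner_smult_left: "inner (smult c p) q = cnj c * inner p q"
  using inner_smult_right[of q c p] by (metis inner_commute complex_cnj_mult)

lemma inner_diff_left: "inner (p - q) r = inner p r - inner q r"
  using inner_diff_right[of r p q] by (metis inner_commute complex_cnj_diff)

lemma inner_sum_left: "inner (\<Sum>k\<in>A. p k) q = (\<Sum>k\<in>A. inner (p k) q)"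
proof (induction A rule: infinite_finite_induct)
  case (insert x F)
  then show ?case by (simp add: inner_add_left)
qed (simp_all add: circle_inner_def)

lemma inner_expand_left:
  "inner p q = (\<Sum>k\<le>degree p. cnj (coeff p k) * inner (monom 1 k) q)"
proof -
  have "p = (\<Sum>k\<le>degree p. smult (coeff p k) (monom 1 k))"
    by (simp add: smult_monom poly_as_sum_of_monoms)
  then have "inner p q = inner (\<Sum>k\<le>degree p. smult (coeff p k) (monom 1 k)) q"
    by simp
  then show ?thesis
    by (simp only: inner_sum_left inner_smult_left)
qed

lemma inner_self: "inner p p = of_real (sqnorm p)"
proof -
  have "inner p p = (LINT z|\<mu>. of_real ((norm (poly p z))\<^sup>2))"
    unfolding circle_inner_def
    by (simp add: complex_norm_square mult.commute del: of_real_power)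
  then show ?thesis
    by (simp add: circle_sqnorm_def del: of_real_power)
qed

lemma sqnorm_nonneg: "0 \<le> sqnorm p"
  by (simp add: circle_sqnorm_def)

lemma inner_pCons: "inner (pCons 0 p) (pCons 0 q) = inner p q"
  unfolding circle_inner_def
proof (rule Bochner_Integration.integral_cong[OF refl])
  fix z assume "z \<in> space \<mu>"
  then have "z * cnj z = 1"
    by (simp add: complex_norm_square[symmetric])
  then show "cnj (poly (pCons 0 p) z) * poly (pCons 0 q) z = cnj (poly p z) * poly q z"
    by (simp add: mult.left_commute mult.commute)
qed

lemma sqnorm_pCons: "sqnorm (pCons 0 p) = sqnorm p"
  using inner_pCons[of p p] by (simp add: inner_self)

lemma sqnorm_smult: "sqnorm (smult c p) = (norm c)\<^sup>2 * sqnorm p"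
  by (simp add: circle_sqnorm_def norm_mult power_mult_distrib)

lemma sqnorm_add_orth:
  assumes "inner p q = 0"
  shows "sqnorm (p + q) = sqnorm p + sqnorm q"
proof -
  have "inner q p = 0"
    using inner_commute[of q p] assms by simp
  then have "inner (p + q) (p + q) = inner p p + inner q q"
    by (simp add: inner_add_left inner_add_right assms)
  then show ?thesis
    by (simp add: inner_self flip: of_real_add)
qed

text \<open>A polynomial has only finitely many zeros, so it cannot vanish almost everywhere
  with respect to a measure of infinite support.\<close>

lemma sqnorm_pos:
  assumes "p \<noteq> 0"
  shows "sqnorm p > 0"
proof (rule ccontr)
  assume "\<not> sqnorm p > 0"
  then have "(LINT z|\<mu>. (norm (poly p z))\<^sup>2) = 0"
    using sqnorm_nonneg[of p] unfolding circle_sqnorm_def by linarith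
  moreover have "integrable \<mu> (\<lambda>z. (norm (poly p z))\<^sup>2)"
    by (intro continuous_integrable continuous_intros)
  ultimately have ae: "AE z in \<mu>. poly p z = 0"
    by (subst (asm) integral_nonneg_eq_0_iff_AE) auto
  have "circle_support \<mu> \<subseteq> {z. poly p z = 0}"
  proof
    fix z assume z: "z \<in> circle_support \<mu>"
    show "z \<in> {z. poly p z = 0}"
    proof (rule ccontr)
      assume "z \<notin> {z. poly p z = 0}"
      let ?U = "- {z. poly p z = 0}"
      have "open ?U"
        using assms by (intro open_Compl finite_imp_closed poly_roots_finite)
      with z \<open>z \<notin> _\<close> have "emeasure \<mu> (?U \<inter> sphere 0 1) > 0"
        by (auto simp: circle_support_def)
      moreover have "?U \<inter> sphere 0 1 = {z \<in> space \<mu>. \<not> poly p z = 0}"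
        by auto
      moreover have "emeasure \<mu> {z \<in> space \<mu>. \<not> poly p z = 0} = 0"
        using ae by (intro emeasure_eq_0_AE) auto
      ultimately show False
        by simp
    qed
  qed
  then have "finite (circle_support \<mu>)"
    using assms poly_roots_finite finite_subset by blast
  then show False
    using nontrivial by (simp add: nontrivial_circle_prob_def)
qed

text \<open>The zero polynomial is listed separately because its degree is \<open>0\<close>, which is not below \<open>n = 0\<close>.\<close>

lemma monic_OP_orth:
  assumes "is_monic_OP \<mu> n p" "degree q < n \<or> q = 0"
  shows "inner q p = 0"
proof (cases "q = 0")
  case True
  then show ?thesis by (simp add: circle_inner_def)
next
  case False
  then show ?thesis
    using assms by (subst inner_expand_left) (auto simp: is_monic_OP_def)
qed

lemma degree_monic_diff:
  fixes p q :: "complex poly"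
  assumes "degree p = n" "degree q = n" "coeff p n = coeff q n"
  shows "degree (p - q) < n \<or> p - q = 0"
proof (cases "n = 0")
  case True
  then show ?thesis
    using assms by (auto elim!: degree_eq_zeroE)
next
  case False
  then have "degree (p - q) < n"
    using assms by (intro degree_lessI) (auto simp: coeff_eq_0 order_le_less)
  then show ?thesis ..
qed

lemma monic_OP_unique:
  assumes "is_monic_OP \<mu> n p" "is_monic_OP \<mu> n q"
  shows "p = q"
proof -
  have d: "degree (p - q) < n \<or> p - q = 0"
    using assms by (intro degree_monic_diff) (auto simp: is_monic_OP_def)
  have "inner (p - q) (p - q) = 0"
    unfolding inner_diff_right using monic_OP_orth[OF assms(1) d] monic_OP_orth[OF assms(2) d] by simp
  then have "sqnorm (p - q) = 0"
    by (simp add: inner_self)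
  then show ?thesis
    using sqnorm_pos[of "p - q"] by auto
qed

lemma monic_OP_inner_monom:
  assumes "is_monic_OP \<mu> n p"
  shows "inner (monom 1 n) p = of_real (sqnorm p)"
proof -
  have "degree (p - monom 1 n) < n \<or> p - monom 1 n = 0"
    using assms by (intro degree_monic_diff) (auto simp: is_monic_OP_def degree_monom_eq)
  then have "inner (p - monom 1 n) p = 0"
    by (rule monic_OP_orth[OF assms])
  then show ?thesis
    by (simp add: inner_diff_left inner_self)
qed

lemma inner_monom_star:
  assumes "degree p \<le> n" "k \<le> n"
  shows "inner (monom 1 k) (star_poly n p) = cnj (inner (monom 1 (n - k)) p)"
  unfolding circle_inner_def Bochner_Integration.integral_cnj[symmetric]
proof (rule Bochner_Integration.integral_cong[OF refl])
  fix z assume z: "z \<in> space \<mu>"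
  then have "cnj z * z = 1"
    by (simp add: complex_norm_square[symmetric] mult.commute)
  then have "cnj z ^ k * z ^ k = 1"
    by (simp flip: power_mult_distrib)
  moreover have "z ^ n = z ^ k * z ^ (n - k)"
    using assms by (simp flip: power_add)
  ultimately have "cnj z ^ k * z ^ n = z ^ (n - k)"
    by (metis mult.assoc mult_1)
  then show "cnj (poly (monom 1 k) z) * poly (star_poly n p) z =
      cnj (cnj (poly (monom 1 (n - k)) z) * poly p z)"
    using z assms by (simp add: poly_star_circle poly_monom mult.assoc[symmetric])
qed

lemma sqnorm_star:
  assumes "degree p \<le> n"
  shows "sqnorm (star_poly n p) = sqnorm p"
  unfolding circle_sqnorm_def
  by (rule Bochner_Integration.integral_cong[OF refl])
     (use assms in \<open>simp add: poly_star_circle norm_mult norm_power\<close>)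

text \<open>One step of the recursion. Both \<open>z p\<close> and \<open>p\<^sup>*\<close> are orthogonal to \<open>z, \<dots>, z\<^sup>n\<close>, and the coefficient
  is chosen to make the combination orthogonal to \<open>1\<close> as well. This gives the existence of the
  orthogonal polynomials along with the recursion.\<close>

lemma szego_step:
  assumes "is_monic_OP \<mu> n p"
  obtains a where "is_monic_OP \<mu> (Suc n) (pCons 0 p - smult (cnj a) (star_poly n p))"
proof -
  have p: "degree p = n" "lead_coeff p = 1" "\<And>k. k < n \<Longrightarrow> inner (monom 1 k) p = 0"
    using assms by (auto simp: is_monic_OP_def)
  have "p \<noteq> 0"
    using p by auto
  then have pos: "sqnorm p > 0"
    by (rule sqnorm_pos)
  define a where "a = cnj (inner 1 (pCons 0 p) / of_real (sqnorm p))"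
  let ?q = "pCons 0 p - smult (cnj a) (star_poly n p)"
  have "degree (smult (cnj a) (star_poly n p)) < degree (pCons 0 p)"
    using \<open>p \<noteq> 0\<close> degree_star_poly[of n p] degree_smult_le[of "cnj a" "star_poly n p"] p by simp
  then have "degree ?q = Suc n"
    using \<open>p \<noteq> 0\<close> p by (simp add: diff_conv_add_uminus degree_add_eq_left del: add_uminus_conv_diff)
  moreover have "coeff ?q (Suc n) = 1"
    using p by (simp add: coeff_star_poly)
  moreover have "inner (monom 1 k) ?q = 0" if "k < Suc n" for k
  proof (cases k)
    case 0
    have "inner 1 (star_poly n p) = of_real (sqnorm p)"
      using inner_monom_star[of p n 0] monic_OP_inner_monom[OF assms] p by (simp add: one_pCons monom_0)
    then show ?thesis
      using 0 pos by (simp add: inner_diff_right inner_smult_right a_def one_pCons[symmetric] monom_0)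
  next
    case (Suc j)
    have "inner (monom 1 (Suc j)) (pCons 0 p) = inner (monom 1 j) p"
      by (simp add: monom_Suc inner_pCons)
    also have "\<dots> = 0"
      using p Suc that by simp
    moreover have "inner (monom 1 k) (star_poly n p) = 0"
      using inner_monom_star[of p n k] p Suc that by simp
    ultimately show ?thesis
      using Suc by (simp add: inner_diff_right inner_smult_right)
  qed
  ultimately show ?thesis
    by (intro that[of a]) (simp add: is_monic_OP_def)
qed

lemma monic_OP_exists: "\<exists>p. is_monic_OP \<mu> n p"
proof (induction n)
  case 0
  show ?case
    by (rule exI[of _ 1]) (simp add: is_monic_OP_def)
next
  case (Suc n)
  then show ?case
    using szego_step by blast
qed

abbreviation \<Phi> where "\<Phi> \<equiv> monic_OP \<mu>"
abbreviation \<alpha> where "\<alpha> \<equiv> verblunsky \<mu>"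

lemma monic_OP_eqI: "is_monic_OP \<mu> n p \<Longrightarrow> \<Phi> n = p"
proof -
  have *: "monic_OP \<mu> n = (THE p. is_monic_OP \<mu> n p)"
    unfolding monic_OP_def is_monic_OP_def circle_inner_def by (simp add: poly_monom)
  show "\<Phi> n = p" if "is_monic_OP \<mu> n p"
    unfolding * using that monic_OP_unique by blast
qed

lemma is_monic_OP_monic_OP: "is_monic_OP \<mu> n (\<Phi> n)"
  using monic_OP_exists monic_OP_eqI by blast

lemma degree_monic_OP [simp]: "degree (\<Phi> n) = n"
  and lead_coeff_monic_OP: "coeff (\<Phi> n) n = 1"
  using is_monic_OP_monic_OP[of n] by (auto simp: is_monic_OP_def)

lemma monic_OP_neq_0 [simp]: "\<Phi> n \<noteq> 0"
  using lead_coeff_monic_OP[of n] by auto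

lemma monic_OP_0: "\<Phi> 0 = 1"
  by (rule monic_OP_eqI) (simp add: is_monic_OP_def)

lemma coeff_0_star_monic_OP: "coeff (star_poly n (\<Phi> n)) 0 = 1"
  using lead_coeff_monic_OP[of n] by (simp add: coeff_star_poly)

lemma verblunsky_eqI:
  assumes "\<Phi> (Suc n) = pCons 0 (\<Phi> n) - smult (cnj a) (star_poly n (\<Phi> n))"
  shows "\<alpha> n = a"
  unfolding verblunsky_def
proof (rule the_equality)
  show "b = a" if "\<Phi> (Suc n) = pCons 0 (\<Phi> n) - smult (cnj b) (star_poly n (\<Phi> n))" for b
    using arg_cong[OF trans[OF that[symmetric] assms], of "\<lambda>p. coeff p 0"]
    by (simp add: coeff_0_star_monic_OP)
qed fact

lemma szego_recursion: "\<Phi> (Suc n) = pCons 0 (\<Phi> n) - smult (cnj (\<alpha> n)) (star_poly n (\<Phi> n))"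
proof -
  obtain a where "is_monic_OP \<mu> (Suc n) (pCons 0 (\<Phi> n) - smult (cnj a) (star_poly n (\<Phi> n)))"
    using szego_step is_monic_OP_monic_OP by blast
  then have "\<Phi> (Suc n) = pCons 0 (\<Phi> n) - smult (cnj a) (star_poly n (\<Phi> n))"
    by (rule monic_OP_eqI)
  with verblunsky_eqI show ?thesis
    by metis
qed

text \<open>Pythagoras for \<open>z \<Phi>\<^sub>n = \<Phi>\<^sub>n\<^sub>+\<^sub>1 + cnj \<alpha>\<^sub>n \<Phi>\<^sub>n\<^sup>*\<close>.\<close>

lemma sqnorm_monic_OP_Suc: "sqnorm (\<Phi> (Suc n)) = (1 - (norm (\<alpha> n))\<^sup>2) * sqnorm (\<Phi> n)"
proof -
  let ?s = "smult (cnj (\<alpha> n)) (star_poly n (\<Phi> n))"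
  have "inner ?s (\<Phi> (Suc n)) = 0"
    using degree_star_poly[of n "\<Phi> n"] degree_smult_le[of "cnj (\<alpha> n)" "star_poly n (\<Phi> n)"]
    by (intro monic_OP_orth[OF is_monic_OP_monic_OP]) linarith
  then have "sqnorm (?s + \<Phi> (Suc n)) = sqnorm ?s + sqnorm (\<Phi> (Suc n))"
    by (rule sqnorm_add_orth)
  moreover have "?s + \<Phi> (Suc n) = pCons 0 (\<Phi> n)"
    by (simp add: szego_recursion)
  ultimately have "sqnorm (\<Phi> n) = (norm (\<alpha> n))\<^sup>2 * sqnorm (\<Phi> n) + sqnorm (\<Phi> (Suc n))"
    by (simp add: sqnorm_pCons sqnorm_smult sqnorm_star)
  then show ?thesis
    by (simp add: algebra_simps)
qed

lemma norm_verblunsky_less_1: "norm (\<alpha> n) < 1"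
proof -
  have "(1 - (norm (\<alpha> n))\<^sup>2) * sqnorm (\<Phi> n) > 0"
    using sqnorm_pos[of "\<Phi> (Suc n)"] by (simp add: sqnorm_monic_OP_Suc)
  then have "(norm (\<alpha> n))\<^sup>2 < 1"
    using sqnorm_pos[of "\<Phi> n"] by (simp add: zero_less_mult_iff)
  then show ?thesis
    by (simp add: power_less_one_iff abs_square_less_1)
qed

lemma sqnorm_monic_OP: "sqnorm (\<Phi> n) = (\<Prod>k<n. 1 - (norm (\<alpha> k))\<^sup>2)"
proof (induction n)
  case 0
  show ?case
    by (simp add: monic_OP_0 circle_sqnorm_def prob_space[simplified])
qed (simp add: sqnorm_monic_OP_Suc)

text \<open>If \<open>\<Phi>\<^sub>n = (z - a) p\<close>, then \<open>z p\<close> is the orthogonal sum of \<open>a p\<close> and \<open>\<Phi>\<^sub>n\<close>, and multiplication by \<open>z\<close>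
  preserves the norm.\<close>

lemma monic_OP_zeros:
  assumes "poly (\<Phi> n) a = 0"
  shows "norm a < 1"
proof -
  obtain p where p: "\<Phi> n = [:- a, 1:] * p"
    using assms by (auto simp: poly_eq_0_iff_dvd)
  then have "p \<noteq> 0"
    using monic_OP_neq_0[of n] by auto
  then have "degree ([:- a, 1:] * p) = Suc (degree p)"
    by (subst degree_mult_eq) auto
  then have "degree p < n"
    using p degree_monic_OP[of n] by simp
  have eq: "pCons 0 p = smult a p + \<Phi> n"
    by (simp add: p)
  have "inner (smult a p) (\<Phi> n) = 0"
    using \<open>degree p < n\<close> by (intro monic_OP_orth[OF is_monic_OP_monic_OP]) auto
  then have "sqnorm p = (norm a)\<^sup>2 * sqnorm p + sqnorm (\<Phi> n)"
    using sqnorm_add_orth[of "smult a p" "\<Phi> n"] sqnorm_pCons[of p] by (simp add: eq sqnorm_smult)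
  then have "(1 - (norm a)\<^sup>2) * sqnorm p > 0"
    using sqnorm_pos[of "\<Phi> n"] by (simp add: algebra_simps)
  then have "(norm a)\<^sup>2 < 1"
    using sqnorm_pos[OF \<open>p \<noteq> 0\<close>] by (simp add: zero_less_mult_iff)
  then show ?thesis
    by (simp add: abs_square_less_1)
qed

end

text \<open>The Verblunsky coefficients determine the orthogonal polynomials, and these determine
  the moments, since the integral of \<open>\<Phi>\<^sub>k\<close> vanishes for \<open>k > 0\<close>.\<close>

lemma monic_OP_determined:
  assumes "nontrivial_circle_prob \<mu>" "nontrivial_circle_prob \<nu>"
    and "\<And>k. k < N \<Longrightarrow> verblunsky \<mu> k = verblunsky \<nu> k" and "k \<le> N"
  shows "monic_OP \<mu> k = monic_OP \<nu> k"
proof -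
  interpret \<mu>: nontrivial_circle \<mu> by unfold_locales fact
  interpret \<nu>: nontrivial_circle \<nu> by unfold_locales fact
  show ?thesis
    using \<open>k \<le> N\<close>
    by (induction k) (auto simp: \<mu>.monic_OP_0 \<nu>.monic_OP_0 \<mu>.szego_recursion \<nu>.szego_recursion assms(3))
qed

lemma moments_determined:
  assumes "nontrivial_circle_prob \<mu>" "nontrivial_circle_prob \<nu>"
    and "\<And>k. k < N \<Longrightarrow> verblunsky \<mu> k = verblunsky \<nu> k" and "k \<le> N"
  shows "(LINT z|\<mu>. z ^ k) = (LINT z|\<nu>. z ^ k)"
proof -
  interpret \<mu>: nontrivial_circle \<mu> by unfold_locales fact
  interpret \<nu>: nontrivial_circle \<nu> by unfold_locales fact
  show ?thesis
    using \<open>k \<le> N\<close>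
  proof (induction k rule: less_induct)
    case (less k)
    show ?case
    proof (cases "k = 0")
      case True
      then show ?thesis
        using \<mu>.prob_space \<nu>.prob_space by simp
    next
      case False
      have eq: "(LINT z|\<kappa>. z ^ k) = - (\<Sum>j<k. coeff (monic_OP \<kappa> k) j * (LINT z|\<kappa>. z ^ j))"
        if "nontrivial_circle_prob \<kappa>" for \<kappa>
      proof -
        interpret \<kappa>: nontrivial_circle \<kappa> by unfold_locales fact
        have "0 = \<kappa>.inner 1 (\<kappa>.\<Phi> k)"
          using False by (subst \<kappa>.monic_OP_orth[OF \<kappa>.is_monic_OP_monic_OP]) auto
        also have "\<dots> = (LINT z|\<kappa>. (\<Sum>j\<le>k. coeff (\<kappa>.\<Phi> k) j * z ^ j))"
          by (simp add: circle_inner_def poly_altdef)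
        also have "\<dots> = (\<Sum>j\<le>k. (LINT z|\<kappa>. coeff (\<kappa>.\<Phi> k) j * z ^ j))"
          by (intro Bochner_Integration.integral_sum \<kappa>.continuous_integrable continuous_intros)
        also have "\<dots> = (\<Sum>j\<le>k. coeff (\<kappa>.\<Phi> k) j * (LINT z|\<kappa>. z ^ j))"
          by simp
        also have "{..k} = insert k {..<k}"
          by auto
        finally show ?thesis
          by (simp add: \<kappa>.lead_coeff_monic_OP eq_neg_iff_add_eq_0)
      qed
      have "monic_OP \<mu> k = monic_OP \<nu> k"
        using assms less.prems by (intro monic_OP_determined) auto
      then show ?thesis
        using less by (simp add: eq assms)
    qed
  qed
qed

section \<open>Measures on the circle and continuous functions\<close>

subsection \<open>Trigonometric polynomials\<close>

lemma circle_power_cancel: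
  assumes "z \<in> sphere (0::complex) 1"
  shows "z ^ n * cnj z ^ n = 1"
  using assms by (simp flip: power_mult_distrib add: complex_norm_square[symmetric])

text \<open>On the circle a polynomial in \<open>Re z\<close> and \<open>Im z\<close> is a trigonometric polynomial;
  it is represented as an ordinary polynomial divided by a power of \<open>z\<close>.\<close>

lemma real_polynomial_function_circle:
  assumes "real_polynomial_function h"
  shows "\<exists>N P. \<forall>z\<in>sphere 0 1. of_real (h z) = poly P z * cnj z ^ N"
  using assms
proof (induction rule: real_polynomial_function.induct)
  case (linear h)
  define a b where "a = complex_of_real (h 1)" and "b = complex_of_real (h \<i>)"
  let ?P = "[:(a + \<i> * b) / 2, 0, (a - \<i> * b) / 2:]"
  have "of_real (h z) = poly ?P z * cnj z ^ 1" if "z \<in> sphere 0 1" for z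
  proof -
    interpret bounded_linear h by fact
    have "z * cnj z = 1"
      using circle_power_cancel[OF that, of 1] by simp
    then have P: "poly ?P z * cnj z ^ 1 = (a + \<i> * b) / 2 * cnj z + (a - \<i> * b) / 2 * z"
      by (simp add: algebra_simps)
    have "h z = h (Re z *\<^sub>R 1 + Im z *\<^sub>R \<i>)"
      by (rule arg_cong[of _ _ h]) (simp add: complex_eq_iff)
    then have "h z = Re z * h 1 + Im z * h \<i>"
      by (simp add: add scaleR)
    then have "of_real (h z) = (a + \<i> * b) / 2 * cnj z + (a - \<i> * b) / 2 * z"
      by (simp add: complex_eq_iff a_def b_def field_simps)
    then show ?thesis
      by (simp only: P)
  qed
  then show ?case by blast
next
  case (const c)
  show ?case by (rule exI[of _ 0], rule exI[of _ "[:of_real c:]"]) simp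
next
  case (add f g)
  then obtain N P N' P' where *: "\<And>z. z \<in> sphere 0 1 \<Longrightarrow> of_real (f z) = poly P z * cnj z ^ N"
      "\<And>z. z \<in> sphere 0 1 \<Longrightarrow> of_real (g z) = poly P' z * cnj z ^ N'"
    by metis
  have "of_real (f z + g z) = poly (P * monom 1 N' + P' * monom 1 N) z * cnj z ^ (N + N')"
    if "z \<in> sphere 0 1" for z
  proof -
    have "poly (P * monom 1 N' + P' * monom 1 N) z * cnj z ^ (N + N') =
        poly P z * cnj z ^ N * (z ^ N' * cnj z ^ N') + poly P' z * cnj z ^ N' * (z ^ N * cnj z ^ N)"
      by (simp add: power_add algebra_simps poly_monom)
    then show ?thesis
      by (simp only: circle_power_cancel[OF that] * [OF that] of_real_add mult_1_right)
  qed
  then show ?case by blast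
next
  case (mult f g)
  then obtain N P N' P' where *: "\<And>z. z \<in> sphere 0 1 \<Longrightarrow> of_real (f z) = poly P z * cnj z ^ N"
      "\<And>z. z \<in> sphere 0 1 \<Longrightarrow> of_real (g z) = poly P' z * cnj z ^ N'"
    by metis
  have "of_real (f z * g z) = poly (P * P') z * cnj z ^ (N + N')"
    if "z \<in> sphere 0 1" for z
    by (simp only: of_real_mult * [OF that]) (simp add: power_add algebra_simps)
  then show ?case by blast
qed

lemma circle_moment_mixed:
  assumes "z \<in> sphere (0::complex) 1"
  shows "z ^ j * cnj z ^ N = (if N \<le> j then z ^ (j - N) else cnj (z ^ (N - j)))"
proof (cases "N \<le> j")
  case True
  then have "z ^ j = z ^ (j - N) * z ^ N"
    by (simp flip: power_add)
  then show ?thesis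
    using circle_power_cancel[OF assms, of N] True by simp
next
  case False
  then have "cnj z ^ N = cnj z ^ j * cnj z ^ (N - j)"
    by (simp flip: power_add)
  then show ?thesis
    using circle_power_cancel[OF assms, of j] False by (simp flip: mult.assoc)
qed

lemma circle_trig_integral:
  assumes "finite_measure \<mu>" "sets \<mu> = sets circle_borel"
  shows "(LINT z|\<mu>. poly P z * cnj z ^ N) =
    (\<Sum>j\<le>degree P. coeff P j *
       (if N \<le> j then (LINT z|\<mu>. z ^ (j - N)) else cnj (LINT z|\<mu>. z ^ (N - j))))"
proof -
  have mixed: "(LINT z|\<mu>. z ^ j * cnj z ^ N) =
      (if N \<le> j then (LINT z|\<mu>. z ^ (j - N)) else cnj (LINT z|\<mu>. z ^ (N - j)))" for j
  proof -
    have "(LINT z|\<mu>. z ^ j * cnj z ^ N) =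
        (LINT z|\<mu>. (if N \<le> j then z ^ (j - N) else cnj (z ^ (N - j))))"
      by (rule Bochner_Integration.integral_cong[OF refl])
         (simp add: circle_moment_mixed space_circle_measure[OF assms(2)])
    then show ?thesis
      by (simp split: if_splits flip: Bochner_Integration.integral_cnj)
  qed
  have "(LINT z|\<mu>. poly P z * cnj z ^ N) =
      (LINT z|\<mu>. (\<Sum>j\<le>degree P. coeff P j * (z ^ j * cnj z ^ N)))"
    by (simp add: poly_altdef sum_distrib_right mult.assoc)
  also have "\<dots> = (\<Sum>j\<le>degree P. (LINT z|\<mu>. coeff P j * (z ^ j * cnj z ^ N)))"
    by (intro Bochner_Integration.integral_sum circle_continuous_integrable[OF assms] continuous_intros)
  also have "\<dots> = (\<Sum>j\<le>degree P. coeff P j * (LINT z|\<mu>. z ^ j * cnj z ^ N))"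
    by simp
  also have "\<dots> = (\<Sum>j\<le>degree P. coeff P j *
       (if N \<le> j then (LINT z|\<mu>. z ^ (j - N)) else cnj (LINT z|\<mu>. z ^ (N - j))))"
    by (simp only: mixed)
  finally show ?thesis .
qed

text \<open>Convergence of moments implies weak convergence. Here each moment is even constant from
  some index on, so that trigonometric polynomials are integrated exactly.\<close>

lemma weak_convergence_of_moments:
  fixes \<nu> :: "nat \<Rightarrow> complex measure" and h :: "complex \<Rightarrow> real"
  assumes \<nu>: "\<And>n. prob_space (\<nu> n)" "\<And>n. sets (\<nu> n) = sets circle_borel"
    and \<mu>: "prob_space \<mu>" "sets \<mu> = sets circle_borel"
    and moments: "\<And>n k. k \<le> n \<Longrightarrow> (LINT z|\<nu> n. z ^ k) = (LINT z|\<mu>. z ^ k)"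
    and h: "continuous_on (sphere 0 1) h"
  shows "(\<lambda>n. LINT z|\<nu> n. h z) \<longlonglongrightarrow> (LINT z|\<mu>. h z)"
proof (rule LIMSEQ_I)
  fix e :: real assume "e > 0"
  then obtain q where q: "real_polynomial_function q" "\<And>z. z \<in> sphere 0 1 \<Longrightarrow> \<bar>h z - q z\<bar> < e / 3"
    using Stone_Weierstrass_real_polynomial_function[OF _ h, of "e / 3"] by auto
  obtain N P where P: "\<And>z. z \<in> sphere 0 1 \<Longrightarrow> of_real (q z) = poly P z * cnj z ^ N"
    using real_polynomial_function_circle[OF q(1)] by blast
  have cq: "continuous_on (sphere 0 1) q"
    using q(1) by (simp add: continuous_on_polymonial_function real_polynomial_function_eq)
  have approx: "\<bar>(LINT z|\<kappa>. h z) - (LINT z|\<kappa>. q z)\<bar> \<le> e / 3"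
    if \<kappa>: "prob_space \<kappa>" "sets \<kappa> = sets circle_borel" for \<kappa>
  proof -
    interpret prob_space \<kappa> by fact
    have i: "integrable \<kappa> h" "integrable \<kappa> q"
      by (intro circle_continuous_integrable[OF finite_measure_axioms \<kappa>(2)] h cq)+
    have "\<bar>(LINT z|\<kappa>. h z - q z)\<bar> \<le> (LINT z|\<kappa>. e / 3)"
      using i q(2) less_imp_le
      by (intro integral_abs_bound[THEN order_trans] integral_mono)
         (auto simp: space_circle_measure[OF \<kappa>(2)] intro!: less_imp_le)
    then show ?thesis
      using i by (simp add: prob_space)
  qed
  have trig: "of_real (LINT z|\<kappa>. q z) = (LINT z|\<kappa>. poly P z * cnj z ^ N)"
    if \<kappa>: "sets \<kappa> = sets circle_borel" for \<kappa>
    using P unfolding integral_complex_of_real[symmetric]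
    by (intro Bochner_Integration.integral_cong) (auto simp: space_circle_measure[OF \<kappa>])
  have "norm ((LINT z|\<nu> n. h z) - (LINT z|\<mu>. h z)) < e" if "n \<ge> N + degree P" for n
  proof -
    have "complex_of_real (LINT z|\<nu> n. q z) = of_real (LINT z|\<mu>. q z)"
      unfolding trig[OF \<nu>(2)] trig[OF \<mu>(2)]
      unfolding circle_trig_integral[OF prob_space.finite_measure[OF \<nu>(1)] \<nu>(2)]
        circle_trig_integral[OF prob_space.finite_measure[OF \<mu>(1)] \<mu>(2)]
      using that by (intro sum.cong) (auto simp: moments)
    then have "(LINT z|\<nu> n. q z) = (LINT z|\<mu>. q z)"
      by (simp only: of_real_eq_iff)
    then show ?thesis
      using approx[OF \<nu>, of n] approx[OF \<mu>] \<open>e > 0\<close> unfolding real_norm_def by linarith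
  qed
  then show "\<exists>no. \<forall>n\<ge>no. norm ((LINT z|\<nu> n. h z) - (LINT z|\<mu>. h z)) < e"
    by blast
qed

subsection \<open>Approximation of Borel functions by continuous functions\<close>

lemma circle_borel_inclusion:
  assumes "sets \<mu> = sets circle_borel"
  shows "(\<lambda>z. z) \<in> measurable \<mu> borel"
  by (rule circle_continuous_measurable[OF assms]) (rule continuous_on_id)

lemma sets_circle_borelD:
  assumes "A \<in> sets circle_borel"
  shows "A \<in> sets borel" "A \<subseteq> sphere 0 1"
  using assms by (auto simp: circle_borel_def sets_restrict_space)

lemma emeasure_circle_distr:
  assumes "sets \<mu> = sets circle_borel" "A \<in> sets borel"
  shows "emeasure (distr \<mu> borel (\<lambda>z. z)) A = emeasure \<mu> (A \<inter> sphere 0 1)"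
  using circle_borel_inclusion[OF assms(1)] assms(2)
  by (subst emeasure_distr) (auto simp: space_circle_measure[OF assms(1)])

text \<open>Regularity puts \<open>A\<close> between a compact set \<open>K\<close> and an open set \<open>U\<close> of almost the same measure, and
  Urysohn's lemma gives a continuous function that is \<open>1\<close> on \<open>K\<close> and \<open>0\<close> outside \<open>U\<close>.\<close>

lemma circle_indicator_approx:
  assumes \<mu>: "finite_measure \<mu>" "sets \<mu> = sets circle_borel" and A: "A \<in> sets \<mu>" and "e > 0"
  obtains h :: "complex \<Rightarrow> real"
  where "continuous_on UNIV h" "(LINT z|\<mu>. \<bar>indicator A z - h z\<bar>) \<le> e"
proof -
  interpret finite_measure \<mu> by fact
  let ?d = "distr \<mu> borel (\<lambda>z. z)"
  interpret d: finite_measure ?d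
    by (rule finite_measure_distr[OF circle_borel_inclusion[OF \<mu>(2)]])
  have Ab: "A \<in> sets borel" "A \<subseteq> sphere 0 1"
    using A sets_circle_borelD by (simp_all add: \<mu>(2))
  have fin: "emeasure ?d (space ?d) \<noteq> \<infinity>"
    using d.emeasure_finite[of "space ?d"] by simp
  have "\<exists>K. K \<subseteq> A \<and> compact K \<and> measure ?d A < measure ?d K + e / 2"
  proof (rule ccontr)
    assume "\<not> ?thesis"
    then have *: "measure ?d K + e / 2 \<le> measure ?d A" if "K \<subseteq> A" "compact K" for K
      using that by (auto simp: not_less)
    have "emeasure ?d A \<le> ennreal (measure ?d A - e / 2)"
      unfolding inner_regular[OF sets_distr fin Ab(1)]
      by (intro SUP_least)
         (auto simp: d.emeasure_eq_measure le_diff_eq intro!: ennreal_leI dest: *)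
    then have "measure ?d A \<le> measure ?d A - e / 2"
      using *[of "{}"] \<open>e > 0\<close> by (simp add: d.emeasure_eq_measure)
    then show False
      using \<open>e > 0\<close> by simp
  qed
  then obtain K where K: "K \<subseteq> A" "compact K" "measure ?d A < measure ?d K + e / 2"
    by blast
  have "\<exists>U. A \<subseteq> U \<and> open U \<and> measure ?d U < measure ?d A + e / 2"
  proof (rule ccontr)
    assume "\<not> ?thesis"
    then have *: "measure ?d A + e / 2 \<le> measure ?d U" if "A \<subseteq> U" "open U" for U
      using that by (auto simp: not_less)
    have "ennreal (measure ?d A + e / 2) \<le> emeasure ?d A"
      unfolding outer_regular[OF sets_distr fin Ab(1)]
      using * by (intro INF_greatest) (auto simp: d.emeasure_eq_measure intro!: ennreal_leI)
    then show False
      using \<open>e > 0\<close> by (simp add: d.emeasure_eq_measure)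
  qed
  then obtain U where U: "A \<subseteq> U" "open U" "measure ?d U < measure ?d A + e / 2"
    by blast
  obtain h :: "complex \<Rightarrow> real" where h: "continuous_on UNIV h"
      "\<And>z. h z \<in> closed_segment 1 0" "\<And>z. z \<in> K \<Longrightarrow> h z = 1" "\<And>z. z \<in> - U \<Longrightarrow> h z = 0"
    using Urysohn[of K "- U" 1 "0::real"] K U by (auto simp: compact_imp_closed closed_Compl)
  have h01: "0 \<le> h z" "h z \<le> 1" for z
    using h(2)[of z] by (auto simp: closed_segment_eq_real_ivl)
  have [measurable]: "h \<in> borel_measurable borel"
    using h(1) by (rule borel_measurable_continuous_onI)
  have KU: "K \<subseteq> U" "K \<in> sets borel" "U \<in> sets borel"
    using K U by (auto intro: borel_compact)
  have "(LINT z|\<mu>. \<bar>indicator A z - h z\<bar>) = (LINT z|?d. \<bar>indicator A z - h z\<bar>)"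
    using Ab by (subst integral_distr[OF circle_borel_inclusion[OF \<mu>(2)]]) auto
  also have "\<dots> \<le> (LINT z|?d. indicator (U - K) z)"
  proof (rule integral_mono)
    show "integrable ?d (\<lambda>z. \<bar>indicator A z - h z\<bar>)"
    proof (rule d.integrable_const_bound[of _ 1])
      show "AE z in ?d. norm \<bar>indicator A z - h z\<bar> \<le> 1"
      proof (rule AE_I2)
        show "norm \<bar>indicator A z - h z\<bar> \<le> 1" for z
          using h01[of z] by (auto simp: indicator_def)
      qed
    qed (use Ab in simp)
    show "\<bar>indicator A z - h z\<bar> \<le> indicator (U - K) z" for z
      using h01[of z] h(3,4)[of z] K(1) U(1) by (auto simp: indicator_def)
  qed (use KU in \<open>auto intro!: integrable_real_indicator simp: d.emeasure_finite less_top[symmetric]\<close>)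
  also have "\<dots> = measure ?d (U - K)"
    using KU by simp
  also have "\<dots> = measure ?d U - measure ?d K"
    using KU by (intro d.finite_measure_Diff) auto
  also have "\<dots> \<le> e"
    using K U by linarith
  finally show ?thesis
    using that h(1) by blast
qed

lemma circle_L1_approx:
  fixes f :: "complex \<Rightarrow> real"
  assumes \<mu>: "finite_measure \<mu>" "sets \<mu> = sets circle_borel" and f: "integrable \<mu> f" and "e > 0"
  shows "\<exists>h. continuous_on UNIV h \<and> (LINT z|\<mu>. \<bar>f z - h z\<bar>) \<le> e"
  using f \<open>e > 0\<close>
proof (induction arbitrary: e rule: integrable_induct)
  case (base A c)
  define d where "d = e / (\<bar>c\<bar> + 1)"
  have "d > 0"
    using base by (auto simp: d_def)
  then obtain h where h: "continuous_on UNIV h" "(LINT z|\<mu>. \<bar>indicator A z - h z\<bar>) \<le> d"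
    using circle_indicator_approx[OF \<mu> base(1)] by blast
  have "(LINT z|\<mu>. \<bar>indicator A z *\<^sub>R c - c * h z\<bar>) = (LINT z|\<mu>. \<bar>c\<bar> * \<bar>indicator A z - h z\<bar>)"
    by (simp flip: abs_mult add: algebra_simps)
  also have "\<dots> = \<bar>c\<bar> * (LINT z|\<mu>. \<bar>indicator A z - h z\<bar>)"
    by simp
  also have "\<dots> \<le> \<bar>c\<bar> * d"
    using h(2) by (intro mult_left_mono) auto
  also have "\<dots> \<le> e"
    using base(3) by (auto simp: d_def field_simps)
  finally show ?case
    using h(1) by (intro exI[of _ "\<lambda>z. c * h z"]) (auto intro!: continuous_intros)
next
  case (add f g)
  obtain h k where h: "continuous_on UNIV h" "(LINT z|\<mu>. \<bar>f z - h z\<bar>) \<le> e / 2"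
    and k: "continuous_on UNIV k" "(LINT z|\<mu>. \<bar>g z - k z\<bar>) \<le> e / 2"
    using add.IH[of "e / 2"] add.prems by auto
  have i: "integrable \<mu> h" "integrable \<mu> k"
    using h(1) k(1) by (auto intro!: circle_continuous_integrable[OF \<mu>] intro: continuous_on_subset)
  have "(LINT z|\<mu>. \<bar>f z + g z - (h z + k z)\<bar>) \<le> (LINT z|\<mu>. \<bar>f z - h z\<bar> + \<bar>g z - k z\<bar>)"
    using i add.hyps by (intro integral_mono) auto
  also have "\<dots> \<le> e"
    using i add.hyps h k by (subst Bochner_Integration.integral_add) auto
  finally show ?case
    using h(1) k(1) by (intro exI[of _ "\<lambda>z. h z + k z"]) (auto intro!: continuous_intros)
next
  case (lim f s)
  have [measurable]: "f \<in> borel_measurable \<mu>" "\<And>i. s i \<in> borel_measurable \<mu>"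
    using lim.hyps by auto
  have "(\<lambda>i. LINT z|\<mu>. \<bar>f z - s i z\<bar>) \<longlonglongrightarrow> (LINT z|\<mu>. 0)"
  proof (rule integral_dominated_convergence[where w = "\<lambda>z. 3 * \<bar>f z\<bar>"])
    show "AE z in \<mu>. (\<lambda>i. \<bar>f z - s i z\<bar>) \<longlonglongrightarrow> 0"
    proof (rule AE_I2)
      fix z assume "z \<in> space \<mu>"
      then have "(\<lambda>i. \<bar>f z - s i z\<bar>) \<longlonglongrightarrow> \<bar>f z - f z\<bar>"
        by (intro tendsto_intros lim.hyps)
      then show "(\<lambda>i. \<bar>f z - s i z\<bar>) \<longlonglongrightarrow> 0" by simp
    qed
    show "AE z in \<mu>. norm \<bar>f z - s i z\<bar> \<le> 3 * \<bar>f z\<bar>" for i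
    proof (rule AE_I2)
      fix z assume "z \<in> space \<mu>"
      then have "\<bar>s i z\<bar> \<le> 2 * \<bar>f z\<bar>"
        using lim.hyps(3)[of z i] by simp
      then show "norm \<bar>f z - s i z\<bar> \<le> 3 * \<bar>f z\<bar>"
        by simp
    qed
  qed (use lim.hyps in auto)
  then have "\<forall>\<^sub>F i in sequentially. (LINT z|\<mu>. \<bar>f z - s i z\<bar>) < e / 2"
    using lim.prems by (intro order_tendstoD(2)) auto
  then obtain i where i: "(LINT z|\<mu>. \<bar>f z - s i z\<bar>) < e / 2"
    by (auto simp: eventually_sequentially)
  obtain h where h: "continuous_on UNIV h" "(LINT z|\<mu>. \<bar>s i z - h z\<bar>) \<le> e / 2"
    using lim.IH[of "e / 2" i] lim.prems by auto
  have ih: "integrable \<mu> h"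
    using h(1) by (auto intro!: circle_continuous_integrable[OF \<mu>] intro: continuous_on_subset)
  have "(LINT z|\<mu>. \<bar>f z - h z\<bar>) \<le> (LINT z|\<mu>. \<bar>f z - s i z\<bar> + \<bar>s i z - h z\<bar>)"
    using ih lim.hyps by (intro integral_mono) auto
  also have "\<dots> \<le> e"
    using ih lim.hyps h i by (subst Bochner_Integration.integral_add) auto
  finally show ?case
    using h(1) by blast
qed

text \<open>A bounded Borel function is a limit almost everywhere of continuous functions with the same
  bounds.\<close>

lemma circle_AE_approx:
  fixes v :: "complex \<Rightarrow> real"
  assumes \<mu>: "finite_measure \<mu>" "sets \<mu> = sets circle_borel"
    and v: "v \<in> borel_measurable \<mu>" "\<And>z. z \<in> sphere 0 1 \<Longrightarrow> c \<le> v z \<and> v z \<le> C" and "c \<le> C"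
  obtains h :: "nat \<Rightarrow> complex \<Rightarrow> real"
  where "\<And>j. continuous_on UNIV (h j)" "\<And>j z. c \<le> h j z" "\<And>j z. h j z \<le> C"
    "AE z in \<mu>. (\<lambda>j. h j z) \<longlonglongrightarrow> v z"
proof -
  interpret finite_measure \<mu> by fact
  have vi: "integrable \<mu> v"
  proof (rule integrable_const_bound[of _ "\<bar>c\<bar> + \<bar>C\<bar>"])
    show "AE z in \<mu>. norm (v z) \<le> \<bar>c\<bar> + \<bar>C\<bar>"
    proof (rule AE_I2)
      fix z assume "z \<in> space \<mu>"
      then show "norm (v z) \<le> \<bar>c\<bar> + \<bar>C\<bar>"
        using v(2)[of z] by (auto simp: space_circle_measure[OF \<mu>(2)])
    qed
  qed fact
  have "\<exists>h. continuous_on UNIV h \<and> (LINT z|\<mu>. \<bar>v z - h z\<bar>) \<le> 1 / Suc j" for j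
    by (rule circle_L1_approx[OF \<mu> vi]) auto
  then obtain h where h: "\<And>j. continuous_on UNIV (h j)" "\<And>j. (LINT z|\<mu>. \<bar>v z - h j z\<bar>) \<le> 1 / Suc j"
    by metis
  have hi: "integrable \<mu> (h j)" for j
    using h(1)[of j] by (auto intro!: circle_continuous_integrable[OF \<mu>] intro: continuous_on_subset)
  have "(\<lambda>j. LINT z|\<mu>. norm (v z - h j z)) \<longlonglongrightarrow> 0"
    by (rule tendsto_sandwich[OF _ _ tendsto_const LIMSEQ_Suc[OF lim_1_over_n]])
       (use h(2) in \<open>auto intro!: always_eventually\<close>)
  then obtain r where r: "strict_mono (r :: nat \<Rightarrow> nat)" "AE z in \<mu>. (\<lambda>j. v z - h (r j) z) \<longlonglongrightarrow> 0"
    using tendsto_L1_AE_subseq[of \<mu> "\<lambda>j z. v z - h j z"] vi hi by auto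
  define k where "k j z = max c (min C (h (r j) z))" for j z
  show ?thesis
  proof (rule that[of k])
    show "continuous_on UNIV (k j)" for j
      unfolding k_def by (intro continuous_intros h)
    show "AE z in \<mu>. (\<lambda>j. k j z) \<longlonglongrightarrow> v z"
      using r(2) AE_space
    proof eventually_elim
      case (elim z)
      have "(\<lambda>j. v z - (v z - h (r j) z)) \<longlonglongrightarrow> v z - 0"
        by (intro tendsto_intros elim)
      then have "(\<lambda>j. k j z) \<longlonglongrightarrow> max c (min C (v z))"
        unfolding k_def by (intro tendsto_intros) simp
      also have "max c (min C (v z)) = v z"
        using v(2)[of z] elim by (auto simp: space_circle_measure[OF \<mu>(2)])
      finally show ?case .
    qed
  qed (use \<open>c \<le> C\<close> in \<open>auto simp: k_def\<close>)
qed

text \<open>The indicator of a compact set \<open>K\<close> is the limit of the functions \<open>max 0 (1 - n d(z, K))\<close>, so the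
  measures agree on compact sets, and by regularity everywhere.\<close>

lemma circle_measure_eqI:
  assumes \<mu>: "finite_measure \<mu>" "sets \<mu> = sets circle_borel"
    and \<nu>: "finite_measure \<nu>" "sets \<nu> = sets circle_borel"
    and eq: "\<And>h :: complex \<Rightarrow> real. continuous_on (sphere 0 1) h \<Longrightarrow> (LINT z|\<mu>. h z) = (LINT z|\<nu>. h z)"
  shows "\<mu> = \<nu>"
proof -
  have compact: "emeasure (distr \<mu> borel (\<lambda>z. z)) K = emeasure (distr \<nu> borel (\<lambda>z. z)) K"
    if "compact K" for K
  proof (cases "K = {}")
    case False
    have lim: "(\<lambda>n. LINT z|\<kappa>. max 0 (1 - real n * infdist z K)) \<longlonglongrightarrow> measure \<kappa> (K \<inter> sphere 0 1)"
      if \<kappa>: "finite_measure \<kappa>" "sets \<kappa> = sets circle_borel" for \<kappa>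
    proof -
      interpret finite_measure \<kappa> by fact
      have Ks: "K \<inter> sphere 0 1 \<in> sets \<kappa>"
        using \<open>compact K\<close> by (auto simp: \<kappa>(2) circle_borel_def sets_restrict_space intro: borel_compact)
      have "(\<lambda>n. LINT z|\<kappa>. max 0 (1 - real n * infdist z K)) \<longlonglongrightarrow> (LINT z|\<kappa>. indicator (K \<inter> sphere 0 1) z)"
      proof (rule integral_dominated_convergence[where w = "\<lambda>_. 1"])
        show "(\<lambda>z. max 0 (1 - real n * infdist z K)) \<in> borel_measurable \<kappa>" for n
          by (intro circle_continuous_measurable[OF \<kappa>(2)] continuous_intros)
        show "AE z in \<kappa>. (\<lambda>n. max 0 (1 - real n * infdist z K)) \<longlonglongrightarrow> indicator (K \<inter> sphere 0 1) z"
        proof (rule AE_I2)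
          fix z assume z: "z \<in> space \<kappa>"
          show "(\<lambda>n. max 0 (1 - real n * infdist z K)) \<longlonglongrightarrow> indicator (K \<inter> sphere 0 1) z"
          proof (cases "z \<in> K")
            case True
            then show ?thesis
              using z by (simp add: space_circle_measure[OF \<kappa>(2)])
          next
            case False
            then have d: "infdist z K > 0"
              using \<open>compact K\<close> \<open>K \<noteq> {}\<close> infdist_pos_not_in_closed[of K z] by (simp add: compact_imp_closed)
            have "\<forall>\<^sub>F n in sequentially. max 0 (1 - real n * infdist z K) = 0"
              using eventually_ge_at_top[of "nat \<lceil>1 / infdist z K\<rceil>"]
            proof eventually_elim
              case (elim n)
              then have "1 / infdist z K \<le> real n"
                by linarith
              then show ?case
                using d by (simp add: field_simps)
            qed
            then show ?thesis
              using False by (auto intro: tendsto_eventually)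
          qed
        qed
      qed (use Ks in \<open>auto simp: infdist_nonneg\<close>)
      then show ?thesis
        using Ks by simp
    qed
    have "measure \<mu> (K \<inter> sphere 0 1) = measure \<nu> (K \<inter> sphere 0 1)"
    proof (rule LIMSEQ_unique[OF lim[OF \<mu>]])
      have "(LINT z|\<mu>. max 0 (1 - real n * infdist z K)) = (LINT z|\<nu>. max 0 (1 - real n * infdist z K))" for n
        by (intro eq continuous_intros)
      then show "(\<lambda>n. LINT z|\<mu>. max 0 (1 - real n * infdist z K)) \<longlonglongrightarrow> measure \<nu> (K \<inter> sphere 0 1)"
        using lim[OF \<nu>] by simp
    qed
    then show ?thesis
      using \<mu> \<nu> that by (simp add: emeasure_circle_distr borel_compact finite_measure.emeasure_eq_measure)
  qed simp
  have reg: "emeasure (distr \<kappa> borel (\<lambda>z. z)) A =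
      (SUP K \<in> {K. K \<subseteq> A \<and> compact K}. emeasure (distr \<kappa> borel (\<lambda>z. z)) K)"
    if \<kappa>: "finite_measure \<kappa>" "sets \<kappa> = sets circle_borel" and "A \<in> sets borel" for \<kappa> A
  proof -
    interpret d: finite_measure "distr \<kappa> borel (\<lambda>z. z)"
      by (rule finite_measure.finite_measure_distr[OF \<kappa>(1) circle_borel_inclusion[OF \<kappa>(2)]])
    show ?thesis
      by (intro inner_regular) (use d.emeasure_finite that in auto)
  qed
  show ?thesis
  proof (rule measure_eqI)
    fix A assume "A \<in> sets \<mu>"
    then have A: "A \<in> sets borel" "A \<inter> sphere 0 1 = A"
      using sets_circle_borelD \<mu>(2) by blast+
    have "emeasure (distr \<mu> borel (\<lambda>z. z)) A = emeasure (distr \<nu> borel (\<lambda>z. z)) A"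
      unfolding reg[OF \<mu> A(1)] reg[OF \<nu> A(1)] by (intro SUP_cong) (auto simp: compact)
    then show "emeasure \<mu> A = emeasure \<nu> A"
      by (simp add: emeasure_circle_distr \<mu> \<nu> A)
  qed (simp add: \<mu> \<nu>)
qed

lemma circle_measure_eq_moments:
  assumes \<mu>: "prob_space \<mu>" "sets \<mu> = sets circle_borel"
    and \<nu>: "prob_space \<nu>" "sets \<nu> = sets circle_borel"
    and "\<And>k. (LINT z|\<mu>. z ^ k) = (LINT z|\<nu>. z ^ k)"
  shows "\<mu> = \<nu>"
proof (rule circle_measure_eqI)
  fix h :: "complex \<Rightarrow> real" assume "continuous_on (sphere 0 1) h"
  then have "(\<lambda>n::nat. LINT z|\<mu>. h z) \<longlonglongrightarrow> (LINT z|\<nu>. h z)"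
    using assms by (intro weak_convergence_of_moments) auto
  then show "(LINT z|\<mu>. h z) = (LINT z|\<nu>. h z)"
    by (rule LIMSEQ_unique[OF tendsto_const])
qed (use assms in \<open>auto intro: prob_space.finite_measure\<close>)

section \<open>Bernstein--Szego measures\<close>

text \<open>The measure \<open>w d\<theta> / (2\<pi>)\<close> on the circle.\<close>

definition angle_density :: "(real \<Rightarrow> real) \<Rightarrow> complex measure" where
  "angle_density w = distr (density angle_prob (\<lambda>\<theta>. ennreal (w \<theta>))) circle_borel cis"

lemma sets_angle_density [simp, measurable_cong]: "sets (angle_density w) = sets circle_borel"
  by (simp add: angle_density_def)

lemma emeasure_angle_density:
  assumes "w \<in> borel_measurable angle_prob" "A \<in> sets circle_borel"
  shows "emeasure (angle_density w) A = (\<integral>\<^sup>+\<theta>. ennreal (w \<theta>) * indicator A (cis \<theta>) \<partial>angle_prob)"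
proof -
  have m: "cis -` A \<inter> space angle_prob \<in> sets angle_prob"
    using assms(2) by (intro measurable_sets[OF cis_measurable])
  have "emeasure (angle_density w) A = emeasure (density angle_prob (\<lambda>\<theta>. ennreal (w \<theta>))) (cis -` A \<inter> space angle_prob)"
    unfolding angle_density_def using assms(2) by (subst emeasure_distr) auto
  also have "\<dots> = (\<integral>\<^sup>+\<theta>. ennreal (w \<theta>) * indicator (cis -` A \<inter> space angle_prob) \<theta> \<partial>angle_prob)"
    using assms(1) m by (subst emeasure_density) auto
  also have "\<dots> = (\<integral>\<^sup>+\<theta>. ennreal (w \<theta>) * indicator A (cis \<theta>) \<partial>angle_prob)"
    by (rule nn_integral_cong) (simp add: indicator_def)
  finally show ?thesis .
qed

lemma integral_angle_density:
  fixes h :: "complex \<Rightarrow> 'b :: {banach, second_countable_topology}"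
  assumes [measurable]: "w \<in> borel_measurable angle_prob" and "\<And>\<theta>. \<theta> \<in> {0..<2 * pi} \<Longrightarrow> 0 \<le> w \<theta>"
    and [measurable]: "h \<in> borel_measurable circle_borel"
  shows "(LINT z|angle_density w. h z) = (\<integral>\<theta>. w \<theta> *\<^sub>R h (cis \<theta>) \<partial>angle_prob)"
proof -
  have "AE \<theta> in angle_prob. 0 \<le> w \<theta>"
    using assms(2) by (intro AE_I2) simp
  then show ?thesis
    unfolding angle_density_def by (subst integral_distr) (auto simp: integral_density)
qed

lemma circle_borel_open_Int:
  "open U \<Longrightarrow> U \<inter> sphere 0 1 \<in> sets circle_borel"
  unfolding circle_borel_def sets_restrict_space by (rule image_eqI[of _ _ U]) auto

lemma angle_density_support:
  assumes w: "w \<in> borel_measurable angle_prob" "\<And>\<theta>. \<theta> \<in> {0..<2 * pi} \<Longrightarrow> 0 < w \<theta>"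
  shows "circle_support (angle_density w) = sphere 0 1"
proof -
  have "emeasure (angle_density w) (U \<inter> sphere 0 1) > 0"
    if z: "z \<in> sphere 0 1" "z \<in> U" and U: "open U" for z U
  proof (rule ccontr)
    assume "\<not> ?thesis"
    then have "(\<integral>\<^sup>+\<theta>. ennreal (w \<theta>) * indicator (U \<inter> sphere 0 1) (cis \<theta>) \<partial>angle_prob) = 0"
      using w circle_borel_open_Int[OF U] by (simp add: emeasure_angle_density not_less)
    moreover have [measurable]: "(\<lambda>\<theta>. indicator (U \<inter> sphere 0 1) (cis \<theta>) :: ennreal) \<in> borel_measurable angle_prob"
      using measurable_compose[OF cis_measurable borel_measurable_indicator[OF circle_borel_open_Int[OF U]]] .
    ultimately have "AE \<theta> in angle_prob. ennreal (w \<theta>) * indicator (U \<inter> sphere 0 1) (cis \<theta>) = 0"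
      using w by (subst (asm) nn_integral_0_iff_AE) auto
    with AE_space have ae: "AE \<theta> in angle_prob. cis \<theta> \<notin> U"
    proof eventually_elim
      case (elim \<theta>)
      then show ?case using w(2)[of \<theta>] by (auto simp: indicator_def split: if_splits)
    qed
    define t where "t = Arg2pi z"
    have t: "0 \<le> t" "t < 2 * pi" "cis t \<in> U"
      using z by (simp_all add: t_def Arg2pi_ge_0 Arg2pi_lt_2pi cis_Arg2pi)
    have "open (cis -` U)"
      using U by (intro open_vimage continuous_intros)
    then obtain d where d: "d > 0" "\<And>s. dist s t < d \<Longrightarrow> cis s \<in> U"
      using t by (auto simp: open_dist)
    define s where "s = min (t + d) (2 * pi)"
    have s: "t < s" "s \<le> 2 * pi" "\<And>\<theta>. \<theta> \<in> {t..<s} \<Longrightarrow> cis \<theta> \<in> U"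
      using t d by (auto simp: s_def dist_real_def)
    have sets: "{t..<s} \<in> sets angle_prob"
      using s t by (auto simp: sets_angle_measure sets_restrict_space image_iff intro!: bexI[of _ "{t..<s}"])
    have "emeasure angle_prob {t..<s} = 0"
    proof -
      have "AE \<theta> in angle_prob. \<not> \<theta> \<in> {t..<s}"
        using ae by eventually_elim (use s(3) in blast)
      then have "emeasure angle_prob {\<theta> \<in> space angle_prob. \<theta> \<in> {t..<s}} = 0"
        by (rule emeasure_eq_0_AE)
      also have "{\<theta> \<in> space angle_prob. \<theta> \<in> {t..<s}} = {t..<s}"
        using s t by auto
      finally show ?thesis .
    qed
    moreover have "emeasure angle_prob {t..<s} = ennreal ((s - t) / (2 * pi))"
      using s by (simp add: emeasure_angle_prob[OF sets] ennreal_mult[symmetric])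
    ultimately show False
      using s by simp
  qed
  then show ?thesis
    by (auto simp: circle_support_def)
qed

lemma infinite_circle: "infinite (sphere (0::complex) 1)"
proof -
  have "inj_on cis {0..<2 * pi}"
    by (rule inj_on_inverseI[of _ Arg2pi]) (rule Arg2pi_cis)
  moreover have "infinite {0..<2 * pi}"
    by (simp add: infinite_Ico)
  ultimately have "infinite (cis ` {0..<2 * pi})"
    by (simp add: finite_image_iff)
  then show ?thesis
    by (rule infinite_super[rotated]) auto
qed

lemma star_poly_pCons: "degree p \<le> n \<Longrightarrow> star_poly (Suc n) (pCons 0 p) = star_poly n p"
  by (rule poly_eqI) (auto simp: coeff_star_poly coeff_pCons Suc_diff_le le_Suc_eq split: nat.splits)

lemma star_poly_star: "degree p \<le> n \<Longrightarrow> star_poly (Suc n) (star_poly n p) = pCons 0 p"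
  by (rule poly_eqI) (auto simp: coeff_star_poly coeff_pCons coeff_eq_0 split: nat.splits)

lemma star_poly_diff: "star_poly n (p - q) = star_poly n p - star_poly n q"
  by (rule poly_eqI) (simp add: coeff_star_poly)

lemma star_poly_smult: "star_poly n (smult c p) = smult (cnj c) (star_poly n p)"
  by (rule poly_eqI) (simp add: coeff_star_poly)

context nontrivial_circle
begin

lemma verblunsky_eq_coeff: "\<alpha> n = - cnj (coeff (\<Phi> (Suc n)) 0)"
  using arg_cong[OF szego_recursion[of n], of "\<lambda>p. coeff p 0"]
  by (simp add: coeff_0_star_monic_OP)

text \<open>The recursion solved for \<open>\<Phi>\<^sub>n\<close>: the polynomial \<open>\<Phi>\<^sub>n\<^sub>+\<^sub>1\<close> alone determines \<open>\<alpha>\<^sub>n\<close>, as its value at \<open>0\<close>,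
  and hence all earlier orthogonal polynomials.\<close>

lemma inverse_szego_recursion:
  "smult (1 - of_real ((norm (\<alpha> n))\<^sup>2)) (pCons 0 (\<Phi> n)) =
     \<Phi> (Suc n) + smult (cnj (\<alpha> n)) (star_poly (Suc n) (\<Phi> (Suc n)))"
proof -
  have "star_poly (Suc n) (\<Phi> (Suc n)) = star_poly n (\<Phi> n) - smult (\<alpha> n) (pCons 0 (\<Phi> n))"
    by (subst szego_recursion) (simp add: star_poly_diff star_poly_smult star_poly_pCons star_poly_star)
  moreover have "smult (1 - of_real ((norm (\<alpha> n))\<^sup>2)) (pCons 0 (\<Phi> n)) =
      pCons 0 (\<Phi> n) - smult (cnj (\<alpha> n) * \<alpha> n) (pCons 0 (\<Phi> n))"
    by (simp only: smult_diff_left smult_1_left complex_norm_square mult.commute)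
  ultimately show ?thesis
    by (simp only: szego_recursion[of n] smult_diff_right smult_smult) (simp add: algebra_simps)
qed

lemma poly_star_monic_OP_neq_0:
  assumes "norm z \<le> 1"
  shows "poly (star_poly n (\<Phi> n)) z \<noteq> 0"
proof (cases "z = 0")
  case True
  then show ?thesis
    by (simp add: poly_0_coeff_0 coeff_0_star_monic_OP)
next
  case False
  then have "norm (1 / cnj z) \<ge> 1"
    using assms by (simp add: norm_divide)
  then have "poly (\<Phi> n) (1 / cnj z) \<noteq> 0"
    using monic_OP_zeros[of n "1 / cnj z"] by auto
  then show ?thesis
    using False by (simp add: poly_star)
qed

lemma poly_monic_OP_circle_neq_0: "z \<in> sphere 0 1 \<Longrightarrow> poly (\<Phi> n) z \<noteq> 0"
  using monic_OP_zeros[of n z] by auto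

end

text \<open>The weight of the Bernstein--Szego measure built from \<open>\<Phi>\<^sub>N\<close>. The normalising constant is the squared norm
  of \<open>\<Phi>\<^sub>N\<close>.\<close>

definition bs_weight :: "complex measure \<Rightarrow> nat \<Rightarrow> real \<Rightarrow> real" where
  "bs_weight \<mu> N \<theta> = circle_sqnorm \<mu> (monic_OP \<mu> N) / (norm (poly (monic_OP \<mu> N) (cis \<theta>)))\<^sup>2"

context nontrivial_circle
begin

lemma inverse_OP_continuous: "continuous_on (sphere 0 1) (\<lambda>z. c / (norm (poly (\<Phi> N) z))\<^sup>2)"
  by (intro continuous_intros) (use poly_monic_OP_circle_neq_0[of _ N] in auto)

text \<open>With respect to \<open>d\<theta> / |\<Phi>\<^sub>N|\<^sup>2\<close> the orthogonal polynomials of degree \<open>m \<ge> N\<close> are \<open>z\<^sup>m\<^sup>-\<^sup>N \<Phi>\<^sub>N\<close>.\<close>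

lemma inverse_OP_density_orth:
  assumes "c > 0" "N \<le> m" "k < m"
  shows "circle_inner (angle_density (\<lambda>\<theta>. c / (norm (poly (\<Phi> N) (cis \<theta>)))\<^sup>2)) (monom 1 k)
           (monom 1 (m - N) * \<Phi> N) = 0"
proof -
  let ?p = "poly (\<Phi> N)" and ?s = "poly (star_poly N (\<Phi> N))"
  \<comment> \<open>On the circle \<open>F\<close> is the integrand of the inner product; it is analytic on the closed
    disk because \<open>\<Phi>\<^sub>N\<^sup>*\<close> has no zeros there, and it vanishes at \<open>0\<close> because \<open>k < m\<close>.\<close>
  define F where "F z = of_real c * z ^ (m - k) / ?s z" for z
  have "F holomorphic_on cball 0 1"
    unfolding F_def using poly_star_monic_OP_neq_0 by (intro holomorphic_intros) auto
  then have "(\<integral>\<theta>. F (cis \<theta>) \<partial>angle_prob) = F 0"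
    by (rule mean_value_circle)
  also have "F 0 = 0"
    using assms by (simp add: F_def)
  finally have "(\<integral>\<theta>. F (cis \<theta>) \<partial>angle_prob) = 0" .
  moreover have "F z = (c / (norm (?p z))\<^sup>2) *\<^sub>R (cnj (poly (monom 1 k) z) * poly (monom 1 (m - N) * \<Phi> N) z)"
    if z: "z \<in> sphere 0 1" for z
  proof -
    have p: "?p z \<noteq> 0"
      using z by (rule poly_monic_OP_circle_neq_0)
    have "z \<noteq> 0"
      using z by auto
    have 1: "z ^ (m - k) = cnj z ^ k * z ^ m"
      using circle_moment_mixed[OF z, of m k] assms by (simp add: mult.commute)
    have 2: "z ^ m = z ^ (m - N) * z ^ N"
      using assms by (simp flip: power_add)
    show ?thesis
      using p z \<open>z \<noteq> 0\<close> unfolding F_def 1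
      by (simp add: poly_star_circle poly_monom scaleR_conv_of_real complex_norm_square 2 del: of_real_power)
  qed
  ultimately show ?thesis
    unfolding circle_inner_def using assms(1) circle_comp_measurable[OF inverse_OP_continuous]
    by (subst integral_angle_density)
       (auto simp: intro!: circle_continuous_measurable continuous_intros)
qed

text \<open>The measure with weight \<^const>\<open>bs_weight\<close> is a probability measure with the truncated sequence of
  Verblunsky coefficients. Its orthogonal polynomials are \<open>z\<^sup>m\<^sup>-\<^sup>N \<Phi>\<^sub>N\<close> from degree \<open>N\<close> on and, by the
  inverse recursion, those of \<open>\<mu>\<close> below. The normalising constant is the squared norm of \<open>\<Phi>\<^sub>N\<close> in the
  measure itself, and it equals the one in \<open>\<mu>\<close> since both are \<open>\<Prod>k<N. (1 - |\<alpha>\<^sub>k|\<^sup>2)\<close>.\<close>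

lemma bs_measure_verblunsky:
  fixes N :: nat
  defines "\<nu> \<equiv> angle_density (bs_weight \<mu> N)"
  shows "nontrivial_circle_prob \<nu>"
    and "\<And>k. verblunsky \<nu> k = (if k < N then \<alpha> k else 0)"
proof -
  let ?f = "\<lambda>z. 1 / (norm (poly (\<Phi> N) z))\<^sup>2"
  \<comment> \<open>First normalise by \<open>c\<close>; that \<open>c\<close> is the squared norm comes out at the end.\<close>
  define c where "c = 1 / (\<integral>\<theta>. ?f (cis \<theta>) \<partial>angle_prob)"
  define \<kappa> where "\<kappa> = angle_density (\<lambda>\<theta>. c / (norm (poly (\<Phi> N) (cis \<theta>)))\<^sup>2)"
  have fpos: "?f z > 0" if "z \<in> sphere 0 1" for z
    using poly_monic_OP_circle_neq_0[OF that] by simp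
  have fint: "integrable angle_prob (\<lambda>\<theta>. ?f (cis \<theta>))"
    by (rule circle_comp_integrable[OF inverse_OP_continuous])
  have "(\<integral>\<theta>. ?f (cis \<theta>) \<partial>angle_prob) > 0"
  proof (rule ccontr)
    assume "\<not> ?thesis"
    moreover have "(\<integral>\<theta>. ?f (cis \<theta>) \<partial>angle_prob) \<ge> 0"
      by (rule Bochner_Integration.integral_nonneg) simp
    ultimately have "AE \<theta> in angle_prob. ?f (cis \<theta>) = 0"
      using integral_nonneg_eq_0_iff_AE[OF fint] by simp
    then have "AE \<theta> in angle_prob. False"
      by (rule AE_mp) (use fpos in \<open>auto intro!: AE_I2\<close>)
    then show False
      using angle_prob.AE_False by simp
  qed
  then have "c > 0"
    by (simp add: c_def)
  let ?w = "\<lambda>\<theta>. c / (norm (poly (\<Phi> N) (cis \<theta>)))\<^sup>2"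
  have wm: "?w \<in> borel_measurable angle_prob"
    by (rule circle_comp_measurable[OF inverse_OP_continuous])
  have wpos: "?w \<theta> > 0" for \<theta>
    using \<open>c > 0\<close> poly_monic_OP_circle_neq_0[of "cis \<theta>"] by simp
  have "sphere 0 1 \<in> sets circle_borel"
    using sets.top[of circle_borel] by simp
  moreover have "space \<kappa> = sphere 0 1"
    by (rule space_circle_measure) (simp add: \<kappa>_def)
  ultimately have "emeasure \<kappa> (space \<kappa>) = (\<integral>\<^sup>+\<theta>. ennreal (?w \<theta>) \<partial>angle_prob)"
    using wm by (simp only: \<kappa>_def emeasure_angle_density) simp
  also have "\<dots> = ennreal (\<integral>\<theta>. ?w \<theta> \<partial>angle_prob)"
    using wpos circle_comp_integrable[OF inverse_OP_continuous]
    by (intro nn_integral_eq_integral AE_I2 less_imp_le)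
  also have "(\<integral>\<theta>. ?w \<theta> \<partial>angle_prob) = c * (\<integral>\<theta>. ?f (cis \<theta>) \<partial>angle_prob)"
    by (subst integral_mult_right_zero[symmetric]) simp
  also have "\<dots> = 1"
    using \<open>c > 0\<close> by (simp add: c_def)
  finally have "prob_space \<kappa>"
    by (intro prob_spaceI) simp
  then have nt: "nontrivial_circle_prob \<kappa>"
    using wm wpos infinite_circle
    by (simp add: nontrivial_circle_prob_def \<kappa>_def angle_density_support)
  interpret \<kappa>: nontrivial_circle \<kappa>
    by unfold_locales (rule nt)
  have high: "\<kappa>.\<Phi> m = monom 1 (m - N) * \<Phi> N" if "N \<le> m" for m
  proof (rule \<kappa>.monic_OP_eqI)
    have "degree (monom 1 (m - N) * \<Phi> N) = m"
      using that by (subst degree_mult_eq) (auto simp: degree_monom_eq)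
    moreover have "lead_coeff (monom 1 (m - N) * \<Phi> N) = 1"
      by (simp add: lead_coeff_mult degree_monom_eq lead_coeff_monic_OP)
    ultimately show "is_monic_OP \<kappa> m (monom 1 (m - N) * \<Phi> N)"
      using inverse_OP_density_orth[OF \<open>c > 0\<close> that] by (simp add: is_monic_OP_def \<kappa>_def)
  qed
  \<comment> \<open>Descending induction on the degree, by the inverse recursion.\<close>
  have low: "\<kappa>.\<Phi> (N - j) = \<Phi> (N - j)" for j
  proof (induction j)
    case 0
    then show ?case using high[of N] by simp
  next
    case (Suc j)
    show ?case
    proof (cases "j < N")
      case True
      define n where "n = N - Suc j"
      have eq: "\<kappa>.\<Phi> (Suc n) = \<Phi> (Suc n)"
        using Suc True by (simp add: n_def Suc_diff_Suc)
      then have a: "\<kappa>.\<alpha> n = \<alpha> n"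
        by (simp add: \<kappa>.verblunsky_eq_coeff verblunsky_eq_coeff)
      have "smult (1 - of_real ((norm (\<alpha> n))\<^sup>2)) (pCons 0 (\<kappa>.\<Phi> n)) =
          smult (1 - of_real ((norm (\<alpha> n))\<^sup>2)) (pCons 0 (\<Phi> n))"
        using inverse_szego_recursion[of n] \<kappa>.inverse_szego_recursion[of n] by (simp add: a eq)
      moreover have "1 - complex_of_real ((norm (\<alpha> n))\<^sup>2) \<noteq> 0"
      proof -
        have "(norm (\<alpha> n))\<^sup>2 < 1"
          using norm_verblunsky_less_1[of n] by (simp add: abs_square_less_1)
        then have "1 - (norm (\<alpha> n))\<^sup>2 \<noteq> 0"
          by simp
        then show ?thesis
          by (metis of_real_1 of_real_diff of_real_eq_0_iff)
      qed
      ultimately have "pCons 0 (\<kappa>.\<Phi> n) = pCons 0 (\<Phi> n)"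
        by (metis smult_cancel)
      then show ?thesis
        by (simp add: n_def)
    next
      case False
      then have "N - Suc j = N - j"
        by simp
      then show ?thesis
        using Suc by simp
    qed
  qed
  have low': "\<kappa>.\<Phi> k = \<Phi> k" if "k \<le> N" for k
    using low[of "N - k"] that by simp
  have vb: "\<kappa>.\<alpha> k = (if k < N then \<alpha> k else 0)" for k
  proof (cases "k < N")
    case True
    then show ?thesis
      using low'[of "Suc k"] by (simp add: \<kappa>.verblunsky_eq_coeff verblunsky_eq_coeff)
  next
    case False
    have "coeff (monom 1 (Suc k - N) * \<Phi> N) 0 = 0"
      using False by (simp add: coeff_mult_0 Suc_diff_le)
    then show ?thesis
      using False high[of "Suc k"] by (simp add: \<kappa>.verblunsky_eq_coeff)
  qed
  have "c = sqnorm (\<Phi> N)"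
  proof -
    have "\<kappa>.sqnorm (\<kappa>.\<Phi> N) = sqnorm (\<Phi> N)"
      by (simp add: \<kappa>.sqnorm_monic_OP sqnorm_monic_OP vb)
    moreover have "\<kappa>.sqnorm (\<kappa>.\<Phi> N) = (\<integral>\<theta>. ?w \<theta> *\<^sub>R (norm (poly (\<Phi> N) (cis \<theta>)))\<^sup>2 \<partial>angle_prob)"
      unfolding circle_sqnorm_def low'[OF order_refl] unfolding \<kappa>_def
      using wm wpos by (intro integral_angle_density circle_continuous_measurable continuous_intros) (auto intro: less_imp_le)
    moreover have "\<dots> = (\<integral>\<theta>. c \<partial>angle_prob)"
      by (rule Bochner_Integration.integral_cong[OF refl]) (use poly_monic_OP_circle_neq_0 in auto)
    ultimately show ?thesis
      by (simp add: angle_prob.prob_space[simplified])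
  qed
  then have "\<kappa> = \<nu>"
    by (simp add: \<kappa>_def \<nu>_def bs_weight_def[abs_def])
  then show "nontrivial_circle_prob \<nu>" "\<And>k. verblunsky \<nu> k = (if k < N then \<alpha> k else 0)"
    using nt vb by simp_all
qed

text \<open>The last coefficient kept in \<^const>\<open>bernstein_szego\<close> has index \<open>n\<close>, so the weight involves \<open>\<Phi>\<^sub>n\<^sub>+\<^sub>1\<close>.\<close>

lemma bernstein_szego_eq: "bernstein_szego \<mu> n = angle_density (bs_weight \<mu> (Suc n))"
  unfolding bernstein_szego_def
proof (rule the_equality, safe)
  let ?\<nu> = "angle_density (bs_weight \<mu> (Suc n))"
  show "nontrivial_circle_prob ?\<nu>"
    by (rule bs_measure_verblunsky)
  show "verblunsky ?\<nu> k = (if k \<le> n then \<alpha> k else 0)" for k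
    using bs_measure_verblunsky(2)[of "Suc n" k] by (simp add: less_Suc_eq_le)
  fix \<kappa> assume \<kappa>: "nontrivial_circle_prob \<kappa>" "\<forall>k. verblunsky \<kappa> k = (if k \<le> n then \<alpha> k else 0)"
  have "(LINT z|\<kappa>. z ^ k) = (LINT z|?\<nu>. z ^ k)" for k
    by (rule moments_determined[where N = k, OF \<kappa>(1) bs_measure_verblunsky(1)])
       (use \<kappa>(2) bs_measure_verblunsky(2)[of "Suc n"] in \<open>auto simp: less_Suc_eq_le\<close>)
  then show "\<kappa> = ?\<nu>"
    using \<kappa>(1) bs_measure_verblunsky(1)[of "Suc n"]
    by (intro circle_measure_eq_moments) (auto simp: nontrivial_circle_prob_def)
qed

lemma bernstein_szego_weak_convergence:
  fixes h :: "complex \<Rightarrow> real"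
  assumes h: "continuous_on (sphere 0 1) h"
  shows "(\<lambda>n. \<integral>\<theta>. bs_weight \<mu> (Suc n) \<theta> * h (cis \<theta>) \<partial>angle_prob) \<longlonglongrightarrow> (LINT z|\<mu>. h z)"
proof -
  have "(\<lambda>n. LINT z|angle_density (bs_weight \<mu> (Suc n)). h z) \<longlonglongrightarrow> (LINT z|\<mu>. h z)"
  proof (rule weak_convergence_of_moments[OF _ _ prob_space_axioms sets_eq _ h])
    show "prob_space (angle_density (bs_weight \<mu> (Suc n)))" for n
      using bs_measure_verblunsky(1)[of "Suc n"] by (simp add: nontrivial_circle_prob_def)
    show "(LINT z|angle_density (bs_weight \<mu> (Suc n)). z ^ k) = (LINT z|\<mu>. z ^ k)" if "k \<le> n" for n k
      by (rule moments_determined[where N = k, OF bs_measure_verblunsky(1) nontrivial])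
         (use that bs_measure_verblunsky(2)[of "Suc n"] in auto)
  qed simp
  moreover have "(LINT z|angle_density (bs_weight \<mu> (Suc n)). h z) =
      (\<integral>\<theta>. bs_weight \<mu> (Suc n) \<theta> * h (cis \<theta>) \<partial>angle_prob)" for n
    unfolding bs_weight_def[abs_def]
    using circle_comp_measurable[OF inverse_OP_continuous] sqnorm_nonneg
    by (subst integral_angle_density)
       (auto intro!: circle_continuous_measurable[OF refl h])
  ultimately show ?thesis
    by simp
qed

end

section \<open>Lebesgue decomposition\<close>

text \<open>The sum of two measures on the same sigma-algebra.\<close>

definition sum_measure :: "'a measure \<Rightarrow> 'a measure \<Rightarrow> 'a measure" where
  "sum_measure M N = measure_of (space M) (sets M) (\<lambda>A. emeasure M A + emeasure N A)"

lemma sets_sum_measure [simp, measurable_cong]: "sets (sum_measure M N) = sets M"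
  and space_sum_measure [simp]: "space (sum_measure M N) = space M"
  by (simp_all add: sum_measure_def)

lemma emeasure_sum_measure:
  assumes "sets N = sets M" "A \<in> sets M"
  shows "emeasure (sum_measure M N) A = emeasure M A + emeasure N A"
  unfolding sum_measure_def
proof (rule emeasure_measure_of_sigma)
  show "countably_additive (sets M) (\<lambda>A. emeasure M A + emeasure N A)"
    unfolding countably_additive_def
    using assms(1) by (auto simp: suminf_add[symmetric] suminf_emeasure)
qed (use assms in \<open>auto simp: positive_def intro: sets.sigma_algebra_axioms\<close>)

lemma finite_measure_sum_measure:
  assumes "finite_measure M" "finite_measure N" "sets N = sets M"
  shows "finite_measure (sum_measure M N)"
proof
  interpret M: finite_measure M by fact
  interpret N: finite_measure N by fact
  show "emeasure (sum_measure M N) (space (sum_measure M N)) \<noteq> \<infinity>"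
    using M.emeasure_finite N.emeasure_finite by (simp add: emeasure_sum_measure[OF assms(3)])
qed

lemma absolutely_continuous_sum_measure:
  assumes "sets N = sets M"
  shows "absolutely_continuous (sum_measure M N) M" "absolutely_continuous (sum_measure M N) N"
  using assms by (auto simp: absolutely_continuous_def null_sets_def emeasure_sum_measure)

lemma AE_sum_measureD:
  assumes "AE x in sum_measure M N. P x" "sets N = sets M"
  shows "AE x in M. P x" "AE x in N. P x"
  by (rule absolutely_continuous_AE[OF _ _ assms(1)];
      use assms(2) in \<open>simp add: absolutely_continuous_sum_measure\<close>)+

text \<open>Lebesgue decomposition, obtained from the densities of both measures with respect to
  their sum.\<close>

lemma lebesgue_decomposition:
  assumes M: "finite_measure M" and N: "finite_measure N" and sets: "sets N = sets M"
  obtains A f where "A \<in> null_sets M" "f \<in> borel_measurable M"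
    "\<And>x. f x \<noteq> \<infinity>" "\<And>B. B \<in> sets M \<Longrightarrow> emeasure N B = emeasure (density M f) B + emeasure N (B \<inter> A)"
proof -
  let ?L = "sum_measure M N"
  interpret M: finite_measure M by fact
  interpret N: finite_measure N by fact
  interpret L: finite_measure ?L
    by (rule finite_measure_sum_measure) fact+
  define g where "g = RN_deriv ?L M"
  have g [measurable]: "g \<in> borel_measurable M"
    using borel_measurable_RN_deriv[of ?L M] unfolding g_def by simp
  have gM: "density ?L g = M"
    unfolding g_def by (rule L.density_RN_deriv[OF absolutely_continuous_sum_measure(1)[OF sets]]) simp
  have gL: "g \<in> borel_measurable ?L"
    using g by simp
  \<comment> \<open>\<open>M\<close> does not charge \<open>A\<close>, and off \<open>A\<close> the measure \<open>N\<close> is absolutely continuous.\<close>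
  define A where "A = {x \<in> space M. g x = 0}"
  have A: "A \<in> sets M"
    unfolding A_def by measurable
  have "A \<in> null_sets (density ?L g)"
    unfolding null_sets_density_iff[OF gL] using A by (auto simp: A_def)
  then have "A \<in> null_sets M"
    by (simp add: gM)
  define K where "K = density N (indicator (space M - A))"
  have KB: "emeasure K B = emeasure N (B - A)" if "B \<in> sets M" for B
  proof -
    have "B \<inter> (space M - A) = B - A"
      using sets.sets_into_space[OF that] by auto
    then have "(\<integral>\<^sup>+x. indicator (space M - A) x * indicator B x \<partial>N) = (\<integral>\<^sup>+x. indicator (B - A) x \<partial>N)"
      by (metis (no_types) indicator_inter_arith mult.commute)
    then show ?thesis
      unfolding K_def using that A sets by (subst emeasure_density) auto
  qed
  have "finite_measure K"
  proof
    have "space K = space M"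
      by (simp add: K_def sets_eq_imp_space_eq[OF sets])
    then show "emeasure K (space K) \<noteq> \<infinity>"
      using KB[OF sets.top] N.emeasure_finite by simp
  qed
  then interpret K: finite_measure K .
  have "absolutely_continuous M K"
    unfolding absolutely_continuous_def
  proof
    fix B assume "B \<in> null_sets M"
    then have B: "B \<in> sets M" "B \<in> null_sets (density ?L g)"
      by (auto simp: gM)
    then have "AE x in ?L. x \<in> B \<longrightarrow> g x = 0"
      unfolding null_sets_density_iff[OF gL] by auto
    then have "AE x in ?L. \<not> x \<in> B - A"
      using AE_space by eventually_elim (auto simp: A_def)
    then have "AE x in N. \<not> x \<in> B - A"
      by (rule AE_sum_measureD(2)) (rule sets)
    then have "emeasure N {x \<in> space N. x \<in> B - A} = 0"
      by (rule emeasure_eq_0_AE)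
    also have "{x \<in> space N. x \<in> B - A} = B - A"
      using sets.sets_into_space[OF B(1)] by (auto simp: sets_eq_imp_space_eq[OF sets])
    finally show "B \<in> null_sets K"
      using B KB[of B] by (simp add: null_sets_def K_def sets)
  qed
  then have d: "density M (RN_deriv M K) = K"
    by (rule M.density_RN_deriv) (simp add: K_def sets)
  have fin: "AE x in M. RN_deriv M K x \<noteq> \<infinity>"
    by (rule M.RN_deriv_finite[OF K.sigma_finite_measure_axioms \<open>absolutely_continuous M K\<close>]) (simp add: K_def sets)
  define f where "f x = ennreal (enn2real (RN_deriv M K x))" for x
  have fm: "f \<in> borel_measurable M"
    unfolding f_def by measurable
  then have "density M f = density M (RN_deriv M K)"
    by (rule density_cong) (use fin in \<open>auto simp: f_def less_top[symmetric]\<close>)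
  then have df: "density M f = K"
    by (simp add: d)
  show ?thesis
  proof (rule that[of A f])
    show "emeasure N B = emeasure (density M f) B + emeasure N (B \<inter> A)" if B: "B \<in> sets M" for B
      unfolding df KB[OF B] using B A sets by (subst plus_emeasure) (auto intro!: arg_cong[of _ _ "emeasure N"])
  qed (use \<open>A \<in> null_sets M\<close> fm in \<open>auto simp: f_def\<close>)
qed

lemma circle_lebesgue_eq: "circle_lebesgue = distr angle_prob circle_borel cis"
  by (simp add: circle_lebesgue_def)

lemma sets_circle_lebesgue [simp, measurable_cong]: "sets circle_lebesgue = sets circle_borel"
  by (simp add: circle_lebesgue_def)

interpretation circle_lebesgue: prob_space circle_lebesgue
  unfolding circle_lebesgue_eq by (rule angle_prob.prob_space_distr) measurable

lemma AE_circle_lebesgue_not_in: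
  assumes "A \<in> sets circle_borel"
  shows "emeasure circle_lebesgue A = 0 \<longleftrightarrow> (AE \<theta> in angle_prob. cis \<theta> \<notin> A)"
proof -
  have "emeasure circle_lebesgue A = 0 \<longleftrightarrow> (AE z in circle_lebesgue. z \<notin> A)"
    using assms by (subst AE_iff_null_sets[symmetric]) (auto simp: null_sets_def)
  also have "\<dots> \<longleftrightarrow> (AE \<theta> in angle_prob. cis \<theta> \<notin> A)"
    unfolding circle_lebesgue_eq
  proof (rule AE_distr_iff)
    have "{z \<in> space circle_borel. z \<notin> A} = space circle_borel - A"
      by auto
    then show "{z \<in> space circle_borel. z \<notin> A} \<in> sets circle_borel"
      using sets.compl_sets[OF assms] by simp
  qed measurable
  finally show ?thesis .
qed

lemma is_ac_weight_iff:
  "is_ac_weight \<mu> w \<longleftrightarrow>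
     w \<in> borel_measurable angle_prob \<and> (\<forall>\<theta>\<in>{0..<2 * pi}. 0 \<le> w \<theta>) \<and>
     (\<exists>\<sigma>. sets \<sigma> = sets circle_borel \<and> circle_singular \<sigma> \<and>
        (\<forall>A\<in>sets circle_borel. emeasure \<mu> A = emeasure (angle_density w) A + emeasure \<sigma> A))"
  by (simp add: is_ac_weight_def angle_density_def)

lemma is_ac_weight_exists:
  assumes \<mu>: "finite_measure \<mu>" "sets \<mu> = sets circle_borel"
  shows "\<exists>w. is_ac_weight \<mu> w"
proof -
  obtain N f where N: "N \<in> null_sets circle_lebesgue" and f: "f \<in> borel_measurable circle_lebesgue"
    "\<And>z. f z \<noteq> \<infinity>" "\<And>B. B \<in> sets circle_lebesgue \<Longrightarrow>
        emeasure \<mu> B = emeasure (density circle_lebesgue f) B + emeasure \<mu> (B \<inter> N)"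
    using lebesgue_decomposition[OF circle_lebesgue.finite_measure_axioms \<mu>(1)] \<mu>(2) by auto
  define w where "w \<theta> = enn2real (f (cis \<theta>))" for \<theta>
  have [measurable]: "f \<in> borel_measurable circle_borel"
    using f(1) by simp
  have "(\<lambda>\<theta>. ennreal (w \<theta>)) = (\<lambda>\<theta>. f (cis \<theta>))"
    using f(2) by (auto simp: w_def less_top[symmetric])
  then have d: "density circle_lebesgue f = angle_density w"
    unfolding circle_lebesgue_eq angle_density_def by (simp add: density_distr)
  have NA: "N \<in> sets circle_borel"
    using N by (auto simp: null_sets_def)
  define \<sigma> where "\<sigma> = density \<mu> (indicator N)"
  have \<sigma>: "emeasure \<sigma> B = emeasure \<mu> (B \<inter> N)" if "B \<in> sets circle_borel" for B
  proof -
    have "(\<integral>\<^sup>+x. indicator N x * indicator B x \<partial>\<mu>) = (\<integral>\<^sup>+x. indicator (B \<inter> N) x \<partial>\<mu>)"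
      by (simp add: indicator_inter_arith mult.commute)
    then show ?thesis
      unfolding \<sigma>_def using that NA \<mu>(2) by (subst emeasure_density) auto
  qed
  have "sphere 0 1 - N \<in> sets circle_borel"
    using sets.compl_sets[OF NA] by simp
  then have "emeasure \<sigma> (sphere 0 1 - N) = 0"
    by (simp add: \<sigma> Int_commute)
  then have "circle_singular \<sigma>"
    unfolding circle_singular_def using N NA by (intro bexI[of _ N]) (auto simp: null_sets_def)
  moreover have "w \<in> borel_measurable angle_prob"
    unfolding w_def by measurable
  ultimately have "is_ac_weight \<mu> w"
    unfolding is_ac_weight_iff using f(3) \<sigma>
    by (intro conjI exI[of _ \<sigma>]) (auto simp: d \<sigma>_def \<mu>(2) w_def)
  then show ?thesis
    by blast
qed

text \<open>Away from a Lebesgue null set the measure has the weight as its density.\<close>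

lemma is_ac_weight_off_null:
  assumes w: "is_ac_weight \<mu> w" and \<mu>: "sets \<mu> = sets circle_borel"
  obtains N where "N \<in> sets circle_borel" "AE \<theta> in angle_prob. cis \<theta> \<notin> N"
    "density \<mu> (indicator (sphere 0 1 - N)) = angle_density w"
proof -
  obtain \<sigma> N where \<sigma>: "sets \<sigma> = sets circle_borel"
      "\<And>A. A \<in> sets circle_borel \<Longrightarrow> emeasure \<mu> A = emeasure (angle_density w) A + emeasure \<sigma> A"
    and N: "N \<in> sets circle_borel" "emeasure circle_lebesgue N = 0" "emeasure \<sigma> (sphere 0 1 - N) = 0"
    using w unfolding is_ac_weight_iff circle_singular_def by auto
  have wm: "w \<in> borel_measurable angle_prob"
    using w by (simp add: is_ac_weight_iff)
  have ae: "AE \<theta> in angle_prob. cis \<theta> \<notin> N"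
    using N by (simp add: AE_circle_lebesgue_not_in)
  have "density \<mu> (indicator (sphere 0 1 - N)) = angle_density w"
  proof (rule measure_eqI)
    fix A assume "A \<in> sets (density \<mu> (indicator (sphere 0 1 - N)))"
    then have A: "A \<in> sets circle_borel"
      by (simp add: \<mu>)
    have S: "sphere 0 1 - N \<in> sets circle_borel"
      using sets.compl_sets[OF N(1)] by simp
    have AN: "A - N \<in> sets circle_borel" "(sphere 0 1 - N) \<inter> A = A - N"
      using A N sets_circle_borelD(2)[OF A] by auto
    have "emeasure (density \<mu> (indicator (sphere 0 1 - N))) A =
        (\<integral>\<^sup>+z. indicator (sphere 0 1 - N) z * indicator A z \<partial>\<mu>)"
      using A S \<mu> by (subst emeasure_density) auto
    also have "\<dots> = (\<integral>\<^sup>+z. indicator (A - N) z \<partial>\<mu>)"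
      using AN(2) by (metis (no_types) indicator_inter_arith)
    also have "\<dots> = emeasure \<mu> (A - N)"
      using AN \<mu> by simp
    also have "\<dots> = emeasure (angle_density w) (A - N)"
    proof -
      have "emeasure \<sigma> (A - N) \<le> emeasure \<sigma> (sphere 0 1 - N)"
        using S \<sigma>(1) sets_circle_borelD(2)[OF A] by (intro emeasure_mono) auto
      then show ?thesis
        using N(3) \<sigma>(2)[OF AN(1)] by simp
    qed
    also have "\<dots> = emeasure (angle_density w) A"
      unfolding emeasure_angle_density[OF wm AN(1)] emeasure_angle_density[OF wm A]
      by (rule nn_integral_cong_AE) (use ae in \<open>eventually_elim; simp add: indicator_def\<close>)
    finally show "emeasure (density \<mu> (indicator (sphere 0 1 - N))) A = emeasure (angle_density w) A" .
  qed (simp add: \<mu>)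
  then show ?thesis
    using that N(1) ae by blast
qed

lemma angle_density_eq_imp_AE_eq:
  assumes v: "v \<in> borel_measurable angle_prob" "\<And>\<theta>. \<theta> \<in> {0..<2 * pi} \<Longrightarrow> 0 \<le> v \<theta>"
    and w: "w \<in> borel_measurable angle_prob" "\<And>\<theta>. \<theta> \<in> {0..<2 * pi} \<Longrightarrow> 0 \<le> w \<theta>"
    and eq: "angle_density v = angle_density w"
  shows "AE \<theta> in angle_prob. v \<theta> = w \<theta>"
proof -
  have "density angle_prob (\<lambda>\<theta>. ennreal (v \<theta>)) = density angle_prob (\<lambda>\<theta>. ennreal (w \<theta>))"
  proof (rule measure_eqI)
    fix B assume "B \<in> sets (density angle_prob (\<lambda>\<theta>. ennreal (v \<theta>)))"
    then have B: "B \<in> sets angle_prob"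
      by simp
    define A where "A = Arg2pi -` B \<inter> sphere 0 1"
    have A: "A \<in> sets circle_borel"
      using measurable_sets[OF Arg2pi_measurable B] by (simp add: A_def)
    have *: "emeasure (density angle_prob (\<lambda>\<theta>. ennreal (u \<theta>))) B = emeasure (angle_density u) A"
      if u: "u \<in> borel_measurable angle_prob" for u
      unfolding emeasure_angle_density[OF u A] using u B
      by (subst emeasure_density)
         (auto simp: A_def indicator_def Arg2pi_cis intro!: nn_integral_cong)
    show "emeasure (density angle_prob (\<lambda>\<theta>. ennreal (v \<theta>))) B = emeasure (density angle_prob (\<lambda>\<theta>. ennreal (w \<theta>))) B"
      using *[OF v(1)] *[OF w(1)] eq by simp
  qed simp
  then have "AE \<theta> in angle_prob. ennreal (v \<theta>) = ennreal (w \<theta>)"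
    using v(1) w(1) by (subst (asm) angle_prob.density_unique_iff) auto
  with AE_space show ?thesis
  proof eventually_elim
    case (elim \<theta>)
    then show ?case using v(2)[of \<theta>] w(2)[of \<theta>] by simp
  qed
qed

text \<open>The weight of an absolutely continuous measure is its density.\<close>

lemma ac_weight_angle_density:
  assumes v: "v \<in> borel_measurable angle_prob" "\<And>\<theta>. \<theta> \<in> {0..<2 * pi} \<Longrightarrow> 0 \<le> v \<theta>"
    and w: "is_ac_weight (angle_density v) w"
  shows "AE \<theta> in angle_prob. w \<theta> = v \<theta>"
proof -
  obtain N where N: "N \<in> sets circle_borel" "AE \<theta> in angle_prob. cis \<theta> \<notin> N"
      "density (angle_density v) (indicator (sphere 0 1 - N)) = angle_density w"
    using is_ac_weight_off_null[OF w] by auto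
  have "density (angle_density v) (indicator (sphere 0 1 - N)) = density (angle_density v) (\<lambda>_. 1)"
  proof (rule density_cong)
    have "emeasure (angle_density v) N = 0"
    proof -
      have "emeasure (angle_density v) N = (\<integral>\<^sup>+\<theta>. 0 \<partial>angle_prob)"
        unfolding emeasure_angle_density[OF v(1) N(1)]
        by (rule nn_integral_cong_AE) (use N(2) in \<open>eventually_elim; simp add: indicator_def\<close>)
      then show ?thesis by simp
    qed
    then have "AE z in angle_density v. z \<notin> N"
      using N(1) by (subst AE_iff_null_sets[symmetric]) (auto simp: null_sets_def)
    with AE_space show "AE z in angle_density v. indicator (sphere 0 1 - N) z = (1::ennreal)"
      by eventually_elim (simp add: space_circle_measure indicator_def)
  qed (use sets.compl_sets[OF N(1)] in auto)
  then have "angle_density v = angle_density w"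
    using N(3) by (simp add: density_1)
  then have "AE \<theta> in angle_prob. v \<theta> = w \<theta>"
    using v w by (intro angle_density_eq_imp_AE_eq) (auto simp: is_ac_weight_iff)
  then show ?thesis
    by eventually_elim simp
qed

lemma is_ac_weight_ac_weight:
  assumes "finite_measure \<mu>" "sets \<mu> = sets circle_borel"
  shows "is_ac_weight \<mu> (ac_weight \<mu>)"
  unfolding ac_weight_def using is_ac_weight_exists[OF assms] by (rule someI_ex)

section \<open>The weight of a measure\<close>

lemma angle_density_cong:
  assumes "v \<in> borel_measurable angle_prob" "w \<in> borel_measurable angle_prob"
    "\<And>\<theta>. \<theta> \<in> {0..<2 * pi} \<Longrightarrow> v \<theta> = w \<theta>"
  shows "angle_density v = angle_density w"
proof -
  have "density angle_prob (\<lambda>\<theta>. ennreal (v \<theta>)) = density angle_prob (\<lambda>\<theta>. ennreal (w \<theta>))"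
    using assms by (intro density_cong) (auto intro!: AE_I2)
  then show ?thesis
    by (simp add: angle_density_def)
qed

context nontrivial_circle
begin

text \<open>A choice of the weight that is nonnegative on the whole line; on \<open>[0, 2\<pi>)\<close> it is the given one.\<close>

definition weight :: "real \<Rightarrow> real" where
  "weight \<theta> = max 0 (ac_weight \<mu> \<theta>)"

lemma is_ac_weight_ac_weight_mu: "is_ac_weight \<mu> (ac_weight \<mu>)"
  by (rule is_ac_weight_ac_weight[OF finite_measure_axioms sets_eq])

lemma weight_measurable [measurable]: "weight \<in> borel_measurable angle_prob"
proof -
  have [measurable]: "ac_weight \<mu> \<in> borel_measurable angle_prob"
    using is_ac_weight_ac_weight_mu by (simp add: is_ac_weight_iff)
  show ?thesis
    unfolding weight_def[abs_def] by measurable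
qed

lemma weight_nonneg [simp]: "0 \<le> weight \<theta>"
  by (simp add: weight_def)

lemma weight_eq: "\<theta> \<in> {0..<2 * pi} \<Longrightarrow> weight \<theta> = ac_weight \<mu> \<theta>"
  using is_ac_weight_ac_weight_mu by (simp add: is_ac_weight_iff weight_def)

lemma weight_off_null:
  obtains N where "N \<in> sets circle_borel" "AE \<theta> in angle_prob. cis \<theta> \<notin> N"
    "\<And>h :: complex \<Rightarrow> real. h \<in> borel_measurable circle_borel \<Longrightarrow>
        (LINT z|\<mu>. indicator (sphere 0 1 - N) z * h z) = (\<integral>\<theta>. weight \<theta> * h (cis \<theta>) \<partial>angle_prob)"
    "\<And>h :: complex \<Rightarrow> real. integrable \<mu> h \<Longrightarrow> integrable angle_prob (\<lambda>\<theta>. weight \<theta> * h (cis \<theta>))"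
proof -
  obtain N where N: "N \<in> sets circle_borel" "AE \<theta> in angle_prob. cis \<theta> \<notin> N"
    "density \<mu> (indicator (sphere 0 1 - N)) = angle_density (ac_weight \<mu>)"
    using is_ac_weight_off_null[OF is_ac_weight_ac_weight_mu sets_eq] by blast
  have "angle_density (ac_weight \<mu>) = angle_density weight"
    using is_ac_weight_ac_weight_mu by (intro angle_density_cong) (auto simp: is_ac_weight_iff weight_eq)
  then have eq: "density \<mu> (\<lambda>z. ennreal (indicator (sphere 0 1 - N) z)) = angle_density weight"
    using N(3) by (simp add: ennreal_indicator)
  have S: "sphere 0 1 - N \<in> sets circle_borel"
    using sets.compl_sets[OF N(1)] by simp
  have Sm [measurable]: "(indicator (sphere 0 1 - N) :: complex \<Rightarrow> real) \<in> borel_measurable \<mu>"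
    using S by (simp add: sets_eq)
  show ?thesis
  proof (rule that[OF N(1,2)])
    fix h :: "complex \<Rightarrow> real" assume [measurable]: "h \<in> borel_measurable circle_borel"
    have hm: "h \<in> borel_measurable \<mu>"
      by measurable
    have "(LINT z|\<mu>. indicator (sphere 0 1 - N) z * h z) =
        (LINT z|density \<mu> (\<lambda>z. ennreal (indicator (sphere 0 1 - N) z)). h z)"
      using integral_density[OF hm Sm] by simp
    also have "\<dots> = (\<integral>\<theta>. weight \<theta> * h (cis \<theta>) \<partial>angle_prob)"
      unfolding eq by (subst integral_angle_density) auto
    finally show "(LINT z|\<mu>. indicator (sphere 0 1 - N) z * h z) = (\<integral>\<theta>. weight \<theta> * h (cis \<theta>) \<partial>angle_prob)" .
  next
    fix h :: "complex \<Rightarrow> real" assume h: "integrable \<mu> h"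
    then have hm: "h \<in> borel_measurable \<mu>" by simp
    then have [measurable]: "h \<in> borel_measurable circle_borel"
      by (simp add: measurable_cong_sets[OF sets_eq refl])
    have "integrable \<mu> (\<lambda>z. indicator (sphere 0 1 - N) z *\<^sub>R h z)"
      using S h by (intro integrable_mult_indicator) (auto simp: sets_eq)
    then have "integrable (angle_density weight) h"
      unfolding eq[symmetric] using integrable_density[OF hm Sm] by simp
    then have "integrable (density angle_prob (\<lambda>\<theta>. ennreal (weight \<theta>))) (\<lambda>\<theta>. h (cis \<theta>))"
      unfolding angle_density_def by (rule integrable_distr[rotated]) simp
    then show "integrable angle_prob (\<lambda>\<theta>. weight \<theta> * h (cis \<theta>))"
      by (subst (asm) integrable_density) auto
  qed
qed

text \<open>The absolutely continuous part is at most \<open>\<mu>\<close>.\<close>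

lemma weight_integral_le:
  fixes h :: "complex \<Rightarrow> real"
  assumes h: "continuous_on (sphere 0 1) h" "\<And>z. z \<in> sphere 0 1 \<Longrightarrow> 0 \<le> h z"
  shows "integrable angle_prob (\<lambda>\<theta>. weight \<theta> * h (cis \<theta>))"
    and "(\<integral>\<theta>. weight \<theta> * h (cis \<theta>) \<partial>angle_prob) \<le> (LINT z|\<mu>. h z)"
proof -
  obtain N where N: "N \<in> sets circle_borel" "AE \<theta> in angle_prob. cis \<theta> \<notin> N"
    "\<And>h :: complex \<Rightarrow> real. h \<in> borel_measurable circle_borel \<Longrightarrow>
        (LINT z|\<mu>. indicator (sphere 0 1 - N) z * h z) = (\<integral>\<theta>. weight \<theta> * h (cis \<theta>) \<partial>angle_prob)"
    "\<And>h :: complex \<Rightarrow> real. integrable \<mu> h \<Longrightarrow> integrable angle_prob (\<lambda>\<theta>. weight \<theta> * h (cis \<theta>))"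
    by (rule weight_off_null) (rule that)
  have hi: "integrable \<mu> h"
    by (rule continuous_integrable[OF h(1)])
  then show "integrable angle_prob (\<lambda>\<theta>. weight \<theta> * h (cis \<theta>))"
    by (rule N(4))
  have S: "sphere 0 1 - N \<in> sets circle_borel"
    using sets.compl_sets[OF N(1)] by simp
  have "(\<integral>\<theta>. weight \<theta> * h (cis \<theta>) \<partial>angle_prob) = (LINT z|\<mu>. indicator (sphere 0 1 - N) z * h z)"
    by (rule N(3)[symmetric]) (rule circle_continuous_measurable[OF refl h(1)])
  also have "\<dots> \<le> (LINT z|\<mu>. h z)"
  proof (rule integral_mono[OF _ hi])
    show "integrable \<mu> (\<lambda>z. indicator (sphere 0 1 - N) z * h z)"
      using integrable_mult_indicator[OF _ hi, of "sphere 0 1 - N"] S by (simp add: sets_eq)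
    show "indicator (sphere 0 1 - N) z * h z \<le> h z" if "z \<in> space \<mu>" for z
      using h(2)[of z] that by (simp add: indicator_def)
  qed
  finally show "(\<integral>\<theta>. weight \<theta> * h (cis \<theta>) \<partial>angle_prob) \<le> (LINT z|\<mu>. h z)" .
qed

lemma weight_integrable: "integrable angle_prob weight"
  and weight_integral_le_1: "(\<integral>\<theta>. weight \<theta> \<partial>angle_prob) \<le> 1"
  using weight_integral_le[of "\<lambda>_. 1"] prob_space by simp_all

abbreviation approx_weight :: "nat \<Rightarrow> real \<Rightarrow> real" where
  "approx_weight n \<equiv> bs_weight \<mu> (Suc n)"

lemma approx_weight_circle:
  obtains p :: "complex \<Rightarrow> real" where "continuous_on (sphere 0 1) p"
    "\<And>z. z \<in> sphere 0 1 \<Longrightarrow> 0 < p z" "\<And>\<theta>. approx_weight n \<theta> = p (cis \<theta>)"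
proof (rule that)
  show "continuous_on (sphere 0 1) (\<lambda>z. sqnorm (\<Phi> (Suc n)) / (norm (poly (\<Phi> (Suc n)) z))\<^sup>2)"
    by (rule inverse_OP_continuous)
  show "0 < sqnorm (\<Phi> (Suc n)) / (norm (poly (\<Phi> (Suc n)) z))\<^sup>2" if "z \<in> sphere 0 1" for z
    using poly_monic_OP_circle_neq_0[OF that] sqnorm_pos[of "\<Phi> (Suc n)"] by simp
qed (simp add: bs_weight_def)

lemma approx_weight_pos: "0 < approx_weight n \<theta>"
  by (rule approx_weight_circle[of n]) simp

lemma approx_weight_comp_integrable:
  fixes F :: "complex \<Rightarrow> real"
  assumes F: "continuous_on (sphere 0 1) F"
  shows "integrable angle_prob (\<lambda>\<theta>. approx_weight n \<theta> * F (cis \<theta>))"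
    and "integrable angle_prob (\<lambda>\<theta>. F (cis \<theta>) * ln (approx_weight n \<theta>))"
proof -
  obtain p where p: "continuous_on (sphere 0 1) p"
    "\<And>z. z \<in> sphere 0 1 \<Longrightarrow> 0 < p z" "\<And>\<theta>. approx_weight n \<theta> = p (cis \<theta>)"
    using approx_weight_circle by blast
  show "integrable angle_prob (\<lambda>\<theta>. approx_weight n \<theta> * F (cis \<theta>))"
    unfolding p(3) by (rule circle_comp_integrable) (intro continuous_intros p F)
  show "integrable angle_prob (\<lambda>\<theta>. F (cis \<theta>) * ln (approx_weight n \<theta>))"
    unfolding p(3) by (rule circle_comp_integrable) (intro continuous_intros p F; use p(2) in force)
qed

text \<open>The ratio \<open>w/w\<^sub>n\<close> is \<open>w\<close> times the square modulus of the normalised orthogonal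
  polynomial.\<close>

lemma ratio_integrable:
  fixes G :: "complex \<Rightarrow> real"
  assumes G: "continuous_on (sphere 0 1) G"
  shows "integrable angle_prob (\<lambda>\<theta>. G (cis \<theta>) * (weight \<theta> / approx_weight n \<theta>))"
proof -
  obtain p where p: "continuous_on (sphere 0 1) p"
    "\<And>z. z \<in> sphere 0 1 \<Longrightarrow> 0 < p z" "\<And>\<theta>. approx_weight n \<theta> = p (cis \<theta>)"
    using approx_weight_circle by blast
  have *: "integrable angle_prob (\<lambda>\<theta>. weight \<theta> * h (cis \<theta>))" if "integrable \<mu> h" for h :: "complex \<Rightarrow> real"
    by (rule weight_off_null) (use that in blast)
  have "integrable \<mu> (\<lambda>z. G z / p z)"
    by (rule continuous_integrable, intro continuous_intros p G) (use p(2) in force)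
  from *[OF this] show ?thesis
    by (simp add: p(3) mult_ac)
qed

text \<open>The normalised orthogonal polynomial has norm \<open>1\<close> in \<open>L\<^sup>2(\<mu>)\<close>, hence norm at most \<open>1\<close> with respect to
  the absolutely continuous part.\<close>

lemma ratio_integral_le_1: "(\<integral>\<theta>. weight \<theta> / approx_weight n \<theta> \<partial>angle_prob) \<le> 1"
proof -
  let ?h = "\<lambda>z. (norm (poly (\<Phi> (Suc n)) z))\<^sup>2 / sqnorm (\<Phi> (Suc n))"
  have pos: "sqnorm (\<Phi> (Suc n)) > 0"
    by (rule sqnorm_pos) simp
  have "(\<integral>\<theta>. weight \<theta> / approx_weight n \<theta> \<partial>angle_prob) = (\<integral>\<theta>. weight \<theta> * ?h (cis \<theta>) \<partial>angle_prob)"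
    by (simp add: bs_weight_def)
  also have "\<dots> \<le> (LINT z|\<mu>. ?h z)"
    using pos by (intro weight_integral_le continuous_intros) auto
  also have "\<dots> = 1"
    using pos by (simp flip: circle_sqnorm_def)
  finally show ?thesis .
qed

section \<open>Upper and lower semicontinuity\<close>

text \<open>An asymptotic bound that depends on a continuous positive test function extends
  to Borel test functions when the bound is continuous under bounded convergence almost everywhere.\<close>

lemma test_function_extension:
  fixes a :: "nat \<Rightarrow> real" and R :: "(complex \<Rightarrow> real) \<Rightarrow> real"
  assumes v: "v \<in> borel_measurable circle_borel" "\<And>z. z \<in> sphere 0 1 \<Longrightarrow> c \<le> v z \<and> v z \<le> C" "c \<le> C"
    and cont: "\<And>h e. continuous_on UNIV h \<Longrightarrow> (\<And>z. c \<le> h z) \<Longrightarrow> (\<And>z. h z \<le> C) \<Longrightarrow> e > 0 \<Longrightarrow>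
        \<forall>\<^sub>F n in sequentially. a n \<le> R h + e"
    and lim: "\<And>h :: nat \<Rightarrow> complex \<Rightarrow> real. (\<And>j. continuous_on UNIV (h j)) \<Longrightarrow>
        (\<And>j z. c \<le> h j z) \<Longrightarrow> (\<And>j z. h j z \<le> C) \<Longrightarrow>
        (AE z in \<mu>. (\<lambda>j. h j z) \<longlonglongrightarrow> v z) \<Longrightarrow>
        (AE \<theta> in angle_prob. (\<lambda>j. h j (cis \<theta>)) \<longlonglongrightarrow> v (cis \<theta>)) \<Longrightarrow> (\<lambda>j. R (h j)) \<longlonglongrightarrow> R v"
    and "e > 0"
  shows "\<forall>\<^sub>F n in sequentially. a n \<le> R v + e"
proof -
  let ?L = "sum_measure \<mu> circle_lebesgue"
  have L: "finite_measure ?L" "sets ?L = sets circle_borel"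
    using finite_measure_sum_measure[OF finite_measure_axioms circle_lebesgue.finite_measure_axioms]
    by (simp_all add: sets_eq)
  obtain h :: "nat \<Rightarrow> complex \<Rightarrow> real" where h: "\<And>j. continuous_on UNIV (h j)"
      "\<And>j z. c \<le> h j z" "\<And>j z. h j z \<le> C" and ae: "AE z in ?L. (\<lambda>j. h j z) \<longlonglongrightarrow> v z"
  proof (rule circle_AE_approx[OF L _ v(2,3)])
    show "v \<in> borel_measurable ?L"
      using v(1) by (simp add: measurable_cong_sets[OF L(2) refl])
  qed (use that in blast)+
  have hm [measurable]: "h j \<in> borel_measurable circle_borel" for j
    using continuous_on_subset[OF h(1)] by (intro circle_continuous_measurable[OF refl]) auto
  note [measurable] = v(1)
  have ae': "AE z in \<mu>. (\<lambda>j. h j z) \<longlonglongrightarrow> v z" "AE z in circle_lebesgue. (\<lambda>j. h j z) \<longlonglongrightarrow> v z"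
    by (rule AE_sum_measureD[OF ae]; simp add: sets_eq)+
  have "AE \<theta> in angle_prob. (\<lambda>j. h j (cis \<theta>)) \<longlonglongrightarrow> v (cis \<theta>)"
    using ae'(2) unfolding circle_lebesgue_eq by (rule AE_distrD[OF cis_measurable])
  then have "(\<lambda>j. R (h j)) \<longlonglongrightarrow> R v"
    using h ae'(1) by (intro lim)
  then have "\<forall>\<^sub>F j in sequentially. R (h j) < R v + e / 2"
    using \<open>e > 0\<close> by (intro order_tendstoD(2)) auto
  then obtain j where j: "R (h j) < R v + e / 2"
    by (auto simp: eventually_sequentially)
  have "\<forall>\<^sub>F n in sequentially. a n \<le> R (h j) + e / 2"
    using h \<open>e > 0\<close> by (intro cont) auto
  then show ?thesis
    by eventually_elim (use j in linarith)
qed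

text \<open>Truncation to the interval \<open>[1 / k, k]\<close>, for \<open>k \<ge> 1\<close>.\<close>

definition trunc :: "real \<Rightarrow> real \<Rightarrow> real" where
  "trunc k t = max (1 / k) (min k t)"

lemma trunc_bounds: "k \<ge> 1 \<Longrightarrow> 1 / k \<le> trunc k t \<and> trunc k t \<le> k"
  by (auto simp: trunc_def intro: order_trans[of _ 1])

lemma trunc_pos: "k \<ge> 1 \<Longrightarrow> 0 < trunc k t"
  using trunc_bounds[of k t] by (meson less_le_trans zero_less_divide_1_iff zero_less_one order.strict_trans2)

lemma ratio_trunc_le:
  assumes "k \<ge> 1" "t \<ge> 0"
  shows "t / trunc k t \<le> 1 + t / k"
proof (cases "t \<le> k")
  case True
  then have "t \<le> trunc k t"
    by (simp add: trunc_def)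
  then have "t / trunc k t \<le> 1"
    using trunc_pos[OF assms(1), of t] by simp
  then show ?thesis
    using assms by (simp add: add_increasing2)
next
  case False
  moreover have "1 / k \<le> k"
    using assms by (auto intro: order_trans[of _ 1])
  ultimately have "trunc k t = k"
    by (simp add: trunc_def max_absorb2)
  then show ?thesis by simp
qed

text \<open>The test function is a truncation of \<open>1/w\<close>, set to its smallest value on a null set
  that carries the singular part of \<open>\<mu>\<close>.\<close>

lemma trunc_test_function:
  assumes k: "k \<ge> 1" and G: "continuous_on (sphere 0 1) G"
    "\<And>z. z \<in> sphere 0 1 \<Longrightarrow> 0 \<le> G z \<and> G z \<le> B"
  obtains v :: "complex \<Rightarrow> real" where "v \<in> borel_measurable circle_borel"
    "\<And>z. z \<in> sphere 0 1 \<Longrightarrow> 1 / k \<le> v z \<and> v z \<le> k"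
    "AE \<theta> in angle_prob. v (cis \<theta>) = 1 / trunc k (weight \<theta>)"
    "(LINT z|\<mu>. G z * v z) \<le> (\<integral>\<theta>. G (cis \<theta>) \<partial>angle_prob) + 2 * B / k"
proof -
  obtain N where N: "N \<in> sets circle_borel" "AE \<theta> in angle_prob. cis \<theta> \<notin> N"
    "\<And>h :: complex \<Rightarrow> real. h \<in> borel_measurable circle_borel \<Longrightarrow>
        (LINT z|\<mu>. indicator (sphere 0 1 - N) z * h z) = (\<integral>\<theta>. weight \<theta> * h (cis \<theta>) \<partial>angle_prob)"
    "\<And>h :: complex \<Rightarrow> real. integrable \<mu> h \<Longrightarrow> integrable angle_prob (\<lambda>\<theta>. weight \<theta> * h (cis \<theta>))"
    by (rule weight_off_null) (rule that)
  have B: "0 \<le> B"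
    using G(2)[of 1] by auto
  define v where "v z = (if z \<in> N then 1 / k else 1 / trunc k (weight (Arg2pi z)))" for z
  note [measurable] = N(1)
  have [measurable]: "(\<lambda>z. weight (Arg2pi z)) \<in> borel_measurable circle_borel"
    by (rule measurable_compose[OF Arg2pi_measurable weight_measurable])
  have vm [measurable]: "v \<in> borel_measurable circle_borel"
    unfolding v_def[abs_def] trunc_def by measurable
  have vb: "1 / k \<le> v z \<and> v z \<le> k" for z
  proof -
    have "1 / k \<le> 1 / trunc k t" "1 / trunc k t \<le> k" for t
      using trunc_bounds[OF k, of t] trunc_pos[OF k, of t] k by (auto simp: field_simps)
    moreover have "1 / k \<le> k"
      using k by (auto intro: order_trans[of _ 1])
    ultimately show ?thesis
      by (simp add: v_def)
  qed
  have Gm [measurable]: "G \<in> borel_measurable circle_borel"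
    by (rule circle_continuous_measurable[OF refl G(1)])
  have vae: "AE \<theta> in angle_prob. v (cis \<theta>) = 1 / trunc k (weight \<theta>)"
    using N(2) AE_space by eventually_elim (simp add: v_def Arg2pi_cis)
  have Gv: "integrable \<mu> (\<lambda>z. G z * v z)"
  proof (rule integrable_const_bound[of _ "B * k"])
    show "AE z in \<mu>. norm (G z * v z) \<le> B * k"
    proof (rule AE_I2)
      fix z assume "z \<in> space \<mu>"
      moreover have "0 \<le> v z"
        using vb[of z] k by (auto intro: order_trans[of 0 "1 / k"])
      ultimately show "norm (G z * v z) \<le> B * k"
        using G(2)[of z] vb[of z] by (auto simp: abs_mult intro!: mult_mono)
    qed
  qed measurable
  have S: "sphere 0 1 - N \<in> sets \<mu>"
    using sets.compl_sets[OF N(1)] by (simp add: sets_eq)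
  have GvS: "integrable \<mu> (\<lambda>z. indicator (sphere 0 1 - N) z * (G z * v z))"
    using integrable_mult_indicator[OF S Gv] by simp
  have Gw: "integrable angle_prob (\<lambda>\<theta>. weight \<theta> * G (cis \<theta>))"
    using G by (intro weight_integral_le) auto
  have Gi: "integrable angle_prob (\<lambda>\<theta>. G (cis \<theta>))"
    by (rule circle_comp_integrable[OF G(1)])
  have "(LINT z|\<mu>. G z * v z) \<le> (LINT z|\<mu>. B / k + indicator (sphere 0 1 - N) z * (G z * v z))"
  proof (rule integral_mono[OF Gv])
    show "G z * v z \<le> B / k + indicator (sphere 0 1 - N) z * (G z * v z)" if "z \<in> space \<mu>" for z
    proof (cases "z \<in> N")
      case True
      then show ?thesis
        using that G(2)[of z] k by (simp add: v_def divide_right_mono)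
    next
      case False
      then show ?thesis
        using that B k by simp
    qed
  qed (use GvS in auto)
  also have "\<dots> = B / k + (LINT z|\<mu>. indicator (sphere 0 1 - N) z * (G z * v z))"
    using GvS by (subst Bochner_Integration.integral_add) (auto simp: prob_space[simplified])
  also have "(LINT z|\<mu>. indicator (sphere 0 1 - N) z * (G z * v z)) =
      (\<integral>\<theta>. weight \<theta> * (G (cis \<theta>) * v (cis \<theta>)) \<partial>angle_prob)"
    by (rule N(3)) measurable
  also have "\<dots> \<le> (\<integral>\<theta>. G (cis \<theta>) + (B / k) * weight \<theta> \<partial>angle_prob)"
  proof (rule integral_mono_AE)
    show "AE \<theta> in angle_prob. weight \<theta> * (G (cis \<theta>) * v (cis \<theta>)) \<le> G (cis \<theta>) + B / k * weight \<theta>"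
      using vae
    proof eventually_elim
      case (elim \<theta>)
      have "weight \<theta> * (G (cis \<theta>) * v (cis \<theta>)) = G (cis \<theta>) * (weight \<theta> / trunc k (weight \<theta>))"
        by (simp add: elim)
      also have "\<dots> \<le> G (cis \<theta>) * (1 + weight \<theta> / k)"
        using G(2)[of "cis \<theta>"] by (intro mult_left_mono ratio_trunc_le k) auto
      also have "\<dots> = G (cis \<theta>) + G (cis \<theta>) * (weight \<theta> / k)"
        by (simp add: algebra_simps)
      also have "\<dots> \<le> G (cis \<theta>) + B * (weight \<theta> / k)"
        using G(2)[of "cis \<theta>"] k by (intro add_left_mono mult_right_mono) auto
      finally show ?case by simp
    qed
    show "integrable angle_prob (\<lambda>\<theta>. weight \<theta> * (G (cis \<theta>) * v (cis \<theta>)))"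
      by (rule N(4)[OF Gv])
  qed (use Gi weight_integrable in auto)
  also have "\<dots> = (\<integral>\<theta>. G (cis \<theta>) \<partial>angle_prob) + B / k * (\<integral>\<theta>. weight \<theta> \<partial>angle_prob)"
    using Gi weight_integrable by (subst Bochner_Integration.integral_add) auto
  also have "\<dots> \<le> (\<integral>\<theta>. G (cis \<theta>) \<partial>angle_prob) + B / k * 1"
    using B k weight_integral_le_1 by (intro add_left_mono mult_left_mono) auto
  finally have "(LINT z|\<mu>. G z * v z) \<le> (\<integral>\<theta>. G (cis \<theta>) \<partial>angle_prob) + 2 * B / k"
    by simp
  then show ?thesis
    using that vm vb vae by blast
qed

end

lemma abs_ln_le:
  fixes t k :: real
  assumes "1 \<le> k" "1 / k \<le> t" "t \<le> k"
  shows "\<bar>ln t\<bar> \<le> ln k"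
proof -
  have "0 < 1 / k"
    using assms by simp
  then have "0 < t"
    using assms by linarith
  have "ln (1 / k) \<le> ln t"
    using ln_le_cancel_iff[OF \<open>0 < 1 / k\<close> \<open>0 < t\<close>] assms(2) by (rule iffD2)
  moreover have "ln t \<le> ln k"
    using ln_le_cancel_iff[OF \<open>0 < t\<close>, of k] assms \<open>0 < t\<close> by linarith
  moreover have "ln (1 / k) = - ln k"
    using assms by (simp add: ln_div)
  ultimately show ?thesis
    by linarith
qed

context nontrivial_circle
begin

text \<open>Upper semicontinuity of the entropy. For a continuous test function \<open>h > 0\<close>,
  \<open>log w\<^sub>n \<le> w\<^sub>n h - 1 - log h\<close>; the first term passes to the limit by weak convergence, and then \<open>h\<close>
  is replaced by the truncation of \<open>1/w\<close>.\<close>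

lemma log_weight_upper:
  assumes k: "k \<ge> 1" and F: "continuous_on (sphere 0 1) F"
    "\<And>z. z \<in> sphere 0 1 \<Longrightarrow> 0 \<le> F z \<and> F z \<le> B" and "e > 0"
  shows "\<forall>\<^sub>F n in sequentially. (\<integral>\<theta>. F (cis \<theta>) * ln (approx_weight n \<theta>) \<partial>angle_prob)
           \<le> (\<integral>\<theta>. F (cis \<theta>) * ln (trunc k (weight \<theta>)) \<partial>angle_prob) + 2 * B / k + e"
proof -
  obtain v :: "complex \<Rightarrow> real" where v: "v \<in> borel_measurable circle_borel"
    "\<And>z. z \<in> sphere 0 1 \<Longrightarrow> 1 / k \<le> v z \<and> v z \<le> k"
    "AE \<theta> in angle_prob. v (cis \<theta>) = 1 / trunc k (weight \<theta>)"
    "(LINT z|\<mu>. F z * v z) \<le> (\<integral>\<theta>. F (cis \<theta>) \<partial>angle_prob) + 2 * B / k"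
    using trunc_test_function[OF k F] by blast
  note [measurable] = v(1) circle_comp_measurable[OF F(1)] circle_continuous_measurable[OF refl F(1)]
  have k0: "0 < 1 / k"
    using k by simp
  have B: "0 \<le> B"
    using F(2)[of 1] by auto
  have F': "0 \<le> F (cis \<theta>)" "F (cis \<theta>) \<le> B" for \<theta>
    using F(2)[of "cis \<theta>"] by auto
  have Fi: "integrable angle_prob (\<lambda>\<theta>. F (cis \<theta>))"
    by (rule circle_comp_integrable[OF F(1)])
  define R where "R h = (LINT z|\<mu>. F z * h z) - (\<integral>\<theta>. F (cis \<theta>) * (1 + ln (h (cis \<theta>))) \<partial>angle_prob)"
    for h :: "complex \<Rightarrow> real"
  have "\<forall>\<^sub>F n in sequentially. (\<integral>\<theta>. F (cis \<theta>) * ln (approx_weight n \<theta>) \<partial>angle_prob) \<le> R v + e"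
  proof (rule test_function_extension[where R = R and v = v and c = "1 / k" and C = k])
    show "1 / k \<le> k"
      using k by (auto intro: order_trans[of _ 1])
    fix h :: "complex \<Rightarrow> real" and e' :: real
    assume h: "continuous_on UNIV h" "\<And>z. 1 / k \<le> h z" "\<And>z. h z \<le> k" and "e' > 0"
    have hs: "continuous_on (sphere 0 1) h"
      using h(1) by (rule continuous_on_subset) auto
    have hpos: "h z > 0" for z
      using h(2)[of z] k0 by linarith
    have Fh: "continuous_on (sphere 0 1) (\<lambda>z. F z * h z)"
      by (intro continuous_intros F hs)
    have i2: "integrable angle_prob (\<lambda>\<theta>. F (cis \<theta>) * (1 + ln (h (cis \<theta>))))"
      by (rule circle_comp_integrable[of "\<lambda>z. F z * (1 + ln (h z))"])
         (use hpos in \<open>auto intro!: continuous_intros F hs simp: less_imp_neq[THEN not_sym]\<close>)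
    have "(\<lambda>n. \<integral>\<theta>. approx_weight n \<theta> * (F (cis \<theta>) * h (cis \<theta>)) \<partial>angle_prob) \<longlonglongrightarrow> (LINT z|\<mu>. F z * h z)"
      by (rule bernstein_szego_weak_convergence[OF Fh])
    then have "\<forall>\<^sub>F n in sequentially. (\<integral>\<theta>. approx_weight n \<theta> * (F (cis \<theta>) * h (cis \<theta>)) \<partial>angle_prob)
        < (LINT z|\<mu>. F z * h z) + e'"
      using \<open>e' > 0\<close> by (intro order_tendstoD(2)) auto
    then show "\<forall>\<^sub>F n in sequentially. (\<integral>\<theta>. F (cis \<theta>) * ln (approx_weight n \<theta>) \<partial>angle_prob) \<le> R h + e'"
    proof eventually_elim
      case (elim n)
      have i1: "integrable angle_prob (\<lambda>\<theta>. approx_weight n \<theta> * (F (cis \<theta>) * h (cis \<theta>)))"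
        by (rule approx_weight_comp_integrable[OF Fh])
      have "(\<integral>\<theta>. F (cis \<theta>) * ln (approx_weight n \<theta>) \<partial>angle_prob) \<le>
          (\<integral>\<theta>. approx_weight n \<theta> * (F (cis \<theta>) * h (cis \<theta>)) - F (cis \<theta>) * (1 + ln (h (cis \<theta>))) \<partial>angle_prob)"
      proof (rule integral_mono)
        fix \<theta> assume "\<theta> \<in> space angle_prob"
        have "ln (approx_weight n \<theta> * h (cis \<theta>)) \<le> approx_weight n \<theta> * h (cis \<theta>) - 1"
          using approx_weight_pos[of n \<theta>] hpos by (intro ln_le_minus_one mult_pos_pos)
        then have "ln (approx_weight n \<theta>) \<le> approx_weight n \<theta> * h (cis \<theta>) - (1 + ln (h (cis \<theta>)))"
          using approx_weight_pos[of n \<theta>] hpos[of "cis \<theta>"] by (simp add: ln_mult)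
        then have "F (cis \<theta>) * ln (approx_weight n \<theta>) \<le>
            F (cis \<theta>) * (approx_weight n \<theta> * h (cis \<theta>) - (1 + ln (h (cis \<theta>))))"
          using F'(1) by (intro mult_left_mono)
        then show "F (cis \<theta>) * ln (approx_weight n \<theta>) \<le>
            approx_weight n \<theta> * (F (cis \<theta>) * h (cis \<theta>)) - F (cis \<theta>) * (1 + ln (h (cis \<theta>)))"
          by (simp add: algebra_simps)
      qed (intro approx_weight_comp_integrable F Bochner_Integration.integrable_diff i1 i2)+
      also have "\<dots> = (\<integral>\<theta>. approx_weight n \<theta> * (F (cis \<theta>) * h (cis \<theta>)) \<partial>angle_prob)
          - (\<integral>\<theta>. F (cis \<theta>) * (1 + ln (h (cis \<theta>))) \<partial>angle_prob)"
        by (rule Bochner_Integration.integral_diff[OF i1 i2])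
      finally show ?case
        using elim unfolding R_def by linarith
    qed
  next
    fix h :: "nat \<Rightarrow> complex \<Rightarrow> real"
    assume h: "\<And>j. continuous_on UNIV (h j)" "\<And>j z. 1 / k \<le> h j z" "\<And>j z. h j z \<le> k"
      and ae: "AE z in \<mu>. (\<lambda>j. h j z) \<longlonglongrightarrow> v z"
        "AE \<theta> in angle_prob. (\<lambda>j. h j (cis \<theta>)) \<longlonglongrightarrow> v (cis \<theta>)"
    have hs: "continuous_on (sphere 0 1) (h j)" for j
      using h(1) by (rule continuous_on_subset) auto
    note [measurable] = circle_continuous_measurable[OF refl hs] circle_comp_measurable[OF hs]
    have hpos: "h j z > 0" for j z
      using h(2)[of j z] k0 by linarith
    show "(\<lambda>j. R (h j)) \<longlonglongrightarrow> R v"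
      unfolding R_def
    proof (intro tendsto_diff)
      show "(\<lambda>j. LINT z|\<mu>. F z * h j z) \<longlonglongrightarrow> (LINT z|\<mu>. F z * v z)"
      proof (rule integral_dominated_convergence[where w = "\<lambda>_. B * k"])
        show "AE z in \<mu>. (\<lambda>j. F z * h j z) \<longlonglongrightarrow> F z * v z"
          using ae(1) by eventually_elim (intro tendsto_intros)
        show "AE z in \<mu>. norm (F z * h j z) \<le> B * k" for j
        proof (rule AE_I2)
          fix z assume "z \<in> space \<mu>"
          then show "norm (F z * h j z) \<le> B * k"
            using F(2)[of z] h(3)[of j z] hpos[of j z] by (auto simp: abs_mult intro!: mult_mono)
        qed
      qed auto
      show "(\<lambda>j. \<integral>\<theta>. F (cis \<theta>) * (1 + ln (h j (cis \<theta>))) \<partial>angle_prob) \<longlonglongrightarrow>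
          (\<integral>\<theta>. F (cis \<theta>) * (1 + ln (v (cis \<theta>))) \<partial>angle_prob)"
      proof (rule integral_dominated_convergence[where w = "\<lambda>_. B * (1 + ln k)"])
        show "AE \<theta> in angle_prob. (\<lambda>j. F (cis \<theta>) * (1 + ln (h j (cis \<theta>)))) \<longlonglongrightarrow> F (cis \<theta>) * (1 + ln (v (cis \<theta>)))"
          using ae(2)
        proof eventually_elim
          case (elim \<theta>)
          have "v (cis \<theta>) \<noteq> 0"
            using v(2)[of "cis \<theta>"] k0 by auto
          with elim show ?case
            by (intro tendsto_intros)
        qed
        show "AE \<theta> in angle_prob. norm (F (cis \<theta>) * (1 + ln (h j (cis \<theta>)))) \<le> B * (1 + ln k)" for j
        proof (rule AE_I2)
          fix \<theta>
          have "\<bar>1 + ln (h j (cis \<theta>))\<bar> \<le> 1 + ln k"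
            using abs_ln_le[OF k h(2,3)[of j "cis \<theta>"]] by linarith
          then show "norm (F (cis \<theta>) * (1 + ln (h j (cis \<theta>)))) \<le> B * (1 + ln k)"
            using F'[of \<theta>] by (auto simp: abs_mult intro!: mult_mono)
        qed
      qed auto
    qed
  qed (use v \<open>e > 0\<close> in auto)
  moreover have "R v \<le> (\<integral>\<theta>. F (cis \<theta>) * ln (trunc k (weight \<theta>)) \<partial>angle_prob) + 2 * B / k"
  proof -
    have i: "integrable angle_prob (\<lambda>\<theta>. F (cis \<theta>) * ln (trunc k (weight \<theta>)))"
    proof (rule angle_prob.integrable_const_bound[of _ "B * ln k"])
      show "AE \<theta> in angle_prob. norm (F (cis \<theta>) * ln (trunc k (weight \<theta>))) \<le> B * ln k"
        using F' B trunc_bounds[OF k]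
        by (intro AE_I2) (auto simp: abs_mult intro!: mult_mono abs_ln_le k)
    qed (simp add: trunc_def)
    have "(\<integral>\<theta>. F (cis \<theta>) * (1 + ln (v (cis \<theta>))) \<partial>angle_prob) =
        (\<integral>\<theta>. F (cis \<theta>) - F (cis \<theta>) * ln (trunc k (weight \<theta>)) \<partial>angle_prob)"
    proof (rule integral_cong_AE)
      show "AE \<theta> in angle_prob. F (cis \<theta>) * (1 + ln (v (cis \<theta>))) =
          F (cis \<theta>) - F (cis \<theta>) * ln (trunc k (weight \<theta>))"
        using v(3)
      proof eventually_elim
        case (elim \<theta>)
        then have "ln (v (cis \<theta>)) = - ln (trunc k (weight \<theta>))"
          using trunc_pos[OF k, of "weight \<theta>"] by (simp add: ln_div)
        then show ?case
          by (simp add: algebra_simps)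
      qed
    qed (auto simp: trunc_def)
    also have "\<dots> = (\<integral>\<theta>. F (cis \<theta>) \<partial>angle_prob) - (\<integral>\<theta>. F (cis \<theta>) * ln (trunc k (weight \<theta>)) \<partial>angle_prob)"
      by (rule Bochner_Integration.integral_diff[OF Fi i])
    finally show ?thesis
      using v(4) unfolding R_def by linarith
  qed
  ultimately show ?thesis
    by (elim eventually_mono) linarith
qed

lemma sqrt_le_add:
  fixes a b :: real
  assumes "0 \<le> a" "0 \<le> b"
  shows "2 * sqrt (a * b) \<le> a + b"
proof -
  have "0 \<le> (sqrt a - sqrt b)\<^sup>2"
    by simp
  also have "\<dots> = a + b - 2 * sqrt (a * b)"
    using assms by (simp add: power2_diff real_sqrt_mult)
  finally show ?thesis by simp
qed

text \<open>With \<open>r = w/w\<^sub>n\<close> the inequality of arithmetic and geometric means gives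
  \<open>1 - r \<le> 1 + w\<^sub>n h - 2 sqrt (h w)\<close>. The term with \<open>w\<^sub>n\<close> passes to the limit, and for \<open>h = 1/w\<close> the
  right-hand side would be \<open>0\<close> in the limit.\<close>

lemma ratio_defect_trunc:
  assumes k: "k \<ge> 1" and G: "continuous_on (sphere 0 1) G"
    "\<And>z. z \<in> sphere 0 1 \<Longrightarrow> 0 \<le> G z \<and> G z \<le> B" and "e > 0"
  shows "\<forall>\<^sub>F n in sequentially. (\<integral>\<theta>. G (cis \<theta>) * (1 - weight \<theta> / approx_weight n \<theta>) \<partial>angle_prob)
           \<le> 2 * (\<integral>\<theta>. G (cis \<theta>) \<partial>angle_prob) + 2 * B / k
             - 2 * (\<integral>\<theta>. G (cis \<theta>) * sqrt (weight \<theta> / trunc k (weight \<theta>)) \<partial>angle_prob) + e"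
proof -
  obtain v :: "complex \<Rightarrow> real" where v: "v \<in> borel_measurable circle_borel"
    "\<And>z. z \<in> sphere 0 1 \<Longrightarrow> 1 / k \<le> v z \<and> v z \<le> k"
    "AE \<theta> in angle_prob. v (cis \<theta>) = 1 / trunc k (weight \<theta>)"
    "(LINT z|\<mu>. G z * v z) \<le> (\<integral>\<theta>. G (cis \<theta>) \<partial>angle_prob) + 2 * B / k"
    using trunc_test_function[OF k G] by blast
  note [measurable] = v(1) circle_comp_measurable[OF G(1)] circle_continuous_measurable[OF refl G(1)]
  have k0: "0 < 1 / k"
    using k by simp
  have B: "0 \<le> B"
    using G(2)[of 1] by auto
  have G': "0 \<le> G (cis \<theta>)" "G (cis \<theta>) \<le> B" for \<theta>
    using G(2)[of "cis \<theta>"] by auto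
  have Gi: "integrable angle_prob (\<lambda>\<theta>. G (cis \<theta>))"
    by (rule circle_comp_integrable[OF G(1)])
  have bound: "norm (G (cis \<theta>) * sqrt (t * weight \<theta>)) \<le> B * (k + weight \<theta>)"
    if "0 \<le> t" "t \<le> k" for t \<theta>
  proof -
    have "2 * sqrt (t * weight \<theta>) \<le> t + weight \<theta>"
      using that by (intro sqrt_le_add) auto
    then have "sqrt (t * weight \<theta>) \<le> k + weight \<theta>"
      using that weight_nonneg[of \<theta>] by linarith
    then show ?thesis
      using G'[of \<theta>] that by (auto simp: abs_mult intro!: mult_mono)
  qed
  have dom: "integrable angle_prob (\<lambda>\<theta>. B * (k + weight \<theta>))"
    using weight_integrable by simp
  define R where "R h = (\<integral>\<theta>. G (cis \<theta>) \<partial>angle_prob) + (LINT z|\<mu>. G z * h z)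
      - 2 * (\<integral>\<theta>. G (cis \<theta>) * sqrt (h (cis \<theta>) * weight \<theta>) \<partial>angle_prob)" for h :: "complex \<Rightarrow> real"
  have "\<forall>\<^sub>F n in sequentially. (\<integral>\<theta>. G (cis \<theta>) * (1 - weight \<theta> / approx_weight n \<theta>) \<partial>angle_prob) \<le> R v + e"
  proof (rule test_function_extension[where R = R and v = v and c = "1 / k" and C = k])
    show "1 / k \<le> k"
      using k by (auto intro: order_trans[of _ 1])
    fix h :: "complex \<Rightarrow> real" and e' :: real
    assume h: "continuous_on UNIV h" "\<And>z. 1 / k \<le> h z" "\<And>z. h z \<le> k" and "e' > 0"
    have hs: "continuous_on (sphere 0 1) h"
      using h(1) by (rule continuous_on_subset) auto
    note [measurable] = circle_comp_measurable[OF hs]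
    have hpos: "h z > 0" for z
      using h(2)[of z] k0 by linarith
    have Gh: "continuous_on (sphere 0 1) (\<lambda>z. G z * h z)"
      by (intro continuous_intros G hs)
    have i2: "integrable angle_prob (\<lambda>\<theta>. G (cis \<theta>) * sqrt (h (cis \<theta>) * weight \<theta>))"
      by (rule Bochner_Integration.integrable_bound[OF dom])
         (use bound[OF less_imp_le[OF hpos] h(3)] in \<open>auto intro!: AE_I2 order_trans[OF _ abs_ge_self]\<close>)
    have "(\<lambda>n. \<integral>\<theta>. approx_weight n \<theta> * (G (cis \<theta>) * h (cis \<theta>)) \<partial>angle_prob) \<longlonglongrightarrow> (LINT z|\<mu>. G z * h z)"
      by (rule bernstein_szego_weak_convergence[OF Gh])
    then have "\<forall>\<^sub>F n in sequentially. (\<integral>\<theta>. approx_weight n \<theta> * (G (cis \<theta>) * h (cis \<theta>)) \<partial>angle_prob)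
        < (LINT z|\<mu>. G z * h z) + e'"
      using \<open>e' > 0\<close> by (intro order_tendstoD(2)) auto
    then show "\<forall>\<^sub>F n in sequentially.
        (\<integral>\<theta>. G (cis \<theta>) * (1 - weight \<theta> / approx_weight n \<theta>) \<partial>angle_prob) \<le> R h + e'"
    proof eventually_elim
      case (elim n)
      have i1: "integrable angle_prob (\<lambda>\<theta>. approx_weight n \<theta> * (G (cis \<theta>) * h (cis \<theta>)))"
        by (rule approx_weight_comp_integrable[OF Gh])
      have i3: "integrable angle_prob (\<lambda>\<theta>. G (cis \<theta>) * (weight \<theta> / approx_weight n \<theta>))"
        by (rule ratio_integrable[OF G(1)])
      have "(\<integral>\<theta>. G (cis \<theta>) * (1 - weight \<theta> / approx_weight n \<theta>) \<partial>angle_prob) \<le>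
          (\<integral>\<theta>. (G (cis \<theta>) + approx_weight n \<theta> * (G (cis \<theta>) * h (cis \<theta>)))
              - 2 * (G (cis \<theta>) * sqrt (h (cis \<theta>) * weight \<theta>)) \<partial>angle_prob)"
      proof (rule integral_mono)
        show "integrable angle_prob (\<lambda>\<theta>. G (cis \<theta>) * (1 - weight \<theta> / approx_weight n \<theta>))"
          using Bochner_Integration.integrable_diff[OF Gi i3] by (simp add: algebra_simps)
        show "integrable angle_prob (\<lambda>\<theta>. (G (cis \<theta>) + approx_weight n \<theta> * (G (cis \<theta>) * h (cis \<theta>)))
              - 2 * (G (cis \<theta>) * sqrt (h (cis \<theta>) * weight \<theta>)))"
          by (intro Bochner_Integration.integrable_diff Bochner_Integration.integrable_add
                integrable_mult_right Gi i1 i2)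
        fix \<theta> assume "\<theta> \<in> space angle_prob"
        have "2 * sqrt (weight \<theta> / approx_weight n \<theta> * (approx_weight n \<theta> * h (cis \<theta>))) \<le>
            weight \<theta> / approx_weight n \<theta> + approx_weight n \<theta> * h (cis \<theta>)"
          using approx_weight_pos[of n \<theta>] hpos[of "cis \<theta>"] by (intro sqrt_le_add) auto
        then have "1 - weight \<theta> / approx_weight n \<theta> \<le>
            1 + approx_weight n \<theta> * h (cis \<theta>) - 2 * sqrt (h (cis \<theta>) * weight \<theta>)"
          using approx_weight_pos[of n \<theta>] by (simp add: mult.commute)
        then have "G (cis \<theta>) * (1 - weight \<theta> / approx_weight n \<theta>) \<le>
            G (cis \<theta>) * (1 + approx_weight n \<theta> * h (cis \<theta>) - 2 * sqrt (h (cis \<theta>) * weight \<theta>))"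
          using G'(1) by (intro mult_left_mono)
        then show "G (cis \<theta>) * (1 - weight \<theta> / approx_weight n \<theta>) \<le>
            (G (cis \<theta>) + approx_weight n \<theta> * (G (cis \<theta>) * h (cis \<theta>)))
              - 2 * (G (cis \<theta>) * sqrt (h (cis \<theta>) * weight \<theta>))"
          by (simp add: algebra_simps)
      qed
      also have "\<dots> = (\<integral>\<theta>. G (cis \<theta>) \<partial>angle_prob) + (\<integral>\<theta>. approx_weight n \<theta> * (G (cis \<theta>) * h (cis \<theta>)) \<partial>angle_prob)
          - 2 * (\<integral>\<theta>. G (cis \<theta>) * sqrt (h (cis \<theta>) * weight \<theta>) \<partial>angle_prob)"
        using Gi i1 i2 by simp
      finally show ?case
        using elim unfolding R_def by linarith
    qed
  next
    fix h :: "nat \<Rightarrow> complex \<Rightarrow> real"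
    assume h: "\<And>j. continuous_on UNIV (h j)" "\<And>j z. 1 / k \<le> h j z" "\<And>j z. h j z \<le> k"
      and ae: "AE z in \<mu>. (\<lambda>j. h j z) \<longlonglongrightarrow> v z"
        "AE \<theta> in angle_prob. (\<lambda>j. h j (cis \<theta>)) \<longlonglongrightarrow> v (cis \<theta>)"
    have hs: "continuous_on (sphere 0 1) (h j)" for j
      using h(1) by (rule continuous_on_subset) auto
    note [measurable] = circle_continuous_measurable[OF refl hs] circle_comp_measurable[OF hs]
    have hpos: "h j z > 0" for j z
      using h(2)[of j z] k0 by linarith
    show "(\<lambda>j. R (h j)) \<longlonglongrightarrow> R v"
      unfolding R_def
    proof (intro tendsto_diff tendsto_add tendsto_const tendsto_mult)
      show "(\<lambda>j. LINT z|\<mu>. G z * h j z) \<longlonglongrightarrow> (LINT z|\<mu>. G z * v z)"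
      proof (rule integral_dominated_convergence[where w = "\<lambda>_. B * k"])
        show "AE z in \<mu>. (\<lambda>j. G z * h j z) \<longlonglongrightarrow> G z * v z"
          using ae(1) by eventually_elim (intro tendsto_intros)
        show "AE z in \<mu>. norm (G z * h j z) \<le> B * k" for j
        proof (rule AE_I2)
          fix z assume "z \<in> space \<mu>"
          then show "norm (G z * h j z) \<le> B * k"
            using G(2)[of z] h(3)[of j z] hpos[of j z] by (auto simp: abs_mult intro!: mult_mono)
        qed
      qed auto
      show "(\<lambda>j. \<integral>\<theta>. G (cis \<theta>) * sqrt (h j (cis \<theta>) * weight \<theta>) \<partial>angle_prob) \<longlonglongrightarrow>
          (\<integral>\<theta>. G (cis \<theta>) * sqrt (v (cis \<theta>) * weight \<theta>) \<partial>angle_prob)"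
      proof (rule integral_dominated_convergence[OF _ _ dom])
        show "AE \<theta> in angle_prob. (\<lambda>j. G (cis \<theta>) * sqrt (h j (cis \<theta>) * weight \<theta>)) \<longlonglongrightarrow>
            G (cis \<theta>) * sqrt (v (cis \<theta>) * weight \<theta>)"
          using ae(2) by eventually_elim (intro tendsto_intros)
        show "AE \<theta> in angle_prob. norm (G (cis \<theta>) * sqrt (h j (cis \<theta>) * weight \<theta>)) \<le> B * (k + weight \<theta>)" for j
          using bound[OF less_imp_le[OF hpos] h(3)] by (intro AE_I2)
      qed auto
    qed
  qed (use v \<open>e > 0\<close> in auto)
  moreover have "(\<integral>\<theta>. G (cis \<theta>) * sqrt (v (cis \<theta>) * weight \<theta>) \<partial>angle_prob) =
      (\<integral>\<theta>. G (cis \<theta>) * sqrt (weight \<theta> / trunc k (weight \<theta>)) \<partial>angle_prob)"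
  proof (rule integral_cong_AE)
    show "AE \<theta> in angle_prob. G (cis \<theta>) * sqrt (v (cis \<theta>) * weight \<theta>) =
        G (cis \<theta>) * sqrt (weight \<theta> / trunc k (weight \<theta>))"
      using v(3) by eventually_elim simp
  qed (auto simp: trunc_def)
  then have "R v \<le> 2 * (\<integral>\<theta>. G (cis \<theta>) \<partial>angle_prob) + 2 * B / k
             - 2 * (\<integral>\<theta>. G (cis \<theta>) * sqrt (weight \<theta> / trunc k (weight \<theta>)) \<partial>angle_prob)"
    using v(4) unfolding R_def by simp
  ultimately show ?thesis
    by (elim eventually_mono) linarith
qed

text \<open>Where \<open>w > 0\<close>, the truncation of \<open>w\<close> becomes exact for large \<open>k\<close>, and the bound tends to \<open>0\<close>.\<close>

lemma ratio_defect:
  assumes G: "continuous_on (sphere 0 1) G"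
    "\<And>z. z \<in> sphere 0 1 \<Longrightarrow> 0 \<le> G z \<and> G z \<le> B" and w: "AE \<theta> in angle_prob. 0 < weight \<theta>" and "e > 0"
  shows "\<forall>\<^sub>F n in sequentially. (\<integral>\<theta>. G (cis \<theta>) * (1 - weight \<theta> / approx_weight n \<theta>) \<partial>angle_prob) \<le> e"
proof -
  note [measurable] = circle_comp_measurable[OF G(1)]
  have G': "0 \<le> G (cis \<theta>)" "G (cis \<theta>) \<le> B" for \<theta>
    using G(2)[of "cis \<theta>"] by auto
  let ?k = "\<lambda>i. real (Suc i)"
  let ?I = "\<lambda>i. \<integral>\<theta>. G (cis \<theta>) * sqrt (weight \<theta> / trunc (?k i) (weight \<theta>)) \<partial>angle_prob"
  let ?J = "\<integral>\<theta>. G (cis \<theta>) \<partial>angle_prob"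
  have "?I \<longlonglongrightarrow> (\<integral>\<theta>. G (cis \<theta>) * sqrt 1 \<partial>angle_prob)"
  proof (rule integral_dominated_convergence[where w = "\<lambda>\<theta>. B * (1 + weight \<theta>)"])
    show "integrable angle_prob (\<lambda>\<theta>. B * (1 + weight \<theta>))"
      using weight_integrable by simp
    show "AE \<theta> in angle_prob. (\<lambda>i. G (cis \<theta>) * sqrt (weight \<theta> / trunc (?k i) (weight \<theta>))) \<longlonglongrightarrow> G (cis \<theta>) * sqrt 1"
      using w
    proof eventually_elim
      case (elim \<theta>)
      have "\<forall>\<^sub>F i in sequentially. weight \<theta> / trunc (?k i) (weight \<theta>) = 1"
        using eventually_ge_at_top[of "nat \<lceil>max (weight \<theta>) (1 / weight \<theta>)\<rceil>"]
      proof eventually_elim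
        case (elim i)
        then have "weight \<theta> \<le> ?k i" "1 / weight \<theta> \<le> ?k i"
          by linarith+
        then have "trunc (?k i) (weight \<theta>) = weight \<theta>"
          using \<open>0 < weight \<theta>\<close> by (simp add: trunc_def min_def max_def field_simps)
        then show ?case
          using \<open>0 < weight \<theta>\<close> by simp
      qed
      then have "(\<lambda>i. weight \<theta> / trunc (?k i) (weight \<theta>)) \<longlonglongrightarrow> 1"
        by (rule tendsto_eventually)
      then show ?case
        by (intro tendsto_intros)
    qed
    show "AE \<theta> in angle_prob. norm (G (cis \<theta>) * sqrt (weight \<theta> / trunc (?k i) (weight \<theta>))) \<le> B * (1 + weight \<theta>)" for i
    proof (rule AE_I2)
      fix \<theta>
      let ?r = "weight \<theta> / trunc (?k i) (weight \<theta>)"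
      have r0: "0 \<le> ?r"
        using trunc_pos[of "?k i" "weight \<theta>"] by simp
      have "?r \<le> 1 + weight \<theta> / ?k i"
        by (rule ratio_trunc_le) auto
      also have "weight \<theta> / ?k i \<le> weight \<theta> / 1"
        by (rule divide_left_mono) auto
      finally have "?r \<le> 1 + weight \<theta>"
        by simp
      then have "sqrt ?r \<le> sqrt ((1 + weight \<theta>)\<^sup>2)"
        by (intro real_sqrt_le_mono order_trans[OF _ self_le_power]) auto
      then have "sqrt ?r \<le> 1 + weight \<theta>"
        by simp
      then show "norm (G (cis \<theta>) * sqrt ?r) \<le> B * (1 + weight \<theta>)"
        using G'[of \<theta>] r0 by (auto simp: abs_mult intro!: mult_mono)
    qed
  qed (auto simp: trunc_def)
  moreover have "(\<lambda>i. 2 * B / ?k i) \<longlonglongrightarrow> 0"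
    using LIMSEQ_Suc[OF lim_const_over_n[of "2 * B"]] .
  ultimately have "(\<lambda>i. 2 * ?J + 2 * B / ?k i - 2 * ?I i) \<longlonglongrightarrow> 2 * ?J + 0 - 2 * ?J"
    by (intro tendsto_intros) simp_all
  then have "\<forall>\<^sub>F i in sequentially. 2 * ?J + 2 * B / ?k i - 2 * ?I i < e / 2"
    using \<open>e > 0\<close> by (intro order_tendstoD(2)) auto
  then obtain i where i: "2 * ?J + 2 * B / ?k i - 2 * ?I i < e / 2"
    by (auto simp: eventually_sequentially)
  have "\<forall>\<^sub>F n in sequentially. (\<integral>\<theta>. G (cis \<theta>) * (1 - weight \<theta> / approx_weight n \<theta>) \<partial>angle_prob)
      \<le> 2 * ?J + 2 * B / ?k i - 2 * ?I i + e / 2"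
    using \<open>e > 0\<close> by (intro ratio_defect_trunc G) auto
  then show ?thesis
    by eventually_elim (use i in linarith)
qed

text \<open>Here \<open>log (w/w\<^sub>n) \<le> w/w\<^sub>n - 1\<close>. Since \<open>w/w\<^sub>n\<close> has integral at most \<open>1\<close>, the integral of
  \<open>F (w/w\<^sub>n - 1)\<close> is at most that of \<open>(B - F) (1 - w/w\<^sub>n)\<close>, where \<open>B\<close> is an upper bound of \<open>F\<close>, and
  this is asymptotically nonpositive.\<close>

lemma log_weight_lower:
  assumes F: "continuous_on (sphere 0 1) F" "\<And>z. z \<in> sphere 0 1 \<Longrightarrow> 0 \<le> F z"
    and w: "AE \<theta> in angle_prob. 0 < weight \<theta>" and Fw: "integrable angle_prob (\<lambda>\<theta>. F (cis \<theta>) * ln (weight \<theta>))"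
    and "e > 0"
  shows "\<forall>\<^sub>F n in sequentially. (\<integral>\<theta>. F (cis \<theta>) * ln (weight \<theta>) \<partial>angle_prob) - e
           \<le> (\<integral>\<theta>. F (cis \<theta>) * ln (approx_weight n \<theta>) \<partial>angle_prob)"
proof -
  obtain B where "B > 0" and B: "\<And>z. z \<in> sphere 0 1 \<Longrightarrow> norm (F z) \<le> B"
    using circle_continuous_bounded[OF F(1)] by blast
  have FB: "F z \<le> B" if "z \<in> sphere 0 1" for z
    using B[OF that] by simp
  have G: "continuous_on (sphere 0 1) (\<lambda>z. B - F z)"
    by (intro continuous_intros F)
  have "\<forall>\<^sub>F n in sequentially. (\<integral>\<theta>. (B - F (cis \<theta>)) * (1 - weight \<theta> / approx_weight n \<theta>) \<partial>angle_prob) \<le> e"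
    using F(2) FB by (intro ratio_defect[OF G _ w \<open>e > 0\<close>, of B]) auto
  then show ?thesis
  proof eventually_elim
    case (elim n)
    have r: "integrable angle_prob (\<lambda>\<theta>. weight \<theta> / approx_weight n \<theta>)"
      using ratio_integrable[of "\<lambda>_. 1" n] by simp
    have Fr: "integrable angle_prob (\<lambda>\<theta>. F (cis \<theta>) * (weight \<theta> / approx_weight n \<theta>))"
      by (rule ratio_integrable[OF F(1)])
    have Fi: "integrable angle_prob (\<lambda>\<theta>. F (cis \<theta>))"
      by (rule circle_comp_integrable[OF F(1)])
    have Fn: "integrable angle_prob (\<lambda>\<theta>. F (cis \<theta>) * ln (approx_weight n \<theta>))"
      by (rule approx_weight_comp_integrable[OF F(1)])
    have "(\<integral>\<theta>. F (cis \<theta>) * ln (weight \<theta>) \<partial>angle_prob) - (\<integral>\<theta>. F (cis \<theta>) * ln (approx_weight n \<theta>) \<partial>angle_prob) =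
        (\<integral>\<theta>. F (cis \<theta>) * ln (weight \<theta>) - F (cis \<theta>) * ln (approx_weight n \<theta>) \<partial>angle_prob)"
      by (rule Bochner_Integration.integral_diff[OF Fw Fn, symmetric])
    also have "\<dots> \<le> (\<integral>\<theta>. F (cis \<theta>) * (weight \<theta> / approx_weight n \<theta>) - F (cis \<theta>) \<partial>angle_prob)"
    proof (rule integral_mono_AE)
      show "AE \<theta> in angle_prob. F (cis \<theta>) * ln (weight \<theta>) - F (cis \<theta>) * ln (approx_weight n \<theta>)
          \<le> F (cis \<theta>) * (weight \<theta> / approx_weight n \<theta>) - F (cis \<theta>)"
        using w
      proof eventually_elim
        case (elim \<theta>)
        have "ln (weight \<theta> / approx_weight n \<theta>) \<le> weight \<theta> / approx_weight n \<theta> - 1"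
          using elim approx_weight_pos[of n \<theta>] by (intro ln_le_minus_one divide_pos_pos)
        then have "ln (weight \<theta>) - ln (approx_weight n \<theta>) \<le> weight \<theta> / approx_weight n \<theta> - 1"
          using elim approx_weight_pos[of n \<theta>] by (simp add: ln_div)
        then have "F (cis \<theta>) * (ln (weight \<theta>) - ln (approx_weight n \<theta>)) \<le>
            F (cis \<theta>) * (weight \<theta> / approx_weight n \<theta> - 1)"
          using F(2)[of "cis \<theta>"] by (intro mult_left_mono) auto
        then show ?case
          by (simp add: algebra_simps)
      qed
    qed (intro Bochner_Integration.integrable_diff Fw Fn Fr Fi)+
    also have "\<dots> = (\<integral>\<theta>. F (cis \<theta>) * (weight \<theta> / approx_weight n \<theta>) \<partial>angle_prob) - (\<integral>\<theta>. F (cis \<theta>) \<partial>angle_prob)"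
      by (rule Bochner_Integration.integral_diff[OF Fr Fi])
    also have "\<dots> \<le> (\<integral>\<theta>. (B - F (cis \<theta>)) * (1 - weight \<theta> / approx_weight n \<theta>) \<partial>angle_prob)"
    proof -
      have "(\<integral>\<theta>. (B - F (cis \<theta>)) * (1 - weight \<theta> / approx_weight n \<theta>) \<partial>angle_prob) =
          (\<integral>\<theta>. (B - B * (weight \<theta> / approx_weight n \<theta>))
            + (F (cis \<theta>) * (weight \<theta> / approx_weight n \<theta>) - F (cis \<theta>)) \<partial>angle_prob)"
        by (rule Bochner_Integration.integral_cong[OF refl])
           (simp add: algebra_simps del: times_divide_eq_right times_divide_eq_left)
      also have "\<dots> = (B - B * (\<integral>\<theta>. weight \<theta> / approx_weight n \<theta> \<partial>angle_prob)) +
          ((\<integral>\<theta>. F (cis \<theta>) * (weight \<theta> / approx_weight n \<theta>) \<partial>angle_prob) - (\<integral>\<theta>. F (cis \<theta>) \<partial>angle_prob))"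
        using r Fr Fi angle_prob.prob_space
        by (simp del: times_divide_eq_right)
      moreover have "B * (\<integral>\<theta>. weight \<theta> / approx_weight n \<theta> \<partial>angle_prob) \<le> B * 1"
        using \<open>B > 0\<close> ratio_integral_le_1 by (intro mult_left_mono) auto
      ultimately show ?thesis
        by simp
    qed
    also have "\<dots> \<le> e"
      by (rule elim)
    finally show ?case
      by simp
  qed
qed

end

section \<open>Convergence of the functional\<close>

lemma ln_ext_measurable [measurable]: "ln_ext \<in> borel_measurable borel"
  unfolding ln_ext_def[abs_def] by measurable

lemma Z_functional_eq:
  assumes f: "(\<lambda>\<theta>. (norm (f (cis \<theta>)))\<^sup>2) \<in> borel_measurable angle_prob"
    and w: "ac_weight \<kappa> \<in> borel_measurable angle_prob"
  shows "Z_functional f \<kappa> =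
    enn2ereal (ennreal (1 / 2) *
      (\<integral>\<^sup>+\<theta>. e2ennreal (ereal ((norm (f (cis \<theta>)))\<^sup>2) * ln_ext (ac_weight \<kappa> \<theta>)) \<partial>angle_prob)) -
    enn2ereal (ennreal (1 / 2) *
      (\<integral>\<^sup>+\<theta>. e2ennreal (- (ereal ((norm (f (cis \<theta>)))\<^sup>2) * ln_ext (ac_weight \<kappa> \<theta>))) \<partial>angle_prob))"
proof -
  note [measurable] = f w
  show ?thesis
    unfolding Z_functional_def ereal_integral_def angle_measure_4pi
    by (simp add: nn_integral_scale_measure)
qed

text \<open>When \<open>log w\<close> is integrable against \<open>|f|\<^sup>2\<close>, the extended integral is an ordinary one.\<close>

lemma Z_functional_integrable:
  assumes f: "(\<lambda>\<theta>. (norm (f (cis \<theta>)))\<^sup>2) \<in> borel_measurable angle_prob"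
    and w: "ac_weight \<kappa> \<in> borel_measurable angle_prob"
    and u: "AE \<theta> in angle_prob. ac_weight \<kappa> \<theta> = u \<theta> \<and> 0 < u \<theta>"
    and i: "integrable angle_prob (\<lambda>\<theta>. (norm (f (cis \<theta>)))\<^sup>2 * ln (u \<theta>))"
  shows "Z_functional f \<kappa> = ereal ((\<integral>\<theta>. (norm (f (cis \<theta>)))\<^sup>2 * ln (u \<theta>) \<partial>angle_prob) / 2)"
proof -
  let ?g = "\<lambda>\<theta>. (norm (f (cis \<theta>)))\<^sup>2 * ln (u \<theta>)"
  let ?P = "\<integral>\<^sup>+\<theta>. ennreal (?g \<theta>) \<partial>angle_prob" and ?N = "\<integral>\<^sup>+\<theta>. ennreal (- ?g \<theta>) \<partial>angle_prob"
  have P: "(\<integral>\<^sup>+\<theta>. e2ennreal (ereal ((norm (f (cis \<theta>)))\<^sup>2) * ln_ext (ac_weight \<kappa> \<theta>)) \<partial>angle_prob) = ?P"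
    by (rule nn_integral_cong_AE) (use u in \<open>eventually_elim; simp add: ln_ext_def\<close>)
  have N: "(\<integral>\<^sup>+\<theta>. e2ennreal (- (ereal ((norm (f (cis \<theta>)))\<^sup>2) * ln_ext (ac_weight \<kappa> \<theta>))) \<partial>angle_prob) = ?N"
    by (rule nn_integral_cong_AE) (use u in \<open>eventually_elim; simp add: ln_ext_def\<close>)
  have "?P \<noteq> \<infinity>" "?N \<noteq> \<infinity>"
    using i by (simp_all add: real_integrable_def)
  then obtain p q where pq: "?P = ennreal p" "?N = ennreal q" "0 \<le> p" "0 \<le> q"
    by (cases ?P; cases ?N) auto
  then have "(\<integral>\<theta>. ?g \<theta> \<partial>angle_prob) = p - q"
    by (simp add: real_lebesgue_integral_def[OF i])
  moreover have "Z_functional f \<kappa> = ereal (p / 2) - ereal (q / 2)"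
    unfolding Z_functional_eq[OF f w] P N pq(1,2)
    using pq(3,4) by (simp add: ennreal_mult[symmetric] del: ennreal_half)
  ultimately show ?thesis
    by (simp add: diff_divide_distrib)
qed

lemma AE_poly_circle_neq_0:
  assumes "Q \<noteq> 0"
  shows "AE \<theta> in angle_prob. poly Q (cis \<theta>) \<noteq> 0"
proof -
  let ?A = "{\<theta> \<in> space angle_prob. \<not> poly Q (cis \<theta>) \<noteq> 0}"
  have "?A \<subseteq> Arg2pi ` {z. poly Q z = 0}"
    by (force simp: Arg2pi_cis image_iff)
  then have fin: "finite ?A"
    using poly_roots_finite[OF assms] by (meson finite_imageI finite_subset)
  then have "?A \<in> sets borel"
    by (intro borel_closed finite_imp_closed)
  moreover have "?A \<subseteq> {0..<2 * pi}"
    by auto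
  ultimately have s: "?A \<in> sets angle_prob"
    unfolding sets_angle_measure sets_restrict_space by (intro image_eqI[of _ _ ?A]) auto
  have "emeasure angle_prob ?A = 0"
    unfolding emeasure_angle_prob[OF s] using finite_imp_null_set_lborel[OF fin] by (simp add: null_sets_def)
  then show ?thesis
    using s by (intro AE_I'[of ?A]) (auto simp: null_sets_def)
qed

text \<open>Truncation of the negative part of \<open>log t\<close>, with its increasing limit in the extended
  reals.\<close>

lemma neg_log_truncation_limit:
  assumes "0 \<le> t" "0 \<le> F"
  shows "(\<lambda>i. ennreal (F * - ln (max (1 / real (Suc i)) (min 1 t)))) \<longlonglongrightarrow> e2ennreal (- (ereal F * ln_ext t))"
proof (cases "t = 0")
  case True
  have eq: "F * - ln (max (1 / real (Suc i)) (min 1 t)) = F * ln (real (Suc i))" for i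
    using True by (simp add: ln_div max_def)
  show ?thesis
  proof (cases "F = 0")
    case False
    have "filterlim (\<lambda>i. F * ln (real (Suc i))) at_top sequentially"
      using False \<open>0 \<le> F\<close>
      by (intro filterlim_tendsto_pos_mult_at_top[OF tendsto_const] filterlim_compose[OF ln_at_top]
            filterlim_compose[OF filterlim_real_sequentially] filterlim_Suc) auto
    then have "(\<lambda>i. ereal (F * ln (real (Suc i)))) \<longlonglongrightarrow> \<infinity>"
      by (simp only: tendsto_PInfty_eq_at_top)
    then have "(\<lambda>i. e2ennreal (ereal (F * ln (real (Suc i))))) \<longlonglongrightarrow> e2ennreal \<infinity>"
      by (rule tendsto_e2ennrealI)
    moreover have "- (ereal F * ln_ext t) = \<infinity>"
      using True False \<open>0 \<le> F\<close> by (simp add: ln_ext_def)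
    ultimately show ?thesis
      unfolding eq by simp
  qed (simp add: eq e2ennreal_neg flip: zero_ereal_def)
next
  case False
  then have t: "0 < t"
    using assms by simp
  have "\<forall>\<^sub>F i in sequentially.
      ennreal (F * - ln (max (1 / real (Suc i)) (min 1 t))) = e2ennreal (- (ereal F * ln_ext t))"
    using eventually_ge_at_top[of "nat \<lceil>1 / t\<rceil>"]
  proof eventually_elim
    case (elim i)
    then have "1 / t \<le> real (Suc i)"
      by linarith
    then have "1 / real (Suc i) \<le> t" "1 / real (Suc i) \<le> 1"
      using t by (simp_all add: field_simps)
    then have "max (1 / real (Suc i)) (min 1 t) = min 1 t"
      by (simp add: max_absorb2)
    moreover have "ennreal (F * - ln (min 1 t)) = ennreal (- (F * ln t))"
      using t \<open>0 \<le> F\<close> by (auto simp: min_def ennreal_neg)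
    ultimately show ?case
      using False by (simp add: ln_ext_def)
  qed
  then show ?thesis
    by (rule tendsto_eventually)
qed

context nontrivial_circle
begin

lemma Z_functional_bernstein_szego:
  assumes f: "continuous_on (sphere 0 1) (\<lambda>z. (norm (f z))\<^sup>2)"
  shows "Z_functional f (bernstein_szego \<mu> n) =
    ereal ((\<integral>\<theta>. (norm (f (cis \<theta>)))\<^sup>2 * ln (approx_weight n \<theta>) \<partial>angle_prob) / 2)"
proof (rule Z_functional_integrable)
  obtain p where p: "continuous_on (sphere 0 1) p" "\<And>\<theta>. approx_weight n \<theta> = p (cis \<theta>)"
    using approx_weight_circle by blast
  have m: "approx_weight n \<in> borel_measurable angle_prob"
    using circle_comp_measurable[OF p(1)] by (simp add: p(2)[abs_def])
  have fm: "finite_measure (bernstein_szego \<mu> n)" "sets (bernstein_szego \<mu> n) = sets circle_borel"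
    using bs_measure_verblunsky(1)[of "Suc n"]
    by (simp_all add: bernstein_szego_eq nontrivial_circle_prob_def prob_space_def)
  have w: "is_ac_weight (bernstein_szego \<mu> n) (ac_weight (bernstein_szego \<mu> n))"
    by (rule is_ac_weight_ac_weight[OF fm])
  then show "ac_weight (bernstein_szego \<mu> n) \<in> borel_measurable angle_prob"
    by (simp add: is_ac_weight_iff)
  have "AE \<theta> in angle_prob. ac_weight (bernstein_szego \<mu> n) \<theta> = approx_weight n \<theta>"
    using w m approx_weight_pos unfolding bernstein_szego_eq
    by (intro ac_weight_angle_density) (auto intro: less_imp_le)
  then show "AE \<theta> in angle_prob. ac_weight (bernstein_szego \<mu> n) \<theta> = approx_weight n \<theta> \<and> 0 < approx_weight n \<theta>"
    by eventually_elim (simp add: approx_weight_pos)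
qed (use circle_comp_measurable[OF f] approx_weight_comp_integrable(2)[OF f] in simp_all)

text \<open>Only continuity of \<open>|f|\<^sup>2\<close> and \<open>f \<noteq> 0\<close> almost everywhere matter. If the limit is not \<open>-\<infinity>\<close>, the
  second condition forces \<open>w > 0\<close> almost everywhere, which the lower bound requires.\<close>

lemma Z_functional_tendsto:
  assumes f: "continuous_on (sphere 0 1) (\<lambda>z. (norm (f z))\<^sup>2)"
    and nz: "AE \<theta> in angle_prob. f (cis \<theta>) \<noteq> 0"
  shows "(\<lambda>n. Z_functional f (bernstein_szego \<mu> n)) \<longlonglongrightarrow> Z_functional f \<mu>"
proof -
  define F where "F z = (norm (f z))\<^sup>2" for z
  have F: "continuous_on (sphere 0 1) F" "\<And>z. 0 \<le> F z"
    using f by (simp_all add: F_def[abs_def])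
  obtain B where "B > 0" and B: "\<And>z. z \<in> sphere 0 1 \<Longrightarrow> norm (F z) \<le> B"
    using circle_continuous_bounded[OF F(1)] by blast
  have FB: "F z \<le> B" if "z \<in> sphere 0 1" for z
    using B[OF that] by simp
  note [measurable] = circle_comp_measurable[OF F(1)]
  let ?L = "\<lambda>n. \<integral>\<theta>. F (cis \<theta>) * ln (approx_weight n \<theta>) \<partial>angle_prob"
  have Zn: "Z_functional f (bernstein_szego \<mu> n) = ereal (?L n / 2)" for n
    using Z_functional_bernstein_szego[OF f] by (simp add: F_def)
  have wm: "ac_weight \<mu> \<in> borel_measurable angle_prob"
    using is_ac_weight_ac_weight_mu by (simp add: is_ac_weight_iff)
  have fm: "(\<lambda>\<theta>. (norm (f (cis \<theta>)))\<^sup>2) \<in> borel_measurable angle_prob"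
    by (rule circle_comp_measurable[OF f])

  \<comment> \<open>Twice the functional of \<open>\<mu>\<close> is \<open>p - NN\<close>, with \<open>p\<close> finite.\<close>
  have pos_int: "integrable angle_prob (\<lambda>\<theta>. F (cis \<theta>) * ln (max 1 (weight \<theta>)))"
  proof (rule Bochner_Integration.integrable_bound[of _ "\<lambda>\<theta>. B * weight \<theta>"])
    show "AE \<theta> in angle_prob. norm (F (cis \<theta>) * ln (max 1 (weight \<theta>))) \<le> norm (B * weight \<theta>)"
    proof (rule AE_I2)
      fix \<theta>
      have "ln (max 1 (weight \<theta>)) \<le> max 1 (weight \<theta>) - 1"
        by (intro ln_le_minus_one) auto
      then have "ln (max 1 (weight \<theta>)) \<le> weight \<theta>"
        using weight_nonneg[of \<theta>] by linarith
      then show "norm (F (cis \<theta>) * ln (max 1 (weight \<theta>))) \<le> norm (B * weight \<theta>)"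
        using F(2)[of "cis \<theta>"] FB[of "cis \<theta>"] \<open>B > 0\<close> by (auto simp: abs_mult intro!: mult_mono)
    qed
  qed (use weight_integrable in auto)
  define p where "p = (\<integral>\<theta>. F (cis \<theta>) * ln (max 1 (weight \<theta>)) \<partial>angle_prob)"
  have p0: "0 \<le> p"
    unfolding p_def using F(2) by (intro Bochner_Integration.integral_nonneg) simp
  have "(\<integral>\<^sup>+\<theta>. e2ennreal (ereal ((norm (f (cis \<theta>)))\<^sup>2) * ln_ext (ac_weight \<mu> \<theta>)) \<partial>angle_prob) =
      (\<integral>\<^sup>+\<theta>. ennreal (F (cis \<theta>) * ln (max 1 (weight \<theta>))) \<partial>angle_prob)"
  proof (rule nn_integral_cong)
    fix \<theta> assume "\<theta> \<in> space angle_prob"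
    then have "ac_weight \<mu> \<theta> = weight \<theta>"
      by (simp add: weight_eq)
    moreover have "e2ennreal (ereal (F z) * ln_ext t) = ennreal (F z * ln (max 1 t))" if "0 \<le> t" for t z
    proof (cases "t = 0")
      case True
      then show ?thesis
        using F(2)[of z] by (cases "F z = 0") (auto simp: ln_ext_def e2ennreal_neg)
    next
      case False
      then show ?thesis
        using that F(2)[of z] by (auto simp: ln_ext_def max_def ennreal_neg mult_nonneg_nonpos)
    qed
    ultimately show "e2ennreal (ereal ((norm (f (cis \<theta>)))\<^sup>2) * ln_ext (ac_weight \<mu> \<theta>)) =
        ennreal (F (cis \<theta>) * ln (max 1 (weight \<theta>)))"
      by (simp add: F_def)
  qed
  also have "\<dots> = ennreal p"
    unfolding p_def using pos_int F(2) by (intro nn_integral_eq_integral) auto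
  finally have P: "(\<integral>\<^sup>+\<theta>. e2ennreal (ereal ((norm (f (cis \<theta>)))\<^sup>2) * ln_ext (ac_weight \<mu> \<theta>)) \<partial>angle_prob) = ennreal p" .
  define NN where "NN = (\<integral>\<^sup>+\<theta>. e2ennreal (- (ereal (F (cis \<theta>)) * ln_ext (weight \<theta>))) \<partial>angle_prob)"
  have N: "(\<integral>\<^sup>+\<theta>. e2ennreal (- (ereal ((norm (f (cis \<theta>)))\<^sup>2) * ln_ext (ac_weight \<mu> \<theta>))) \<partial>angle_prob) = NN"
    unfolding NN_def by (rule nn_integral_cong) (simp add: weight_eq F_def)
  have Z: "Z_functional f \<mu> = ereal (p / 2) - enn2ereal (ennreal (1 / 2) * NN)"
    unfolding Z_functional_eq[OF fm wm] P N
    using p0 by (simp add: ennreal_mult[symmetric] del: ennreal_half)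

  \<comment> \<open>Truncating the negative part of the logarithm gives integrals \<open>m i\<close> that increase to \<open>NN\<close>.\<close>
  define lo where "lo i t = ln (max (1 / real (Suc i)) (min 1 t))" for i and t :: real
  have lo_bounds: "lo i t \<le> 0" "\<bar>lo i t\<bar> \<le> ln (real (Suc i))" for i t
  proof -
    show "lo i t \<le> 0"
      unfolding lo_def by (subst ln_le_zero_iff) (auto simp: less_max_iff_disj)
    show "\<bar>lo i t\<bar> \<le> ln (real (Suc i))"
      unfolding lo_def by (rule abs_ln_le) (auto intro: order_trans[of _ 1])
  qed
  have lo_int: "integrable angle_prob (\<lambda>\<theta>. F (cis \<theta>) * - lo i (weight \<theta>))" for i
  proof (rule angle_prob.integrable_const_bound[of _ "B * ln (real (Suc i))"])
    show "AE \<theta> in angle_prob. norm (F (cis \<theta>) * - lo i (weight \<theta>)) \<le> B * ln (real (Suc i))"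
    proof (rule AE_I2)
      fix \<theta>
      show "norm (F (cis \<theta>) * - lo i (weight \<theta>)) \<le> B * ln (real (Suc i))"
        using F(2)[of "cis \<theta>"] FB[of "cis \<theta>"] \<open>B > 0\<close> lo_bounds(2)[of i "weight \<theta>"]
        by (auto simp: abs_mult intro!: mult_mono)
    qed
  qed (simp add: lo_def)
  define m where "m i = (\<integral>\<theta>. F (cis \<theta>) * - lo i (weight \<theta>) \<partial>angle_prob)" for i
  have m0: "0 \<le> m i" for i
    unfolding m_def using F(2) lo_bounds(1)
    by (intro Bochner_Integration.integral_nonneg mult_nonneg_nonneg) auto
  have "(\<lambda>i. \<integral>\<^sup>+\<theta>. ennreal (F (cis \<theta>) * - lo i (weight \<theta>)) \<partial>angle_prob) \<longlonglongrightarrow> NN"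
    unfolding NN_def
  proof (rule nn_integral_LIMSEQ)
    show "incseq (\<lambda>i \<theta>. ennreal (F (cis \<theta>) * - lo i (weight \<theta>)))"
    proof (intro incseq_SucI le_funI ennreal_leI mult_left_mono F(2))
      fix i \<theta>
      have "1 / real (Suc (Suc i)) \<le> 1 / real (Suc i)"
        by (simp add: field_simps)
      then have "max (1 / real (Suc (Suc i))) (min 1 (weight \<theta>)) \<le> max (1 / real (Suc i)) (min 1 (weight \<theta>))"
        by (intro max.mono) auto
      then have "lo (Suc i) (weight \<theta>) \<le> lo i (weight \<theta>)"
        unfolding lo_def by (subst ln_le_cancel_iff) (auto simp: less_max_iff_disj)
      then show "- lo i (weight \<theta>) \<le> - lo (Suc i) (weight \<theta>)"
        by simp
    qed
    show "(\<lambda>i. ennreal (F (cis \<theta>) * - lo i (weight \<theta>))) \<longlonglongrightarrow>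
        e2ennreal (- (ereal (F (cis \<theta>)) * ln_ext (weight \<theta>)))" for \<theta>
      unfolding lo_def by (rule neg_log_truncation_limit) (use F(2) in auto)
  qed (simp add: lo_def)
  moreover have "(\<integral>\<^sup>+\<theta>. ennreal (F (cis \<theta>) * - lo i (weight \<theta>)) \<partial>angle_prob) = ennreal (m i)" for i
    unfolding m_def using lo_int F(2) lo_bounds(1)
    by (intro nn_integral_eq_integral AE_I2 mult_nonneg_nonneg) auto
  ultimately have m_lim: "(\<lambda>i. ennreal (m i)) \<longlonglongrightarrow> NN"
    by simp

  show ?thesis
    unfolding Zn
  proof (rule order_tendstoI)
    fix a assume a: "Z_functional f \<mu> < a"
    \<comment> \<open>The upper bounds obtained with truncation parameter \<open>Suc i\<close>.\<close>
    let ?x = "\<lambda>i. ereal (p / 2 + B / real (Suc i)) - ereal (m i / 2)"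
    have "?x \<longlonglongrightarrow> Z_functional f \<mu>"
    proof -
      have "(\<lambda>i. enn2ereal (ennreal (1 / 2) * ennreal (m i))) \<longlonglongrightarrow> enn2ereal (ennreal (1 / 2) * NN)"
        unfolding tendsto_enn2ereal_iff by (rule ennreal_tendsto_cmult[OF ennreal_less_top m_lim])
      moreover have "enn2ereal (ennreal (1 / 2) * ennreal (m i)) = ereal (m i / 2)" for i
        using m0[of i] by (simp add: ennreal_mult[symmetric] del: ennreal_half)
      ultimately have 1: "(\<lambda>i. ereal (m i / 2)) \<longlonglongrightarrow> enn2ereal (ennreal (1 / 2) * NN)"
        by (simp only:)
      have "(\<lambda>i. p / 2 + B / real (Suc i)) \<longlonglongrightarrow> p / 2 + 0"
        by (intro tendsto_intros LIMSEQ_Suc[OF lim_const_over_n])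
      then have 2: "(\<lambda>i. ereal (- (p / 2 + B / real (Suc i)))) \<longlonglongrightarrow> ereal (- (p / 2))"
        by (intro tendsto_ereal tendsto_minus) simp
      have "(\<lambda>i. ereal (- (p / 2 + B / real (Suc i))) + ereal (m i / 2)) \<longlonglongrightarrow>
          ereal (- (p / 2)) + enn2ereal (ennreal (1 / 2) * NN)"
        using enn2ereal_nonneg[of "ennreal (1 / 2) * NN"]
        by (intro tendsto_add_ereal_nonneg 1 2) auto
      then have "(\<lambda>i. - (ereal (- (p / 2 + B / real (Suc i))) + ereal (m i / 2))) \<longlonglongrightarrow>
          - (ereal (- (p / 2)) + enn2ereal (ennreal (1 / 2) * NN))"
        by (rule tendsto_uminus_ereal)
      moreover have "- (ereal (- (p / 2)) + enn2ereal (ennreal (1 / 2) * NN)) = Z_functional f \<mu>"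
        unfolding Z by (cases "enn2ereal (ennreal (1 / 2) * NN)") auto
      ultimately show ?thesis
        by (simp add: algebra_simps)
    qed
    then have "\<forall>\<^sub>F i in sequentially. ?x i < a"
      using a by (rule order_tendstoD(2))
    then obtain i where "?x i < a"
      by (auto simp: eventually_sequentially)
    then obtain r where r: "?x i < ereal r" "ereal r < a"
      using ereal_dense2 by blast
    define e where "e = 2 * (r - (p / 2 + B / real (Suc i) - m i / 2))"
    have "e > 0"
      using r(1) by (simp add: e_def)
    let ?k = "real (Suc i)"
    have "(\<integral>\<theta>. F (cis \<theta>) * ln (trunc ?k (weight \<theta>)) \<partial>angle_prob) \<le>
        (\<integral>\<theta>. F (cis \<theta>) * ln (max 1 (weight \<theta>)) - F (cis \<theta>) * - lo i (weight \<theta>) \<partial>angle_prob)"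
    proof (rule integral_mono)
      have tk: "1 / ?k \<le> trunc ?k t" "trunc ?k t \<le> ?k" for t
        using trunc_bounds[of ?k t] by auto
      show "integrable angle_prob (\<lambda>\<theta>. F (cis \<theta>) * ln (trunc ?k (weight \<theta>)))"
      proof (rule angle_prob.integrable_const_bound[of _ "B * ln ?k"])
        show "AE \<theta> in angle_prob. norm (F (cis \<theta>) * ln (trunc ?k (weight \<theta>))) \<le> B * ln ?k"
        proof (rule AE_I2)
          fix \<theta>
          show "norm (F (cis \<theta>) * ln (trunc ?k (weight \<theta>))) \<le> B * ln ?k"
            using F(2)[of "cis \<theta>"] FB[of "cis \<theta>"] \<open>B > 0\<close> abs_ln_le[OF _ tk, of "weight \<theta>"]
            by (auto simp: abs_mult intro!: mult_mono)
        qed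
      qed (simp add: trunc_def)
      fix \<theta>
      have "ln (trunc ?k t) \<le> ln (max 1 t) + lo i t" if "0 \<le> t" for t
      proof (cases "t \<le> 1")
        case True
        then show ?thesis
          by (simp add: trunc_def lo_def min_def max_def)
      next
        case False
        then have "lo i t = 0"
          by (simp add: lo_def max_def)
        moreover have "trunc ?k t \<le> t"
          using False by (auto simp: trunc_def intro: order_trans[of _ 1])
        then have "ln (trunc ?k t) \<le> ln t"
          using trunc_pos[of ?k t] by simp
        ultimately show ?thesis
          using False by (simp add: max_def)
      qed
      then have "F (cis \<theta>) * ln (trunc ?k (weight \<theta>)) \<le> F (cis \<theta>) * (ln (max 1 (weight \<theta>)) + lo i (weight \<theta>))"
        using F(2) by (intro mult_left_mono) auto
      then show "F (cis \<theta>) * ln (trunc ?k (weight \<theta>)) \<le>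
          F (cis \<theta>) * ln (max 1 (weight \<theta>)) - F (cis \<theta>) * - lo i (weight \<theta>)"
        by (simp add: algebra_simps)
    qed (intro Bochner_Integration.integrable_diff pos_int lo_int)+
    also have "\<dots> = p - m i"
      unfolding p_def m_def by (rule Bochner_Integration.integral_diff[OF pos_int lo_int])
    finally have bound: "(\<integral>\<theta>. F (cis \<theta>) * ln (trunc ?k (weight \<theta>)) \<partial>angle_prob) \<le> p - m i" .
    have "\<forall>\<^sub>F n in sequentially. ?L n \<le> (\<integral>\<theta>. F (cis \<theta>) * ln (trunc ?k (weight \<theta>)) \<partial>angle_prob) + 2 * B / ?k + e"
      using F FB \<open>e > 0\<close> by (intro log_weight_upper) auto
    then show "\<forall>\<^sub>F n in sequentially. ereal (?L n / 2) < a"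
    proof eventually_elim
      case (elim n)
      have "?L n \<le> p - m i + 2 * (B / ?k) + e"
        using elim bound by simp
      then have "?L n / 2 \<le> r"
        by (simp add: e_def)
      then show ?case
        using r(2) by (meson ereal_less_eq(3) le_less_trans)
    qed
  next
    fix a assume a: "a < Z_functional f \<mu>"
    have NN: "NN \<noteq> \<infinity>"
    proof
      assume "NN = \<infinity>"
      then have "Z_functional f \<mu> = -\<infinity>"
        unfolding Z by (simp add: ennreal_mult_top)
      then show False
        using a by simp
    qed
    have m_N: "(\<lambda>\<theta>. e2ennreal (- (ereal (F (cis \<theta>)) * ln_ext (weight \<theta>)))) \<in> borel_measurable angle_prob"
      by measurable
    have "AE \<theta> in angle_prob. e2ennreal (- (ereal (F (cis \<theta>)) * ln_ext (weight \<theta>))) \<noteq> \<infinity>"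
      using nn_integral_PInf_AE[OF m_N] NN by (simp add: NN_def)
    with nz have w: "AE \<theta> in angle_prob. 0 < weight \<theta>"
    proof eventually_elim
      case (elim \<theta>)
      show ?case
      proof (rule ccontr)
        assume "\<not> 0 < weight \<theta>"
        then have "weight \<theta> = 0"
          using weight_nonneg[of \<theta>] by linarith
        moreover have "F (cis \<theta>) > 0"
          using elim(1) by (simp add: F_def)
        ultimately show False
          using elim(2) by (simp add: ln_ext_def)
      qed
    qed
    have Fw: "integrable angle_prob (\<lambda>\<theta>. F (cis \<theta>) * ln (weight \<theta>))"
      unfolding real_integrable_def
    proof (intro conjI)
      have "(\<integral>\<^sup>+\<theta>. ennreal (F (cis \<theta>) * ln (weight \<theta>)) \<partial>angle_prob) \<le>
          (\<integral>\<^sup>+\<theta>. ennreal (F (cis \<theta>) * ln (max 1 (weight \<theta>))) \<partial>angle_prob)"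
      proof (rule nn_integral_mono_AE)
        show "AE \<theta> in angle_prob. ennreal (F (cis \<theta>) * ln (weight \<theta>)) \<le> ennreal (F (cis \<theta>) * ln (max 1 (weight \<theta>)))"
          using w by eventually_elim (use F(2) in \<open>auto intro!: ennreal_leI mult_left_mono\<close>)
      qed
      also have "\<dots> = ennreal p"
        unfolding p_def using pos_int F(2) by (intro nn_integral_eq_integral) auto
      finally show "(\<integral>\<^sup>+\<theta>. ennreal (F (cis \<theta>) * ln (weight \<theta>)) \<partial>angle_prob) \<noteq> \<infinity>"
        by (auto simp: top_unique)
      have "(\<integral>\<^sup>+\<theta>. ennreal (- (F (cis \<theta>) * ln (weight \<theta>))) \<partial>angle_prob) = NN"
        unfolding NN_def
        by (rule nn_integral_cong_AE) (use w in \<open>eventually_elim; simp add: ln_ext_def\<close>)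
      then show "(\<integral>\<^sup>+\<theta>. ennreal (- (F (cis \<theta>) * ln (weight \<theta>))) \<partial>angle_prob) \<noteq> \<infinity>"
        using NN by simp
    qed simp
    let ?I = "\<integral>\<theta>. F (cis \<theta>) * ln (weight \<theta>) \<partial>angle_prob"
    have "Z_functional f \<mu> = ereal (?I / 2)"
      unfolding F_def
    proof (rule Z_functional_integrable[OF fm wm])
      show "AE \<theta> in angle_prob. ac_weight \<mu> \<theta> = weight \<theta> \<and> 0 < weight \<theta>"
        using w AE_space by eventually_elim (simp add: weight_eq)
    qed (use Fw in \<open>simp add: F_def\<close>)
    then obtain r where r: "a < ereal r" "r < ?I / 2"
      using a ereal_dense2[of a "ereal (?I / 2)"] by auto
    have "\<forall>\<^sub>F n in sequentially. ?I - (?I - 2 * r) \<le> ?L n"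
      using F r(2) by (intro log_weight_lower w Fw) auto
    then show "\<forall>\<^sub>F n in sequentially. a < ereal (?L n / 2)"
    proof eventually_elim
      case (elim n)
      then have "r \<le> ?L n / 2"
        by simp
      then show ?case
        using r(1) by (meson ereal_less_eq(3) less_le_trans)
    qed
  qed
qed

end

theorem proposition3p4:
  fixes f :: "complex \<Rightarrow> complex" and g :: "complex \<Rightarrow> real"
    and Q :: "complex poly" and \<mu> :: "complex measure"
  assumes "continuous_on (sphere 0 1) g"
    and "\<And>z. z \<in> sphere 0 1 \<Longrightarrow> g z > 0"
    and "\<And>z. z \<in> sphere 0 1 \<Longrightarrow> f z = complex_of_real (g z) * poly Q z"
    and "nontrivial_circle_prob \<mu>"
  shows "(\<lambda>n. Z_functional f (bernstein_szego \<mu> n)) \<longlonglongrightarrow> Z_functional f \<mu>"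
proof (cases "Q = 0")
  case True
  then have "f (cis \<theta>) = 0" for \<theta>
    using assms(3) by simp
  then have "Z_functional f \<kappa> = 0" for \<kappa>
    by (simp add: Z_functional_def ereal_integral_def e2ennreal_neg flip: zero_ereal_def)
  then show ?thesis
    by simp
next
  case False
  interpret nontrivial_circle \<mu>
    by unfold_locales fact
  show ?thesis
  proof (rule Z_functional_tendsto)
    have "continuous_on (sphere 0 1) (\<lambda>z. (norm (complex_of_real (g z) * poly Q z))\<^sup>2)"
      by (intro continuous_intros assms(1))
    then show "continuous_on (sphere 0 1) (\<lambda>z. (norm (f z))\<^sup>2)"
      by (rule continuous_on_eq) (simp add: assms(3))
    show "AE \<theta> in angle_prob. f (cis \<theta>) \<noteq> 0"
      using AE_poly_circle_neq_0[OF False]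
    proof eventually_elim
      case (elim \<theta>)
      then show ?case
        using assms(2)[of "cis \<theta>"] assms(3)[of "cis \<theta>"] by simp
    qed
  qed
qed

end
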